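(* Let $p$ be a prime number such that $p=1+16a^2$ for some integer $a$. Then there exists a hemisystem of the Hermitian surface $\mathcal U_3$ of $\mathrm{PG}(3,p^2)$ which is left invariant by a subgroup of $\mathrm{PGU}(4,p)$ isomorphic to $\mathrm{PSL}(2,p)\times C_{(p+1)/2}$, where $C_{(p+1)/2}$ denotes the cyclic group of order $(p+1)/2$.
   Context: For a prime power $q$, the Hermitian surface $\mathcal U_3$ of $\mathrm{PG}(3,q^2)$ is the set of self-conjugate points of a non-degenerate unitary polarity; up to coordinates it is $X_0^{q+1}+X_1^{q+1}+X_2^{q+1}+X_3^{q+1}=0$, and $\mathrm{PGU}(4,q)$ is the group of linear collineations preserving it. A generator of $\mathcal U_3$ is a line of $\mathrm{PG}(3,q^2)$ contained in $\mathcal U_3$; there are $(q^3+1)(q+1)$ generators and $q+1$ of them pass through each point of $\mathcal U_3$. For $q$ odd, a hemisystem of $\mathcal U_3$ is a set of $\frac12(q^3+1)(q+1)$ generators such that exactly $\frac12(q+1)$ of them pass through each point of $\mathcal U_3$ (in $\mathrm{PG}(3,q^2)$). A group of collineations leaves a hemisystem invariant if it maps the set of generators onto itself. *)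

theory Defs
  imports "HOL-Analysis.Analysis" "HOL-Algebra.Elementary_Groups"
begin

definition GL :: "('a::field^'n^'n) monoid" where
  "GL = \<lparr>carrier = {A. invertible A}, monoid.mult = (**), one = mat 1\<rparr>"

definition SL :: "('a::field^'n^'n) monoid" where
  "SL = \<lparr>carrier = {A. det A = 1}, monoid.mult = (**), one = mat 1\<rparr>"

definition scalars :: "('a::field^'n^'n) set" where
  "scalars = {mat c | c. c \<noteq> 0}"

definition PGL :: "('a::field^'n^'n) set monoid" where
  "PGL = GL Mod scalars"

definition PSL :: "('a::field^'n^'n) set monoid" where
  "PSL = SL Mod (scalars \<inter> carrier SL)"

text \<open>Points and lines of the projective space are the subspaces of vector space dimension 1
  and 2 of the coordinate space; incidence is inclusion.\<close>

definition pg_points :: "('a::field^'n) set set" where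
  "pg_points = {P. vec.subspace P \<and> vec.dim P = 1}"

definition pg_lines :: "('a::field^'n) set set" where
  "pg_lines = {L. vec.subspace L \<and> vec.dim L = 2}"

definition collin :: "'a::field^'n^'n \<Rightarrow> ('a^'n) set \<Rightarrow> ('a^'n) set" where
  "collin g S = (\<lambda>x. g *v x) ` S"

text \<open>In the following the field is meant to have order \<open>q\<^sup>2\<close>, so that its involutory automorphism
  is \<open>x \<mapsto> x ^ q\<close>. A non-degenerate unitary polarity is given by the Gram matrix \<open>H\<close>
  of a non-degenerate Hermitian form.\<close>

definition nondeg_hermitian :: "nat \<Rightarrow> 'a::field^'n^'n \<Rightarrow> bool" where
  "nondeg_hermitian q H \<longleftrightarrow> (\<forall>i j. (H $ i $ j) ^ q = H $ j $ i) \<and> det H \<noteq> 0"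

definition hform :: "nat \<Rightarrow> 'a::field^'n^'n \<Rightarrow> 'a^'n \<Rightarrow> 'a^'n \<Rightarrow> 'a" where
  "hform q H x y = (\<Sum>i\<in>UNIV. \<Sum>j\<in>UNIV. x $ i * H $ i $ j * (y $ j) ^ q)"

definition polar :: "nat \<Rightarrow> 'a::field^'n^'n \<Rightarrow> ('a^'n) set \<Rightarrow> ('a^'n) set" where
  "polar q H S = {y. \<forall>x\<in>S. hform q H x y = 0}"

definition herm_points :: "nat \<Rightarrow> 'a::field^'n^'n \<Rightarrow> ('a^'n) set set" where
  "herm_points q H = {P \<in> pg_points. P \<subseteq> polar q H P}"

definition generators :: "nat \<Rightarrow> 'a::field^4^4 \<Rightarrow> ('a^4) set set" where
  "generators q H = {L \<in> pg_lines. \<forall>P\<in>pg_points. P \<subseteq> L \<longrightarrow> P \<in> herm_points q H}"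

definition hemisystem :: "nat \<Rightarrow> 'a::field^4^4 \<Rightarrow> ('a^4) set set \<Rightarrow> bool" where
  "hemisystem q H M \<longleftrightarrow>
     odd q \<and> M \<subseteq> generators q H \<and>
     card M = (q ^ 3 + 1) * (q + 1) div 2 \<and>
     (\<forall>P\<in>herm_points q H. card {L \<in> M. P \<subseteq> L} = (q + 1) div 2)"

text \<open>An element of PGL is a coset \<open>C\<close> of the scalar matrices, and all matrices in \<open>C\<close> induce the
  same map on subspaces; hence the quantifier over \<open>g \<in> C\<close> amounts to picking a representative.\<close>

definition preserves :: "('a::field^'n^'n) set \<Rightarrow> ('a^'n) set set \<Rightarrow> bool" where
  "preserves C M \<longleftrightarrow> (\<forall>g\<in>C. collin g ` M = M)"

definition PGU :: "nat \<Rightarrow> 'a::field^'n^'n \<Rightarrow> ('a^'n^'n) set monoid" where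
  "PGU q H = PGL\<lparr>carrier := {C \<in> carrier PGL. preserves C (herm_points q H)}\<rparr>"


lemma GL_simps [simp]:
  "carrier GL = {A. invertible A}" "monoid.mult GL = (**)" "one GL = mat 1"
  by (simp_all add: GL_def)

lemma SL_simps [simp]:
  "carrier SL = {A. det A = 1}" "monoid.mult SL = (**)" "one SL = mat 1"
  by (simp_all add: SL_def)

lemma group_GL: "group (GL :: ('a::field^'n^'n) monoid)"
proof (rule groupI)
  fix A :: "'a^'n^'n" assume "A \<in> carrier GL"
  then show "\<exists>B\<in>carrier GL. B \<otimes>\<^bsub>GL\<^esub> A = \<one>\<^bsub>GL\<^esub>"
    by (auto simp: invertible_def)
next
  show "\<one>\<^bsub>GL\<^esub> \<in> carrier (GL :: ('a^'n^'n) monoid)" by (simp add: invertible_det_nz)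
qed (auto simp: invertible_mult matrix_mul_assoc)

lemma SL_subgroup_GL: "subgroup {A. det A = 1} (GL :: ('a::field^'n^'n) monoid)"
proof (rule group.subgroupI[OF group_GL])
  fix A :: "'a^'n^'n" assume A: "A \<in> {A. det A = 1}"
  then have "A \<in> carrier GL" by (simp add: invertible_det_nz)
  then have "A ** inv\<^bsub>GL\<^esub> A = mat 1"
    using group.r_inv[OF group_GL] by fastforce
  then have "det A * det (inv\<^bsub>GL\<^esub> A) = 1" by (metis det_I det_mul)
  then show "inv\<^bsub>GL\<^esub> A \<in> {A. det A = 1}" using A by simp
next
  show "{A :: 'a^'n^'n. det A = 1} \<noteq> {}" using det_I by blast
qed (auto simp: invertible_det_nz det_mul)

lemma group_SL: "group (SL :: ('a::field^'n^'n) monoid)"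
proof -
  have "SL = (GL :: ('a^'n^'n) monoid)\<lparr>carrier := {A. det A = 1}\<rparr>"
    by (simp add: SL_def GL_def)
  then show ?thesis
    using group.subgroup_imp_group[OF group_GL SL_subgroup_GL] by metis
qed

lemma mat_mult_left: "mat c ** (A :: 'a::field^'n^'n) = (\<chi> i j. c * A $ i $ j)"
  by (simp add: matrix_matrix_mult_def mat_def vec_eq_iff if_distrib if_distribR cong: if_cong)

lemma mat_mult_right: "(A :: 'a::field^'n^'n) ** mat c = (\<chi> i j. c * A $ i $ j)"
  by (simp add: matrix_matrix_mult_def mat_def vec_eq_iff if_distrib if_distribR mult.commute cong: if_cong)

lemma mat_commute: "mat c ** (A :: 'a::field^'n^'n) = A ** mat c"
  by (simp add: mat_mult_left mat_mult_right)

lemma mat_mult_mat: "mat c ** (mat d :: 'a::field^'n^'n) = mat (c * d)"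
  by (simp add: mat_mult_left) (simp add: mat_def vec_eq_iff)

lemma scalars_subgroup_GL: "subgroup scalars (GL :: ('a::field^'n^'n) monoid)"
proof (rule group.subgroupI[OF group_GL])
  have inv: "mat c ** (mat (inverse c) :: 'a^'n^'n) = mat 1" "mat (inverse c) ** (mat c :: 'a^'n^'n) = mat 1"
    if "c \<noteq> 0" for c using that by (simp_all add: mat_mult_mat)
  show sub: "scalars \<subseteq> carrier (GL :: ('a^'n^'n) monoid)"
  proof
    fix A :: "'a^'n^'n" assume "A \<in> scalars"
    then obtain c where "c \<noteq> 0" "A = mat c" by (auto simp: scalars_def)
    then have "A ** mat (inverse c) = mat 1 \<and> mat (inverse c) ** A = mat 1" using inv by simp
    then show "A \<in> carrier GL" unfolding GL_simps mem_Collect_eq invertible_def by (rule exI)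
  qed
  fix A :: "'a^'n^'n" assume "A \<in> scalars"
  then obtain c where c: "c \<noteq> 0" "A = mat c" by (auto simp: scalars_def)
  have ic: "mat (inverse c) \<in> (scalars :: ('a^'n^'n) set)"
    unfolding scalars_def mem_Collect_eq by (rule exI[of _ "inverse c"]) (simp add: c)
  have "inv\<^bsub>GL\<^esub> A = mat (inverse c)"
  proof (rule group.inv_equality[OF group_GL])
    show "mat (inverse c) \<otimes>\<^bsub>GL\<^esub> A = \<one>\<^bsub>GL\<^esub>" using c inv(2)[of c] by simp
  qed (use sub ic \<open>A \<in> scalars\<close> in blast)+
  then show "inv\<^bsub>GL\<^esub> A \<in> scalars" using ic by simp
next
  have "mat 1 \<in> (scalars :: ('a^'n^'n) set)"
    unfolding scalars_def mem_Collect_eq by (rule exI[of _ 1]) simp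
  then show "(scalars :: ('a^'n^'n) set) \<noteq> {}" by (metis empty_iff)
next
  fix A B :: "'a^'n^'n" assume "A \<in> scalars" "B \<in> scalars"
  then obtain c d where "c \<noteq> 0" "d \<noteq> 0" "A = mat c" "B = mat d" by (auto simp: scalars_def)
  then have "A \<otimes>\<^bsub>GL\<^esub> B = mat (c * d) \<and> c * d \<noteq> 0" by (simp add: mat_mult_mat)
  then show "A \<otimes>\<^bsub>GL\<^esub> B \<in> scalars" unfolding scalars_def mem_Collect_eq by (rule exI)
qed

lemma scalars_normal_GL: "scalars \<lhd> (GL :: ('a::field^'n^'n) monoid)"
proof (rule group.normalI[OF group_GL scalars_subgroup_GL], rule ballI)
  fix A :: "'a^'n^'n"
  show "scalars #>\<^bsub>GL\<^esub> A = A <#\<^bsub>GL\<^esub> scalars"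
    unfolding r_coset_def l_coset_def GL_simps
    by (rule SUP_cong[OF refl]) (auto simp: scalars_def mat_commute)
qed

lemma group_PGL: "group (PGL :: ('a::field^'n^'n) set monoid)"
  unfolding PGL_def by (rule normal.factorgroup_is_group[OF scalars_normal_GL])

lemma PGU_subgroup_PGL: "subgroup (carrier (PGU q H)) (PGL :: ('a::field^'n^'n) set monoid)"
proof (rule group.subgroupI[OF group_PGL])
  let ?U = "herm_points q H"
  have one: "collin (mat 1) ` N = N" for N :: "('a^'n) set set"
    by (simp add: collin_def image_image)
  have mul: "collin (g ** h) ` N = collin g ` collin h ` N" for g h :: "'a^'n^'n" and N
    by (simp add: collin_def image_image matrix_vector_mul_assoc)
  have sc: "collin (mat c) S = S" if "c \<noteq> 0" "vec.subspace S" for c and S :: "('a^'n) set"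
  proof -
    have m: "mat c *v x = c *s x" for x :: "'a^'n"
      by (simp add: matrix_vector_mult_def mat_def vec_eq_iff if_distrib if_distribR cong: if_cong)
    have "x \<in> (*s) c ` S" if "x \<in> S" for x
      using that \<open>c \<noteq> 0\<close> vec.subspace_scale[OF \<open>vec.subspace S\<close>, of x "inverse c"]
      by (intro image_eqI[of _ _ "inverse c *s x"]) auto
    then show ?thesis
      using vec.subspace_scale[OF \<open>vec.subspace S\<close>] by (auto simp: collin_def m)
  qed
  have scU: "collin (mat c) ` ?U = ?U" if "c \<noteq> 0" for c
    using sc[OF that] by (force simp: herm_points_def pg_points_def)
  show "carrier (PGU q H) \<subseteq> carrier PGL" by (auto simp: PGU_def)
  have "preserves (\<one>\<^bsub>PGL\<^esub>) ?U"
    using scU by (auto simp: preserves_def PGL_def FactGroup_def scalars_def)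
  then have "\<one>\<^bsub>PGL\<^esub> \<in> carrier (PGU q H)"
    using monoid.one_closed[OF group.is_monoid[OF group_PGL]] by (simp add: PGU_def)
  then show "carrier (PGU q H) \<noteq> {}" by (metis empty_iff)
  fix C D assume C: "C \<in> carrier (PGU q H)"
  then have C': "C \<in> carrier PGL" "preserves C ?U" by (auto simp: PGU_def)
  show "inv\<^bsub>PGL\<^esub> C \<in> carrier (PGU q H)"
  proof -
    have "inv\<^bsub>PGL\<^esub> C = set_inv\<^bsub>GL\<^esub> C"
      using C'(1) normal.inv_FactGroup[OF scalars_normal_GL] unfolding PGL_def by blast
    moreover have "collin (inv\<^bsub>GL\<^esub> g) ` ?U = ?U" if "g \<in> C" for g
    proof -
      have "g \<in> carrier GL"
        using that C'(1) subgroup.rcosets_carrier[OF scalars_subgroup_GL group_GL, of C]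
        unfolding PGL_def FactGroup_def by auto
      then have "inv\<^bsub>GL\<^esub> g ** g = mat 1" using group.l_inv[OF group_GL] by fastforce
      then have "?U = collin (inv\<^bsub>GL\<^esub> g) ` collin g ` ?U" by (metis one mul)
      then show ?thesis using that C'(2) unfolding preserves_def by metis
    qed
    ultimately have "preserves (inv\<^bsub>PGL\<^esub> C) ?U"
      unfolding preserves_def SET_INV_def by auto
    then show ?thesis
      using group.inv_closed[OF group_PGL C'(1)] by (simp add: PGU_def)
  qed
  assume "D \<in> carrier (PGU q H)"
  then have D': "D \<in> carrier PGL" "preserves D ?U" by (auto simp: PGU_def)
  have "preserves (C \<otimes>\<^bsub>PGL\<^esub> D) ?U"
    unfolding preserves_def
  proof
    fix k assume "k \<in> C \<otimes>\<^bsub>PGL\<^esub> D"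
    then obtain g h where "g \<in> C" "h \<in> D" "k = g ** h"
      by (auto simp: PGL_def FactGroup_def set_mult_def)
    then show "collin k ` ?U = ?U" using C'(2) D'(2) by (simp add: mul preserves_def)
  qed
  then show "C \<otimes>\<^bsub>PGL\<^esub> D \<in> carrier (PGU q H)"
    using monoid.m_closed[OF group.is_monoid[OF group_PGL] C'(1) D'(1)] by (simp add: PGU_def)
qed

lemma group_PSL: "group (PSL :: ('a::field^'n^'n) set monoid)"
proof -
  have SL: "SL = (GL :: ('a^'n^'n) monoid)\<lparr>carrier := {A. det A = 1}\<rparr>"
    by (simp add: SL_def GL_def)
  have "scalars \<inter> {A. det A = 1} \<lhd> (SL :: ('a^'n^'n) monoid)" unfolding SL
    by (rule group.normal_Int_subgroup[OF group_GL SL_subgroup_GL scalars_normal_GL])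
  then show ?thesis unfolding PSL_def
    by (simp add: normal.factorgroup_is_group)
qed

text \<open>For the identity Gram matrix one obtains the familiar equation.\<close>

lemma herm_points_mat_1:
  fixes x :: "'a::field^'n"
  assumes "x \<noteq> 0"
  shows "vec.span {x} \<in> herm_points q (mat 1) \<longleftrightarrow> (\<Sum>i\<in>UNIV. (x $ i) ^ (q + 1)) = 0"
proof -
  have h: "hform q (mat 1) u v = (\<Sum>i\<in>UNIV. u $ i * (v $ i) ^ q)" for u v :: "'a^'n"
    by (simp add: hform_def mat_def if_distrib if_distribR cong: if_cong)
  let ?s = "\<Sum>i\<in>UNIV. (x $ i) ^ (q + 1)"
  have eq: "hform q (mat 1) (c *s x) (d *s x) = c * d ^ q * ?s" for c d
    by (simp add: h sum_distrib_left power_mult_distrib algebra_simps)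
  have dim: "vec.dim (vec.span {x}) = 1"
    using assms by (simp add: vec.dim_eq_card_independent)
  have "vec.span {x} \<in> herm_points q (mat 1) \<longleftrightarrow>
      (\<forall>u\<in>vec.span {x}. \<forall>v\<in>vec.span {x}. hform q (mat 1) u v = 0)"
    using dim by (auto simp: herm_points_def pg_points_def polar_def)
  also have "\<dots> \<longleftrightarrow> (\<forall>c d. c * d ^ q * ?s = 0)"
    unfolding vec.span_singleton ball_simps eq[symmetric] by simp
  also have "\<dots> \<longleftrightarrow> ?s = 0"
  proof
    assume "\<forall>c d. c * d ^ q * ?s = 0"
    then have "1 * 1 ^ q * ?s = 0" by blast
    then show "?s = 0" by simp
  qed simp
  finally show ?thesis .
qed

end

theory Submission
  imports "HOL-Algebra.Algebraic_Closure_Type" "HOL-Number_Theory.Residues" Defs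
begin

text \<open>Write the four-dimensional space as a line plus the space of binary quadratic forms \<open>w\<close> over
  the field of order \<open>p\<^sup>2\<close>, with the Hermitian form \<open>B(w, w') - x x'\<close> (second argument conjugated),
  where \<open>B\<close> is the discriminant form; it is invariant under \<open>SL(2,p)\<close>. A generator is spanned by
  \<open>(0, u)\<close> and \<open>(1, w)\<close>, where \<open>u\<close> is a point of the Hermitian curve and \<open>w\<close> is a unit vector
  orthogonal to \<open>u\<close>; given \<open>u\<close>, the vector \<open>w\<close> is unique modulo \<open>u\<close> up to factors of norm one.
  Put \<open>m = (p + 1)/2\<close>, which is odd. A system of generators that contains half of the generators on
  each \<open>u\<close> and is invariant under multiplication of \<open>w\<close> by \<open>m\<close>-th roots of unity is a choice of a
  sign for every flag \<open>(u, w)\<close> that changes under \<open>w \<mapsto> - w\<close>, and it is a hemisystem iff for each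
  unit vector \<open>w\<close> the signs of the \<open>p + 1\<close> flags \<open>(u, w)\<close> cancel.

  If the roots of \<open>u\<close> do not lie in the field, the sign tells on which of the two Fuhrmann-Torres
  curves \<open>x ^ m = \<plusminus>(t ^ p - t)\<close> the points \<open>(w(t), t)\<close> with \<open>u(t) = 0\<close> lie. The plane orthogonal to
  \<open>(1, w)\<close> meets both curves in \<open>p + 1\<close> points, and every other \<open>u\<close> contributes equally to both,
  so these signs cancel. The remaining signs are invariant under \<open>PGL(2,p)\<close>, and a half turn about a
  rational vector orthogonal to \<open>w\<close> maps \<open>w\<close> to \<open>- w\<close>, so they cancel too. The exception is when
  the only such vector is isotropic. Then one point \<open>u\<close> lies on the rational conic, and the others
  contribute half the Jacobsthal sum of \<open>x\<^sup>3 - x\<close>. This is the odd number \<open>A\<close> in \<open>p = A\<^sup>2 + B\<^sup>2\<close>, thus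
  \<open>\<plusminus>1\<close> if \<open>p = 1 + 16 a\<^sup>2\<close>, and it is cancelled by a suitable sign for the points of the conic.\<close>

text \<open>The obstacle is the points \<open>u\<close> with two distinct roots in the field of
  order \<open>p ^ 2\<close>: one root lies on each of the two curves, so the curves give such a
  \<open>u\<close> no sign. Its sign is read instead from the determinant of \<open>u\<close>, its
  conjugate and \<open>w\<close>, whose norm is \<open>-2\<close> times the norm of
  \<open>bil u u\<close>; for \<open>u\<close> on the rational conic it is read from an eigenvalue
  of norm \<open>-2\<close>. In both cases the \<open>m\<close>-th power is, up to a known factor, a
  square root of \<open>-2\<close>. The two reference roots \<open>\<kappa>\<close> and
  \<open>\<kappa>'\<close> are independent: replacing \<open>\<kappa>'\<close> by its negative
  reverses all signs on the conic and no others. On an exceptional line a single conic point has to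
  outweigh all other real points, so their signs must add up to \<open>1\<close> or
  \<open>-1\<close>; hence the condition that the odd number \<open>A\<close> be a unit. The curves
  are invariant under determinant one, while a non-square determinant exchanges them; this is why
  \<open>PSL(2,p)\<close> survives and not \<open>PGL(2,p)\<close>. The cyclic factor scales the
  coordinate outside the forms; \<open>p mod 4 = 1\<close> makes \<open>m\<close> odd, so that
  \<open>-1\<close> is no \<open>m\<close>-th root of unity.\<close>

no_notation fps_nth (infixl "$" 75)

section \<open>Finite fields\<close>

lemma finite_power_eq:
  fixes c :: "'a::field"
  assumes "n > 0"
  shows "finite {x. x ^ n = c}" "card {x. x ^ n = c} \<le> n"
proof -
  define f where "f = Polynomial.monom (1::'a) n - [:c:]"
  have "Polynomial.coeff f n = 1"
    using assms by (cases n) (simp_all add: f_def)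
  then have nz: "f \<noteq> 0" by auto
  have deg: "Polynomial.degree f \<le> n"
    unfolding f_def by (rule degree_diff_le) (simp_all add: degree_monom_le)
  have "{x. x ^ n = c} = {x. poly f x = 0}"
    by (simp add: f_def poly_monom)
  then show "finite {x. x ^ n = c}" "card {x. x ^ n = c} \<le> n"
    using poly_roots_finite[OF nz] card_poly_roots_bound[OF nz] deg by simp_all
qed

text \<open>Fibres of size at most \<open>n\<close> over at most \<open>k\<close> values add up to
  at most \<open>n * k\<close>; since this is the size of \<open>A\<close>, no fibre can fall short.
  It turns bounds on numbers of roots into exact counts for powers and traces.\<close>

lemma card_fiber_eq:
  assumes "finite A" "finite C" "f ` A \<subseteq> C" "\<And>c. c \<in> C \<Longrightarrow> card {x\<in>A. f x = c} \<le> n"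
    and "card C \<le> k" "card A = n * k" "c \<in> C"
  shows "card {x\<in>A. f x = c} = n"
proof (rule ccontr)
  assume "card {x\<in>A. f x = c} \<noteq> n"
  then have lt: "card {x\<in>A. f x = c} < n" using assms(4)[OF \<open>c \<in> C\<close>] by simp
  have "A = (\<Union>c\<in>C. {x\<in>A. f x = c})" using assms(3) by auto
  then have "card A = card (\<Union>c\<in>C. {x\<in>A. f x = c})" by simp
  also have "\<dots> = (\<Sum>c\<in>C. card {x\<in>A. f x = c})"
    by (rule card_UN_disjoint) (use assms in auto)
  also have "\<dots> < (\<Sum>c\<in>C. n)"
    by (rule sum_strict_mono_ex1) (use assms lt in auto)
  also have "\<dots> \<le> n * k" using assms(5) by (simp add: mult.commute)
  finally show False using assms(6) by simp
qed

lemma power_CARD_minus_1: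
  fixes x :: "'a::{field,finite}"
  assumes "x \<noteq> 0"
  shows "x ^ (CARD('a) - 1) = 1"
proof -
  have "(\<Prod>y\<in>-{0}. x * y) = (\<Prod>y\<in>-{0::'a}. y)"
    by (rule prod.reindex_bij_witness[of _ "\<lambda>y. y / x" "\<lambda>y. x * y"]) (use assms in auto)
  moreover have "(\<Prod>y\<in>-{0}. x * y) = x ^ (CARD('a) - 1) * (\<Prod>y\<in>-{0::'a}. y)"
    by (simp add: prod.distrib Compl_eq_Diff_UNIV card_Diff_singleton)
  moreover have "(\<Prod>y\<in>-{0::'a}. y) \<noteq> 0" by simp
  ultimately show ?thesis by simp
qed

lemma power_CARD_eq:
  fixes x :: "'a::{field,finite}"
  shows "x ^ CARD('a) = x"
proof (cases "x = 0")
  case False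
  have "x ^ CARD('a) = x ^ (CARD('a) - 1) * x"
    using finite_UNIV_card_ge_0[where 'a='a] by (simp flip: power_Suc2)
  then show ?thesis using power_CARD_minus_1[OF False] by simp
qed (use finite_UNIV_card_ge_0[where 'a='a] in simp)

lemma card_power_eq:
  fixes c :: "'a::{field,finite}"
  assumes "CARD('a) - 1 = n * k" "n > 0" "k > 0" "c ^ k = 1"
  shows "card {x. x ^ n = c} = n"
proof -
  have c: "c \<noteq> 0" using assms by (auto simp: power_0_left)
  have "card {x\<in>-{0}. x ^ n = c} = n"
  proof (rule card_fiber_eq[where C = "{c. c ^ k = 1}" and k = k])
    show "(\<lambda>x. x ^ n) ` (-{0::'a}) \<subseteq> {c. c ^ k = 1}"
      using power_CARD_minus_1[where 'a='a] assms(1) by (auto simp flip: power_mult)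
    show "card {x\<in>-{0}. x ^ n = c} \<le> n" for c :: 'a
      by (rule order_trans[OF card_mono finite_power_eq(2)[of n c]]) (use finite_power_eq(1) assms in auto)
  qed (use assms finite_power_eq in \<open>auto simp: Compl_eq_Diff_UNIV card_Diff_singleton\<close>)
  also have "{x\<in>-{0}. x ^ n = c} = {x. x ^ n = c}" using c assms(2) by (auto simp: power_0_left)
  finally show ?thesis .
qed

lemma power_eq_exists:
  fixes c :: "'a::{field,finite}"
  assumes "CARD('a) - 1 = n * k" "n > 0" "k > 0" "c ^ k = 1"
  obtains x where "x ^ n = c"
proof -
  have "card {x. x ^ n = c} \<noteq> 0" using card_power_eq[OF assms] assms(2) by simp
  then have "{x. x ^ n = c} \<noteq> {}" by (metis card.empty)
  then show thesis using that by blast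
qed

lemma CHAR_of_CARD_prime_power:
  assumes "prime p" "CARD('a::{field,finite}) = p ^ n"
  shows "CHAR('a) = p"
proof -
  have "CHAR('a) > 0" by (rule finite_imp_CHAR_pos) simp
  then have pr: "prime CHAR('a)" by (rule prime_CHAR_semidom)
  have "CHAR('a) dvd p ^ n" using CHAR_dvd_CARD[where 'a='a] assms(2) by simp
  then have "CHAR('a) dvd p" using pr by (rule prime_dvd_power_nat[rotated])
  then show ?thesis using pr assms(1) by (simp add: primes_dvd_imp_eq)
qed

lemma two_nz_of_CARD_prime:
  assumes "prime p" "CARD('k::{field,finite}) = p" "p > 2"
  shows "(2::'k::{field,finite}) \<noteq> 0"
proof -
  have "CHAR('k) = p" using CHAR_of_CARD_prime_power[of p 1, where 'a='k] assms by simp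
  then have "(of_nat 2 :: 'k) \<noteq> 0"
    using assms(3) dvd_imp_le[of p 2] by (auto simp: of_nat_eq_0_iff_char_dvd simp del: of_nat_numeral)
  then show ?thesis by simp
qed

locale field_embedding =
  fixes \<iota> :: "'k::field \<Rightarrow> 'f::field"
  assumes \<iota>_add: "\<iota> (x + y) = \<iota> x + \<iota> y" and \<iota>_mult: "\<iota> (x * y) = \<iota> x * \<iota> y" and \<iota>_1: "\<iota> 1 = 1"
    and \<iota>_inj: "inj \<iota>"
begin

lemma \<iota>_0: "\<iota> 0 = 0" using \<iota>_add[of 0 0] by (metis add_cancel_right_right)

lemma \<iota>_eq_iff [simp]: "\<iota> x = \<iota> y \<longleftrightarrow> x = y" using \<iota>_inj by (auto simp: inj_def)

lemma \<iota>_minus: "\<iota> (- x) = - \<iota> x"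
  using \<iota>_add[of x "- x"] by (simp add: \<iota>_0 eq_neg_iff_add_eq_0 add.commute)

lemma \<iota>_diff: "\<iota> (x - y) = \<iota> x - \<iota> y"
  using \<iota>_add[of x "- y"] by (simp add: \<iota>_minus)

lemma \<iota>_power: "\<iota> (x ^ n) = \<iota> x ^ n"
  by (induction n) (simp_all add: \<iota>_1 \<iota>_mult)

end

lemma prime_field_embedding:
  assumes "prime p" "CARD('k::{field,finite}) = p" "CHAR('f::field) = p"
  shows "\<exists>\<iota> :: 'k::{field,finite} \<Rightarrow> 'f::field. field_embedding \<iota>"
proof -
  have ck: "CHAR('k) = p" using CHAR_of_CARD_prime_power[of p 1, where 'a='k] assms by simp
  have "inj_on (of_nat :: nat \<Rightarrow> 'k) {..<p}"
    by (auto simp: inj_on_def of_nat_eq_iff_cong_CHAR ck dest: cong_less_modulus_unique_nat)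
  then have "card (of_nat ` {..<p} :: 'k set) = CARD('k)" by (simp add: card_image assms(2))
  then have "of_nat ` {..<p} = (UNIV :: 'k set)" by (intro card_subset_eq) auto
  then have surj: "\<exists>n. x = of_nat n" for x :: 'k by blast
  define \<iota> :: "'k \<Rightarrow> 'f" where "\<iota> x = of_nat (SOME n. x = of_nat n)" for x
  have \<iota>: "\<iota> (of_nat n) = of_nat n" for n
  proof -
    have "(of_nat n :: 'k) = of_nat (SOME k. (of_nat n :: 'k) = of_nat k)"
      by (rule someI[of "\<lambda>k. (of_nat n :: 'k) = of_nat k" n]) simp
    then have "(of_nat n :: 'f) = of_nat (SOME k. (of_nat n :: 'k) = of_nat k)"
      by (simp add: of_nat_eq_iff_cong_CHAR ck assms(3))
    then show ?thesis by (simp add: \<iota>_def)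
  qed
  have "field_embedding \<iota>"
  proof
    fix x y :: 'k
    obtain a b where "x = of_nat a" "y = of_nat b" using surj[of x] surj[of y] by blast
    then show "\<iota> (x + y) = \<iota> x + \<iota> y" "\<iota> (x * y) = \<iota> x * \<iota> y"
      using \<iota>[of "a + b"] \<iota>[of "a * b"] \<iota> by simp_all
  next
    show "\<iota> 1 = 1" using \<iota>[of 1] by simp
    show "inj \<iota>"
    proof (rule injI)
      fix x y :: 'k assume "\<iota> x = \<iota> y"
      moreover obtain a b where "x = of_nat a" "y = of_nat b" using surj[of x] surj[of y] by blast
      ultimately show "x = y" using \<iota> by (simp add: of_nat_eq_iff_cong_CHAR ck assms(3))
    qed
  qed
  then show ?thesis by blast
qed

text \<open>\<open>\<delta>\<close> is a square root of a non-square of the prime field, and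
  \<open>x ^ p\<close> is the conjugate of \<open>x\<close>. Roots of quadratic forms live in
  \<open>'f alg_closure\<close>, where this map is still additive and injective but no longer an
  involution.\<close>

locale quadratic_extension =
  fixes p :: nat and \<delta> :: "'f::{field,finite}"
  assumes prime_p: "prime p" and p_mod_4: "p mod 4 = 1" and card_f: "CARD('f) = p ^ 2"
    and \<delta>_nz: "\<delta> \<noteq> 0" and \<delta>_conj: "\<delta> ^ p = - \<delta>"
begin

definition m :: nat where "m = (p + 1) div 2"

lemma p_gt: "p > 4"
proof -
  have "p \<noteq> 1" using prime_p by auto
  then show ?thesis using p_mod_4 by presburger
qed

lemma m_pos: "m > 0" using p_gt by (simp add: m_def)
lemma two_m: "2 * m = p + 1" and odd_m: "odd m"
  using p_mod_4 unfolding m_def by presburger+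

lemma CHAR_f [simp]: "CHAR('f) = p" and CHAR_ac [simp]: "CHAR('f alg_closure) = p"
  using CHAR_of_CARD_prime_power[OF prime_p card_f] by simp_all

lemma of_nat_nz: "\<not> p dvd n \<Longrightarrow> (of_nat n :: 'f) \<noteq> 0"
  by (simp add: of_nat_eq_0_iff_char_dvd)

lemma two_nz [simp]: "(2::'f) \<noteq> 0"
  using of_nat_nz[of 2] p_gt dvd_imp_le[of p 2] by fastforce

lemma four_nz [simp]: "(4::'f) \<noteq> 0"
proof -
  have "(4::'f) = 2 * 2" by simp
  then show ?thesis by (metis mult_eq_0_iff two_nz)
qed

lemma two_ac_nz [simp]: "(2::'f alg_closure) \<noteq> 0"
  using two_nz by (metis to_ac_eq_0_iff to_ac_numeral)

lemma frob_add [simp]: "(x + y :: 'f) ^ p = x ^ p + y ^ p"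
  and frob_add_ac [simp]: "(s + t :: 'f alg_closure) ^ p = s ^ p + t ^ p"
  by (rule freshmans_dream; simp add: prime_p)+

lemma odd_p: "odd p" using p_mod_4 by presburger

lemma frob_minus [simp]: "(- x :: 'f) ^ p = - (x ^ p)"
  and frob_minus_ac [simp]: "(- s :: 'f alg_closure) ^ p = - (s ^ p)"
  using odd_p by simp_all

lemma frob_diff [simp]: "(x - y :: 'f) ^ p = x ^ p - y ^ p"
  and frob_diff_ac [simp]: "(s - t :: 'f alg_closure) ^ p = s ^ p - t ^ p"
  using frob_add[of x "-y"] frob_add_ac[of s "-t"] by simp_all

lemma frob_of_nat: "(of_nat n :: 'f) ^ p = of_nat n"
  using p_gt by (induction n) (simp_all add: power_0_left)

lemma frob_numeral [simp]: "(numeral n :: 'f) ^ p = numeral n"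
  using frob_of_nat[of "numeral n"] by simp

lemma frob_numeral_ac [simp]: "(numeral n :: 'f alg_closure) ^ p = numeral n"
  by (metis frob_numeral to_ac_numeral to_ac_power)

lemma frob_zero [simp]: "(0::'f) ^ p = 0" "(0::'f alg_closure) ^ p = 0"
  using p_gt by (simp_all add: power_0_left)

lemma frob_frob [simp]: "((x::'f) ^ p) ^ p = x"
  using power_CARD_eq[of x] by (simp add: card_f power2_eq_square power_mult)

lemma frob_inj [simp]: "(x::'f) ^ p = y ^ p \<longleftrightarrow> x = y"
  by (metis frob_frob)

lemma frob_inj_ac [simp]: "(s::'f alg_closure) ^ p = t ^ p \<longleftrightarrow> s = t"
proof
  assume "s ^ p = t ^ p"
  then have "(s - t) ^ p = 0" by simp
  then show "s = t" by (metis eq_iff_diff_eq_0 power_not_zero)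
qed simp

lemma frob_mult [simp]: "((x::'f) * y) ^ p = x ^ p * y ^ p"
  and frob_mult_ac [simp]: "((s::'f alg_closure) * t) ^ p = s ^ p * t ^ p"
  by (simp_all add: power_mult_distrib)

lemma frob_divide [simp]: "((x::'f) / y) ^ p = x ^ p / y ^ p"
  by (simp add: power_divide)

lemma frob_square [simp]: "((x::'f) ^ 2) ^ p = (x ^ p) ^ 2"
  and frob_square_ac [simp]: "((s::'f alg_closure) ^ 2) ^ p = (s ^ p) ^ 2"
  by (simp_all add: power2_eq_square)

lemma card_minus_1: "CARD('f) - 1 = (p + 1) * (p - 1)"
  using p_gt by (simp add: card_f power2_eq_square algebra_simps)

lemma power_p_minus_1: "x ^ p = x \<Longrightarrow> x \<noteq> 0 \<Longrightarrow> x ^ (p - 1) = 1" for x :: 'f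
  using p_gt by (metis (no_types, lifting) One_nat_def Suc_pred gr_implies_not_zero mult_cancel_left2
      neq0_conv power_Suc)

lemma power_p_plus_1: "x ^ (p + 1) = x * x ^ p" for x :: "'a::comm_monoid_mult"
  by simp

lemma power_m_squared: "(x ^ m) ^ 2 = x * x ^ p" for x :: "'a::comm_monoid_mult"
  using two_m by (metis mult.commute power_mult power_p_plus_1)

lemma norm_fiber:
  assumes "(c::'f) ^ p = c" "c \<noteq> 0"
  shows "card {x. x * x ^ p = c} = p + 1"
  using card_power_eq[OF card_minus_1, of c] power_p_minus_1[OF assms] p_gt by simp

lemma norm_exists:
  assumes "(c::'f) ^ p = c" "c \<noteq> 0"
  obtains x where "x * x ^ p = c"
  using power_eq_exists[OF card_minus_1, of c] power_p_minus_1[OF assms] p_gt by auto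

lemma card_m_torsion: "card {l::'f. l ^ m = 1} = m"
proof (rule card_power_eq)
  show "CARD('f) - 1 = m * (2 * (p - 1))" using card_minus_1 two_m by (simp add: algebra_simps)
qed (use p_gt m_pos in auto)

lemma norm_one_cases:
  assumes "(l::'f) * l ^ p = 1" shows "l ^ m = 1 \<or> (- l) ^ m = 1"
proof -
  have "(l ^ m) ^ 2 = 1" using assms power_m_squared[of l] by simp
  then show ?thesis using odd_m by (auto simp: power2_eq_1_iff)
qed

abbreviation rational :: "'f \<Rightarrow> bool" where "rational x \<equiv> x ^ p = x"

text \<open>The values of \<open>x + x ^ p\<close> are rational, polynomials of degree
  \<open>p\<close> bound both the number of rational elements and the size of every fibre by
  \<open>p\<close>, and there are \<open>p * p\<close> elements; so all bounds are attained.\<close>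

lemma trace_fiber:
  assumes c: "rational c"
  shows "card {x::'f. x + x ^ p = c} = p"
proof -
  have root: "card {x::'f. x ^ p + b * x = c} \<le> p" for b c :: 'f
  proof -
    define f where "f = Polynomial.monom (1::'f) p + [:-c, b:]"
    have "Polynomial.coeff f p = 1"
      using p_gt by (cases p) (simp_all add: f_def coeff_pCons split: nat.splits)
    then have nz: "f \<noteq> 0" by auto
    have deg: "Polynomial.degree f \<le> p"
      unfolding f_def using p_gt by (intro degree_add_le) (simp_all add: degree_monom_le)
    have "{x. x ^ p + b * x = c} = {x. poly f x = 0}"
      by (auto simp: f_def poly_monom algebra_simps add_eq_0_iff)
    then show ?thesis using card_poly_roots_bound[OF nz] deg by simp
  qed
  have "card {x\<in>UNIV. x + x ^ p = c} = p"
  proof (rule card_fiber_eq[where C = "{c::'f. rational c}" and k = p])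
    show "card {c::'f. rational c} \<le> p" using root[of "-1" 0] by simp
    show "card {x\<in>UNIV. x + x ^ p = c} \<le> p" for c :: 'f using root[of 1 c] by (simp add: add.commute)
  qed (use assms card_f in \<open>auto simp: power2_eq_square add.commute\<close>)
  then show ?thesis by simp
qed

lemma card_rational: "card {x::'f. rational x} = p"
proof -
  have "bij_betw (\<lambda>x. x * \<delta>) {x. rational x} {x. x + x ^ p = 0}"
    by (rule bij_betw_byWitness[where f' = "\<lambda>x. x / \<delta>"])
      (auto simp: \<delta>_nz \<delta>_conj add_eq_0_iff field_simps)
  then show ?thesis using trace_fiber[of 0] by (simp add: bij_betw_same_card)
qed

lemma rational_parts:
  obtains a b where "rational a" "rational b" "(x::'f) = a + b * \<delta>"
proof
  show "rational ((x + x ^ p) / 2)" by (simp add: add.commute)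
  show "rational ((x - x ^ p) / (2 * \<delta>))" by (simp add: \<delta>_conj field_simps \<delta>_nz)
  show "x = (x + x ^ p) / 2 + (x - x ^ p) / (2 * \<delta>) * \<delta>"
    by (simp add: \<delta>_nz field_simps)
qed

text \<open>Raising to \<open>half\<close> is the quadratic character of the field of order
  \<open>p ^ 2\<close>. As a multiple of \<open>p - 1\<close>, the exponent sends every nonzero
  rational element to 1: these are all squares in the larger field.\<close>

definition half :: nat where "half = (p ^ 2 - 1) div 2"

lemma half_eq: "half = m * (p - 1)"
proof -
  have "p ^ 2 - 1 = 2 * (m * (p - 1))"
    using card_minus_1 two_m card_f by (metis mult.assoc)
  then show ?thesis by (simp add: half_def)
qed

lemma power_half_squared: "x \<noteq> 0 \<Longrightarrow> (x ^ half) ^ 2 = 1" for x :: 'f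
proof -
  assume "x \<noteq> 0"
  have "half * 2 = CARD('f) - 1" using half_eq two_m card_minus_1 by (metis mult.commute mult.assoc)
  then show ?thesis using power_CARD_minus_1[OF \<open>x \<noteq> 0\<close>] by (simp flip: power_mult)
qed

lemma power_half_cases: "x \<noteq> 0 \<Longrightarrow> x ^ half = 1 \<or> x ^ half = -1" for x :: 'f
  using power_half_squared by (simp add: power2_eq_1_iff)

lemma half_pos: "half > 0" using half_eq m_pos p_gt by simp

lemma square_iff: "(\<exists>y. y ^ 2 = x) \<longleftrightarrow> x = 0 \<or> x ^ half = 1" for x :: 'f
proof
  assume "\<exists>y. y ^ 2 = x"
  then show "x = 0 \<or> x ^ half = 1"
    using power_half_squared by (metis mult.commute power_mult power_zero_numeral)
next
  have *: "CARD('f) - 1 = 2 * half"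
    using half_eq two_m card_minus_1 by (metis mult.assoc)
  assume "x = 0 \<or> x ^ half = 1"
  then show "\<exists>y. y ^ 2 = x"
  proof
    assume "x ^ half = 1"
    then show ?thesis using power_eq_exists[OF *, of x] half_pos by auto
  qed auto
qed

lemma rational_power_half: "rational x \<Longrightarrow> x \<noteq> 0 \<Longrightarrow> x ^ half = 1"
  using power_p_minus_1[of x] half_eq by (metis mult.commute power_mult power_one)

end

section \<open>Jacobsthal sums\<close>

locale odd_field =
  fixes q :: nat and ty :: "'k::{field,finite} itself"
  assumes card_k: "CARD('k) = q" and q_mod_4: "q mod 4 = 1" and two_nz_k: "(2::'k) \<noteq> 0"
begin

definition chi :: "'k \<Rightarrow> int" where
  "chi x = (if x = 0 then 0 else if x ^ ((q - 1) div 2) = 1 then 1 else - 1)"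

lemma q_gt: "q > 4"
proof -
  have "card {0, 1::'k} \<le> CARD('k)" by (rule card_mono) auto
  then have "q > 1" by (simp add: card_k)
  then show ?thesis using q_mod_4 by presburger
qed

lemma q_half: "CARD('k) - 1 = 2 * ((q - 1) div 2)" "(q - 1) div 2 = 2 * ((q - 1) div 4)"
  using q_mod_4 card_k by presburger+

lemma one_neq_minus_one: "(1::'k) \<noteq> - 1"
  using two_nz_k by (metis add.left_inverse one_add_one)

lemma power_half_k: "x \<noteq> 0 \<Longrightarrow> x ^ ((q - 1) div 2) = 1 \<or> x ^ ((q - 1) div 2) = - 1" for x :: 'k
proof -
  assume "x \<noteq> 0"
  then have "(x ^ ((q - 1) div 2)) ^ 2 = 1"
    using power_CARD_minus_1[of x] q_half(1) by (simp flip: power_mult add: mult.commute)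
  then show ?thesis by (simp add: power2_eq_1_iff)
qed

lemma of_int_chi: "of_int (chi x) = x ^ ((q - 1) div 2)"
  using power_half_k[of x] q_gt by (auto simp: chi_def power_0_left)

lemma chi_mult: "chi (x * y) = chi x * chi y"
proof (cases "x = 0 \<or> y = 0")
  case False
  then show ?thesis
    using power_half_k[of x] power_half_k[of y] one_neq_minus_one
    by (auto simp: chi_def power_mult_distrib)
qed (auto simp: chi_def)

lemma chi_cases: "x \<noteq> 0 \<Longrightarrow> chi x = 1 \<or> chi x = -1" by (simp add: chi_def)
lemma chi_0 [simp]: "chi 0 = 0" and chi_1 [simp]: "chi 1 = 1" by (simp_all add: chi_def)

lemma chi_minus_1: "chi (-1) = 1"
  using q_half(2) by (simp add: chi_def)

lemma chi_minus [simp]: "chi (- x) = chi x"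
  using chi_mult[of "-1" x] chi_minus_1 by simp

lemma chi_square: "x \<noteq> 0 \<Longrightarrow> chi (x ^ 2) = 1"
  using chi_mult[of x x] chi_cases[of x] by (auto simp: power2_eq_square)

lemma card_sqrt: "int (card {y. y ^ 2 = c}) = 1 + chi c"
proof (cases "c = 0")
  case True
  then have "{y::'k. y ^ 2 = c} = {0}" by auto
  then show ?thesis using True by simp
next
  case False
  show ?thesis
  proof (cases "chi c = 1")
    case True
    then have "c ^ ((q - 1) div 2) = 1" using of_int_chi[of c] by simp
    then have "card {y. y ^ 2 = c} = 2"
      using card_power_eq[OF q_half(1), of c] q_gt by simp
    then show ?thesis using True by simp
  next
    case c: False
    then have "{y. y ^ 2 = c} = {}" using chi_square \<open>c \<noteq> 0\<close> by auto
    then show ?thesis using c chi_cases[OF False] by simp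
  qed
qed

lemma sum_chi: "(\<Sum>x\<in>UNIV. chi x) = 0"
proof -
  have "(\<Sum>c\<in>(UNIV::'k set). \<Sum>y\<in>{y\<in>UNIV. y ^ 2 = c}. (1::int)) = (\<Sum>y\<in>(UNIV::'k set). 1)"
    by (rule sum.group) auto
  then have "(\<Sum>c\<in>(UNIV::'k set). 1 + chi c) = int (CARD('k))"
    by (simp add: card_sqrt)
  then show ?thesis by (simp add: sum.distrib)
qed

lemma sum_chi_shift: "a \<noteq> 0 \<Longrightarrow> (\<Sum>x\<in>UNIV. f (a * x)) = (\<Sum>x\<in>(UNIV::'k set). f x)" for f :: "'k \<Rightarrow> int"
  by (rule sum.reindex_bij_witness[of _ "\<lambda>y. y / a" "\<lambda>y. a * y"]) auto

text \<open>For nonzero \<open>t = a + c\<close>, the product \<open>t * (t + e)\<close> is the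
  square \<open>t ^ 2\<close> times \<open>1 + e / t\<close>, and the last factor runs through
  everything but 1. The full sum of \<open>chi\<close> vanishes, so \<open>- chi 1\<close> is
  left.\<close>

lemma sum_chi_pair:
  assumes "a \<noteq> b"
  shows "(\<Sum>c\<in>UNIV. chi (a + c) * chi (b + c)) = -1"
proof -
  define e where "e = b - a"
  have e: "e \<noteq> 0" using assms by (simp add: e_def)
  have "(\<Sum>c\<in>UNIV. chi (a + c) * chi (b + c)) = (\<Sum>t\<in>UNIV. chi t * chi (t + e))"
    by (rule sum.reindex_bij_witness[of _ "\<lambda>t. t - a" "\<lambda>c. a + c"]) (auto simp: e_def algebra_simps)
  also have "\<dots> = (\<Sum>t\<in>-{0}. chi t * chi (t + e))"
    by (rule sum.mono_neutral_right) auto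
  also have "\<dots> = (\<Sum>t\<in>-{0}. chi (1 + e / t))"
  proof (rule sum.cong[OF refl])
    fix t :: 'k assume "t \<in> -{0}"
    then have t: "t \<noteq> 0" by simp
    then have "t * (t + e) = t ^ 2 * (1 + e / t)" by (simp add: field_simps power2_eq_square)
    then show "chi t * chi (t + e) = chi (1 + e / t)"
      using chi_mult chi_square[OF t] by (metis mult_1)
  qed
  also have "\<dots> = (\<Sum>s\<in>-{1}. chi s)"
    by (rule sum.reindex_bij_witness[of _ "\<lambda>s. e / (s - 1)" "\<lambda>t. 1 + e / t"]) (use e in auto)
  also have "\<dots> = -1"
    using sum_chi by (simp add: Compl_eq_Diff_UNIV sum_diff1)
  finally show ?thesis .
qed

lemma sum_chi_pair_same: "(\<Sum>c\<in>UNIV. chi (a + c) * chi (a + c)) = int q - 1"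
proof -
  have "(\<Sum>c\<in>UNIV. chi (a + c) * chi (a + c)) = (\<Sum>t\<in>UNIV. chi t * chi t)"
    by (rule sum.reindex_bij_witness[of _ "\<lambda>t. t - a" "\<lambda>c. a + c"]) auto
  also have "\<dots> = (\<Sum>t\<in>-{0}. chi t * chi t)"
    by (rule sum.mono_neutral_right) auto
  also have "\<dots> = (\<Sum>t\<in>-{0::'k}. 1)"
    by (rule sum.cong) (use chi_cases in force)+
  finally show ?thesis using q_gt by (simp add: Compl_eq_Diff_UNIV card_Diff_singleton card_k)
qed

definition jac :: "'k \<Rightarrow> int" where "jac c = (\<Sum>x\<in>UNIV. chi x * chi (x ^ 2 + c))"

lemma jac_scale:
  assumes "t \<noteq> 0" shows "jac (c * t ^ 2) = chi t * jac c"
proof -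
  have "jac (c * t ^ 2) = (\<Sum>x\<in>UNIV. chi (t * x) * chi ((t * x) ^ 2 + c * t ^ 2))"
    unfolding jac_def by (rule sum_chi_shift[OF assms, symmetric])
  also have "\<dots> = (\<Sum>x\<in>UNIV. chi t * (chi x * chi (x ^ 2 + c)))"
  proof (rule sum.cong[OF refl])
    fix x
    have "(t * x) ^ 2 + c * t ^ 2 = t ^ 2 * (x ^ 2 + c)" by (simp add: algebra_simps)
    then show "chi (t * x) * chi ((t * x) ^ 2 + c * t ^ 2) = chi t * (chi x * chi (x ^ 2 + c))"
      using chi_square[OF assms] by (simp add: chi_mult)
  qed
  finally show ?thesis by (simp add: jac_def sum_distrib_left)
qed

lemma jac_0: "jac 0 = 0"
proof -
  have "jac 0 = (\<Sum>x\<in>UNIV. chi x)" unfolding jac_def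
  proof (rule sum.cong[OF refl])
    show "chi x * chi (x ^ 2 + 0) = chi x" for x by (cases "x = 0") (simp_all add: chi_square)
  qed
  then show ?thesis by (simp add: sum_chi)
qed

text \<open>After expanding the square and exchanging sums, the sum over \<open>c\<close> is
  \<open>-1\<close>, plus \<open>q\<close> in case \<open>x ^ 2 = y ^ 2\<close>. The part from
  \<open>-1\<close> vanishes with the sum of \<open>chi\<close>; in the other part
  \<open>y = x\<close> and \<open>y = - x\<close> contribute equally.\<close>

lemma sum_jac_squared: "(\<Sum>c\<in>UNIV. (jac c) ^ 2) = 2 * int q * (int q - 1)"
proof -
  have inner: "(\<Sum>c\<in>UNIV. chi (a + c) * chi (b + c)) = -1 + (if a = b then int q else 0)" for a b
    by (simp add: sum_chi_pair sum_chi_pair_same)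
  have fin: "(\<Sum>y\<in>UNIV. chi x * chi y * (if x ^ 2 = y ^ 2 then int q else 0))
      = (if x = 0 then 0 else 2 * int q)" for x
  proof (cases "x = 0")
    case False
    have "x \<noteq> - x" using False two_nz_k by (metis add_eq_0_iff mult_2 mult_eq_0_iff)
    have "(\<Sum>y\<in>UNIV. chi x * chi y * (if x ^ 2 = y ^ 2 then int q else 0))
      = (\<Sum>y\<in>{x, -x}. chi x * chi y * int q)"
      by (rule sum.mono_neutral_cong_right) (auto simp: power2_eq_iff)
    also have "\<dots> = 2 * (chi x * chi x * int q)" using \<open>x \<noteq> - x\<close> by simp
    finally show ?thesis using chi_cases[OF False] False by auto
  qed simp
  have "(\<Sum>c\<in>UNIV. (jac c) ^ 2)
      = (\<Sum>c\<in>UNIV. \<Sum>x\<in>UNIV. \<Sum>y\<in>UNIV. chi x * chi y * (chi (x ^ 2 + c) * chi (y ^ 2 + c)))"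
    by (simp add: jac_def power2_eq_square sum_product algebra_simps)
  also have "\<dots> = (\<Sum>x\<in>UNIV. \<Sum>y\<in>UNIV. \<Sum>c\<in>UNIV. chi x * chi y * (chi (x ^ 2 + c) * chi (y ^ 2 + c)))"
    by (subst sum.swap, rule sum.cong[OF refl], rule sum.swap)
  also have "\<dots> = (\<Sum>x\<in>UNIV. \<Sum>y\<in>UNIV. chi x * chi y * (-1 + (if x ^ 2 = y ^ 2 then int q else 0)))"
    by (simp add: sum_distrib_left[symmetric] inner)
  also have "\<dots> = - (\<Sum>x\<in>UNIV. \<Sum>y\<in>UNIV. chi x * chi y)
      + (\<Sum>x\<in>UNIV. \<Sum>y\<in>UNIV. chi x * chi y * (if x ^ 2 = y ^ 2 then int q else 0))"
    unfolding distrib_left sum.distrib mult_minus_right mult_1_right sum_negf ..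
  also have "(\<Sum>x\<in>UNIV. \<Sum>y\<in>UNIV. chi x * chi y) = 0"
    using sum_chi by (simp add: sum_product[symmetric])
  also have "(\<Sum>x\<in>UNIV. \<Sum>y\<in>UNIV. chi x * chi y * (if x ^ 2 = y ^ 2 then int q else 0))
      = (\<Sum>x\<in>(UNIV::'k set). (if x = 0 then 0 else 2 * int q))"
    by (simp only: fin)
  also have "\<dots> = (\<Sum>x\<in>-{0::'k}. 2 * int q)"
    by (rule sum.mono_neutral_cong_right) auto
  finally show ?thesis using q_gt
    by (simp add: Compl_eq_Diff_UNIV card_Diff_singleton card_k of_nat_diff)
qed

lemma nonsquare_exists: obtains d where "chi d = -1"
proof -
  have "\<exists>d. chi d < 0"
  proof (rule ccontr)
    assume "\<not> ?thesis"
    then have "(\<Sum>x\<in>UNIV. chi x) \<ge> (\<Sum>x\<in>{1}. chi x)"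
      by (intro sum_mono2) (auto simp: not_less)
    then show False using sum_chi by simp
  qed
  then obtain d where "chi d < 0" by blast
  then show thesis using that chi_cases[of d] by (cases "d = 0") auto
qed

lemma square_times: "chi c = chi d \<Longrightarrow> c \<noteq> 0 \<Longrightarrow> d \<noteq> 0 \<Longrightarrow> \<exists>t. t \<noteq> 0 \<and> c = d * t ^ 2"
proof -
  assume h: "chi c = chi d" "c \<noteq> 0" "d \<noteq> 0"
  have "chi (c / d) * chi d = chi d" using h chi_mult[of "c / d" d] by simp
  then have "chi (c / d) = 1" using chi_cases[OF h(3)] by auto
  then have "int (card {y. y ^ 2 = c / d}) = 2" by (simp add: card_sqrt)
  then have "{y. y ^ 2 = c / d} \<noteq> {}" by (metis card.empty of_nat_0 zero_neq_numeral)
  then obtain t where "t ^ 2 = c / d" by blast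
  then show ?thesis using h by (intro exI[of _ t]) (auto simp: field_simps)
qed

text \<open>By \<open>jac_scale\<close>, \<open>(jac c) ^ 2\<close> depends for nonzero
  \<open>c\<close> only on whether \<open>c\<close> is a square, so the second moment
  \<open>2 * q * (q - 1)\<close> consists of \<open>(q - 1) / 2\<close> copies of each of the two
  values.\<close>

lemma jac_squares:
  assumes "chi d = -1"
  shows "(jac (-1)) ^ 2 + (jac d) ^ 2 = 4 * int q"
proof -
  have d: "d \<noteq> 0" using assms by auto
  have sq: "(jac c) ^ 2 = (jac e) ^ 2" if h: "chi c = chi e" "c \<noteq> 0" "e \<noteq> 0" for c e
  proof -
    obtain t where t: "t \<noteq> 0" "c = e * t ^ 2" using square_times[OF h] by blast
    then show ?thesis using jac_scale[OF t(1), of e] chi_cases[OF t(1)] by auto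
  qed
  have chi2: "2 * (jac c) ^ 2 = (jac (-1)) ^ 2 * (1 + chi c) + (jac d) ^ 2 * (1 - chi c)"
    if "c \<noteq> 0" for c
    using sq[of c "-1"] sq[of c d] chi_cases[OF that] that d assms chi_minus_1 by auto
  have "2 * (2 * int q * (int q - 1)) = (\<Sum>c\<in>UNIV. 2 * (jac c) ^ 2)"
    by (simp add: sum_jac_squared sum_distrib_left[symmetric])
  also have "\<dots> = (\<Sum>c\<in>-{0}. 2 * (jac c) ^ 2)"
    by (rule sum.mono_neutral_right) (auto simp: jac_0)
  also have "\<dots> = (\<Sum>c\<in>-{0}. ((jac (-1)) ^ 2 + (jac d) ^ 2) + ((jac (-1)) ^ 2 - (jac d) ^ 2) * chi c)"
    by (rule sum.cong) (auto simp: chi2 algebra_simps)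
  also have "\<dots> = (int q - 1) * ((jac (-1)) ^ 2 + (jac d) ^ 2)
      + ((jac (-1)) ^ 2 - (jac d) ^ 2) * (\<Sum>c\<in>-{0}. chi c)"
    using q_gt by (simp add: sum.distrib sum_distrib_left Compl_eq_Diff_UNIV
        card_Diff_singleton card_k of_nat_diff)
  also have "(\<Sum>c\<in>-{0}. chi c) = 0"
    using sum_chi by (simp add: Compl_eq_Diff_UNIV sum_diff1)
  finally have "(int q - 1) * (4 * int q) = (int q - 1) * ((jac (-1)) ^ 2 + (jac d) ^ 2)" by simp
  then show ?thesis using q_gt by simp
qed

lemma even_card_symmetric:
  assumes "\<And>x::'k. x \<in> S \<Longrightarrow> - x \<in> S" "0 \<notin> S"
  shows "even (card S)"
proof -
  have "card S = (\<Sum>c\<in>(\<lambda>x. x ^ 2) ` S. card {x\<in>S. x ^ 2 = c})"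
    using sum.group[of S "(\<lambda>x. x ^ 2) ` S" "\<lambda>x. x ^ 2" "\<lambda>_. 1::nat"] by simp
  also have "\<dots> = (\<Sum>c\<in>(\<lambda>x. x ^ 2) ` S. 2)"
  proof (rule sum.cong[OF refl])
    fix c assume "c \<in> (\<lambda>x. x ^ 2) ` S"
    then obtain x where x: "x \<in> S" "c = x ^ 2" by auto
    then have "x \<noteq> 0" using assms(2) by auto
    then have "x \<noteq> - x" using two_nz_k by (metis add_eq_0_iff mult_2 mult_eq_0_iff)
    moreover have "{x\<in>S. x ^ 2 = c} = {x, -x}" using x assms(1) by (auto simp: power2_eq_iff)
    ultimately show "card {x\<in>S. x ^ 2 = c} = 2" by simp
  qed
  finally show ?thesis by simp
qed

text \<open>The nonzero terms are 1 or -1, and since \<open>-1\<close> is a square, the terms at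
  \<open>x\<close> and \<open>- x\<close> agree. So the number of terms -1 is even, and replacing
  them by 1 changes the sum by a multiple of 4.\<close>

lemma jac_parity: "\<exists>k. jac c = 4 * k + int (card {x. x \<noteq> 0 \<and> x ^ 2 + c \<noteq> 0})"
proof -
  define S where "S = {x. x \<noteq> 0 \<and> x ^ 2 + c \<noteq> 0}"
  define N where "N = {x\<in>S. chi x * chi (x ^ 2 + c) = -1}"
  have "jac c = (\<Sum>x\<in>S. chi x * chi (x ^ 2 + c))"
    unfolding jac_def by (rule sum.mono_neutral_right) (auto simp: S_def)
  also have "\<dots> = (\<Sum>x\<in>S. 1 - 2 * (if x \<in> N then 1 else 0))"
  proof (rule sum.cong[OF refl])
    fix x assume "x \<in> S"
    then show "chi x * chi (x ^ 2 + c) = 1 - 2 * (if x \<in> N then 1 else 0)"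
      using chi_cases[of x] chi_cases[of "x ^ 2 + c"] by (auto simp: N_def S_def)
  qed
  also have "\<dots> = int (card S) - 2 * (\<Sum>x\<in>S. if x \<in> N then 1 else 0)"
    by (simp add: sum_subtractf sum_distrib_left)
  also have "(\<Sum>x\<in>S. if x \<in> N then 1 else 0) = int (card N)"
  proof -
    have "S \<inter> N = N" by (auto simp: N_def)
    then show ?thesis by (simp add: sum.If_cases)
  qed
  finally have "jac c = int (card S) - 2 * int (card N)" .
  moreover have "even (card N)" by (rule even_card_symmetric) (auto simp: N_def S_def)
  then obtain n where "card N = 2 * n" by (rule evenE)
  ultimately have "jac c = 4 * (- int n) + int (card S)" by simp
  then show ?thesis unfolding S_def by blast
qed

lemma jac_minus_1_mod: "\<exists>k. jac (-1) = 2 * (2 * k + 1)"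
proof -
  have "{x::'k. x \<noteq> 0 \<and> x ^ 2 + (-1) \<noteq> 0} = UNIV - {0, 1, -1}"
    by (auto simp: power2_eq_1_iff)
  moreover have "card {0, 1, -1::'k} = 3" using one_neq_minus_one by simp
  ultimately have "card {x::'k. x \<noteq> 0 \<and> x ^ 2 + (-1) \<noteq> 0} = q - 3"
    by (simp add: card_Diff_subset card_k)
  then obtain k where k: "jac (-1) = 4 * k + int (q - 3)" using jac_parity[of "-1"] by metis
  have "\<exists>n. q - 3 = 4 * n + 2" using q_mod_4 q_gt by presburger
  then obtain n where "q - 3 = 4 * n + 2" by blast
  then have "jac (-1) = 2 * (2 * (k + int n) + 1)" using k by simp
  then show ?thesis by blast
qed

lemma jac_nonsquare_even: "chi d = -1 \<Longrightarrow> even (jac d)"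
proof -
  assume d: "chi d = -1"
  have "x ^ 2 + d \<noteq> 0" for x
  proof
    assume "x ^ 2 + d = 0"
    then have "d = - (x ^ 2)" by (simp add: add_eq_0_iff)
    then show False using d chi_square[of x] by (cases "x = 0") auto
  qed
  then have "{x::'k. x \<noteq> 0 \<and> x ^ 2 + d \<noteq> 0} = UNIV - {0}" by auto
  then have "card {x::'k. x \<noteq> 0 \<and> x ^ 2 + d \<noteq> 0} = q - 1"
    by (simp add: card_k)
  then obtain k where "jac d = 4 * k + int (q - 1)" using jac_parity[of d] by metis
  moreover have "even (q - 1)" using q_mod_4 by presburger
  ultimately show ?thesis by simp
qed

end

text \<open>Since \<open>(c A - B) (c A + B) = p (A ^ 2 - 1)\<close>, the prime divides one factor,
  say \<open>c A - B\<close>. In \<open>(A + c B) ^ 2 + (c A - B) ^ 2 = p ^ 2\<close> the first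
  square is nonzero by parity, so \<open>c A - B\<close> is a multiple of \<open>p\<close> smaller
  than \<open>p\<close> in size, hence 0. Then \<open>B = c A\<close> and
  \<open>A ^ 2 = 1\<close>.\<close>

lemma prime_sum_two_squares_unique:
  fixes A B c p :: int
  assumes p: "prime p" and c: "p = 1 + c ^ 2" and AB: "A ^ 2 + B ^ 2 = p" and "odd A" "even c"
  shows "A = 1 \<or> A = -1"
proof -
  have main: "A' = 1 \<or> A' = -1" if dvd: "p dvd c * A' - B" and AB': "A' ^ 2 + B ^ 2 = p" and "odd A'" for A'
  proof -
    have id: "(A' + c * B) ^ 2 + (c * A' - B) ^ 2 = p * p"
    proof -
      have "(A' + c * B) ^ 2 + (c * A' - B) ^ 2 = (1 + c ^ 2) * (A' ^ 2 + B ^ 2)"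
        by (simp add: power2_eq_square algebra_simps)
      then show ?thesis unfolding AB' c[symmetric] .
    qed
    obtain k where k: "c * A' - B = p * k" using dvd by (rule dvdE)
    have ppos: "p > 0" using p by (simp add: prime_gt_0_int)
    have "A' + c * B \<noteq> 0"
    proof
      assume "A' + c * B = 0"
      then have "A' = - (c * B)" by simp
      then show False using \<open>odd A'\<close> \<open>even c\<close> by simp
    qed
    then have "(p * k) ^ 2 < p * p" using id unfolding k[symmetric] by (smt (verit) zero_less_power2)
    then have "p * p * k ^ 2 < p * p * 1" by (simp add: power2_eq_square algebra_simps)
    then have "k ^ 2 < 1" using ppos by (simp add: mult_less_cancel_left)
    then have "k = 0" by (smt (verit) zero_less_power2)
    then have "B = c * A'" using k by simp
    then have "A' ^ 2 * p = p" using AB' c by (simp add: algebra_simps power_mult_distrib)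
    then show ?thesis using ppos by (simp add: power2_eq_1_iff)
  qed
  have "(c * A - B) * (c * A + B) = p * (A ^ 2 - 1)"
  proof -
    have "(c * A - B) * (c * A + B) = (1 + c ^ 2) * A ^ 2 - (A ^ 2 + B ^ 2)" by Groebner_Basis.algebra
    then show ?thesis unfolding AB c[symmetric] by (simp add: algebra_simps)
  qed
  then have "p dvd (c * A - B) * (c * A + B)" by simp
  then have "p dvd c * A - B \<or> p dvd c * A + B" using p by (simp add: prime_dvd_mult_iff)
  then show ?thesis
  proof
    assume "p dvd c * A - B" then show ?thesis using main AB \<open>odd A\<close> by blast
  next
    assume "p dvd c * A + B"
    then have "p dvd c * (-A) - B" by (metis dvd_minus_iff minus_add_distrib mult_minus_right uminus_add_conv_diff add.commute diff_minus_eq_add minus_diff_eq)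
    then show ?thesis using main[of "-A"] AB \<open>odd A\<close> by auto
  qed
qed

context odd_field
begin

text \<open>Halves of \<open>jac (-1)\<close> and \<open>jac d\<close> represent \<open>q\<close> as
  a sum of two squares, the first of them odd; \<open>1 + (4 a) ^ 2\<close> is another such
  representation, and the odd parts must agree up to sign. This is where the special form of the
  prime enters.\<close>

lemma jac_minus_1:
  assumes "prime q" "int q = 1 + 16 * a ^ 2"
  shows "jac (-1) = 2 \<or> jac (-1) = -2"
proof -
  obtain d where d: "chi d = -1" by (rule nonsquare_exists)
  obtain k where k: "jac (-1) = 2 * (2 * k + 1)" using jac_minus_1_mod by blast
  obtain l where l: "jac d = 2 * l" using jac_nonsquare_even[OF d] by (rule evenE)
  have "(2 * k + 1) ^ 2 + l ^ 2 = int q"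
    using jac_squares[OF d] unfolding k l power_mult_distrib by simp
  moreover have "int q = 1 + (4 * a) ^ 2" using assms(2) by (simp add: power_mult_distrib)
  moreover have "prime (int q)" using assms(1) by simp
  ultimately have "2 * k + 1 = 1 \<or> 2 * k + 1 = -1"
    by (intro prime_sum_two_squares_unique[of "int q" "4 * a" _ l]) (assumption | simp)+
  then show ?thesis using k by auto
qed

text \<open>For \<open>y = d * (d - x ^ 2)\<close>, the sum of \<open>chi z\<close> over the square
  roots \<open>z\<close> of \<open>y\<close> is \<open>2\<close> for a fourth power,
  \<open>-2\<close> for a square that is no fourth power, and \<open>0\<close> otherwise. With the
  sums exchanged, the number of \<open>x\<close> belonging to a given \<open>z\<close> is
  \<open>1 - chi (z ^ 2 - d ^ 2)\<close>, which leaves a Jacobsthal sum.\<close>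

lemma quartic_count:
  assumes d: "chi d = -1"
  shows "2 * (int (card {x. (d * (d - x ^ 2)) ^ ((q - 1) div 4) = 1})
           - int (card {x. (d * (d - x ^ 2)) ^ ((q - 1) div 4) = -1})) = jac (-1)"
proof -
  let ?y = "\<lambda>x. d * (d - x ^ 2)"
  let ?n = "(q - 1) div 4"
  have dnz: "d \<noteq> 0" using d by auto
  have ynz: "?y x \<noteq> 0" for x
  proof
    assume "?y x = 0"
    then have "d = x ^ 2" using dnz by simp
    then show False using d chi_square[of x] by (cases "x = 0") auto
  qed
  have q2: "z ^ ((q - 1) div 2) = (z ^ 2) ^ ?n" for z :: 'k
    using q_half(2) by (simp flip: power_mult)
  have fiber: "(\<Sum>z\<in>{z\<in>UNIV. z ^ 2 = ?y x}. chi z)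
      = 2 * ((if ?y x ^ ?n = 1 then 1 else 0) - (if ?y x ^ ?n = -1 then 1 else 0))" for x
  proof (cases "?y x ^ ?n = 1 \<or> ?y x ^ ?n = -1")
    case True
    then have "?y x ^ ((q - 1) div 2) = 1" unfolding q_half(2) mult.commute[of 2] power_mult by auto
    then have "chi (?y x) = 1" using ynz by (simp add: chi_def)
    then have c: "int (card {z. z ^ 2 = ?y x}) = 2" by (simp add: card_sqrt)
    have "chi z = (if ?y x ^ ?n = 1 then 1 else -1)" if "z ^ 2 = ?y x" for z
      using that q2[of z] ynz[of x] by (auto simp: chi_def)
    then have "(\<Sum>z\<in>{z\<in>UNIV. z ^ 2 = ?y x}. chi z)
        = (\<Sum>z\<in>{z. z ^ 2 = ?y x}. (if ?y x ^ ?n = 1 then 1 else -1))"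
      by (intro sum.cong) auto
    then show ?thesis using True c one_neq_minus_one by auto
  next
    case False
    have "{z. z ^ 2 = ?y x} = {}"
    proof (rule ccontr)
      assume "\<not> ?thesis"
      then obtain z where z: "z ^ 2 = ?y x" by auto
      then have "z \<noteq> 0" using ynz[of x] by auto
      then show False using power_half_k[of z] q2[of z] z False by auto
    qed
    then show ?thesis using False by simp
  qed
  have "2 * (int (card {x. ?y x ^ ?n = 1}) - int (card {x. ?y x ^ ?n = -1}))
      = (\<Sum>x\<in>UNIV. 2 * ((if ?y x ^ ?n = 1 then 1 else 0) - (if ?y x ^ ?n = -1 then 1 else 0)))"
    by (simp add: sum_distrib_left[symmetric] sum_subtractf sum.If_cases)
  also have "\<dots> = (\<Sum>x\<in>UNIV. \<Sum>z\<in>UNIV. if z ^ 2 = ?y x then chi z else 0)"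
    unfolding fiber[symmetric] by (simp add: sum.If_cases)
  also have "\<dots> = (\<Sum>z\<in>UNIV. \<Sum>x\<in>UNIV. if z ^ 2 = ?y x then chi z else 0)"
    by (rule sum.swap)
  also have "\<dots> = (\<Sum>z\<in>UNIV. chi z - chi z * chi (z ^ 2 - d ^ 2))"
  proof (rule sum.cong[OF refl])
    fix z
    have "(\<Sum>x\<in>UNIV. if z ^ 2 = ?y x then chi z else 0) = int (card {x. z ^ 2 = ?y x}) * chi z"
      by (simp add: sum.If_cases)
    also have "{x. z ^ 2 = ?y x} = {x. x ^ 2 = d - z ^ 2 / d}"
      using dnz by (auto simp: field_simps power2_eq_square)
    also have "int (card \<dots>) = 1 + chi (d - z ^ 2 / d)" by (rule card_sqrt)
    also have "chi (d - z ^ 2 / d) = - chi (z ^ 2 - d ^ 2)"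
    proof -
      have "d * (d - z ^ 2 / d) = - (z ^ 2 - d ^ 2)" using dnz by (simp add: field_simps power2_eq_square)
      then have "chi d * chi (d - z ^ 2 / d) = chi (z ^ 2 - d ^ 2)" by (metis chi_mult chi_minus)
      then show ?thesis using d by simp
    qed
    finally show "(\<Sum>x\<in>UNIV. if z ^ 2 = ?y x then chi z else 0) = chi z - chi z * chi (z ^ 2 - d ^ 2)"
      by (simp add: algebra_simps)
  qed
  also have "\<dots> = - jac ((-1) * d ^ 2)"
    by (simp add: sum_subtractf sum_chi jac_def)
  also have "\<dots> = jac (-1)" using jac_scale[OF dnz, of "-1"] d by simp
  finally show ?thesis .
qed

end

section \<open>Binary quadratic forms\<close>

text \<open>The triple \<open>(u\<^sub>0, u\<^sub>1, u\<^sub>2)\<close> stands for the polynomial \<open>u\<^sub>0 + 2 u\<^sub>1 t + u\<^sub>2 t\<^sup>2\<close>.\<close>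

type_synonym 'a quad = "'a \<times> 'a \<times> 'a"

text \<open>\<open>bil f f\<close> is minus half the discriminant. Orthogonality is apolarity: the
  root pairs of \<open>f\<close> and \<open>g\<close> separate each other harmonically.\<close>

fun bil :: "'a::comm_ring_1 quad \<Rightarrow> 'a quad \<Rightarrow> 'a" where
  "bil (f0, f1, f2) (g0, g1, g2) = f0 * g2 + f2 * g0 - 2 * f1 * g1"

text \<open>As a polynomial this is the Wronskian \<open>f g' - f' g\<close>. It serves as a vector
  product for \<open>bil\<close>: alternating, orthogonal to both arguments, and compatible with
  \<open>rho\<close> up to the determinant.\<close>

fun cr :: "'a::comm_ring_1 quad \<Rightarrow> 'a quad \<Rightarrow> 'a quad" where
  "cr (f0, f1, f2) (g0, g1, g2) = (2 * (f0 * g1 - f1 * g0), f0 * g2 - f2 * g0, 2 * (f1 * g2 - f2 * g1))"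

fun scal :: "'a::comm_ring_1 \<Rightarrow> 'a quad \<Rightarrow> 'a quad" where
  "scal c (u0, u1, u2) = (c * u0, c * u1, c * u2)"

fun ev :: "'a::comm_ring_1 quad \<Rightarrow> 'a \<Rightarrow> 'a" where
  "ev (u0, u1, u2) t = u0 + 2 * u1 * t + u2 * t ^ 2"

text \<open>The congruence \<open>A W A^T\<close>, where \<open>W\<close> is the symmetric matrix
  with rows \<open>(w0, w1)\<close>, \<open>(w1, w2)\<close> and \<open>A\<close> has rows
  \<open>(a, b)\<close>, \<open>(c, d)\<close>. On polynomials it is a Moebius substitution, see
  \<open>ev_rho\<close>.\<close>

fun rho :: "'a::comm_ring_1 \<Rightarrow> 'a \<Rightarrow> 'a \<Rightarrow> 'a \<Rightarrow> 'a quad \<Rightarrow> 'a quad" where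
  "rho a b c d (w0, w1, w2) =
    (a ^ 2 * w0 + 2 * a * b * w1 + b ^ 2 * w2,
     a * c * w0 + (a * d + b * c) * w1 + b * d * w2,
     c ^ 2 * w0 + 2 * c * d * w1 + d ^ 2 * w2)"

fun emb :: "'a::field quad \<Rightarrow> 'a alg_closure quad" where
  "emb (u0, u1, u2) = (to_ac u0, to_ac u1, to_ac u2)"

lemma bil_commute: "bil f g = bil g f"
  by (cases f; cases g) (simp add: algebra_simps)

lemma bil_linear [simp]:
  "bil (scal c f) g = c * bil f g" "bil f (scal c g) = c * bil f g"
  "bil (f + f') g = bil f g + bil f' g" "bil f (g + g') = bil f g + bil f g'"
  "bil (- f) g = - bil f g" "bil f (- g) = - bil f g"
  by (cases f; cases g; cases f'; cases g'; simp add: algebra_simps)+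

lemma cr_linear [simp]:
  "cr (scal c f) g = scal c (cr f g)" "cr f (scal c g) = scal c (cr f g)"
  "cr f (g + g') = cr f g + cr f g'" "cr f (- g) = - cr f g" "cr f f = 0"
  by (cases f; cases g; cases g'; simp add: algebra_simps zero_prod_def)+

lemma scal_simps [simp]:
  "scal c (scal d f) = scal (c * d) f" "scal 1 f = f" "scal 0 f = 0" "scal (- c) f = - scal c f"
  "scal c (- f) = - scal c f" "scal c 0 = 0"
  by (cases f; simp add: algebra_simps zero_prod_def)+

lemma scal_eq_0_iff [simp]: "scal c f = 0 \<longleftrightarrow> c = 0 \<or> f = 0" for c :: "'a::idom"
  by (cases f) (auto simp: zero_prod_def)

lemma scal_cancel [simp]: "f \<noteq> 0 \<Longrightarrow> scal c f = scal d f \<longleftrightarrow> c = d" for c :: "'a::idom"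
  by (cases f) (auto simp: zero_prod_def)

lemma ev_linear [simp]:
  "ev (scal c f) t = c * ev f t" "ev (f + g) t = ev f t + ev g t" "ev (- f) t = - ev f t"
  by (cases f; cases g; simp add: algebra_simps)+

lemma emb_simps [simp]:
  "emb (scal c f) = scal (to_ac c) (emb f)" "emb (f + g) = emb f + emb g" "emb (- f) = - emb f"
  by (cases f; cases g; simp)+

lemma bil_emb [simp]: "bil (emb f) (emb g) = to_ac (bil f g)"
  by (cases f; cases g) simp

lemma rho_linear [simp]:
  "rho a b c d (scal k f) = scal k (rho a b c d f)"
  "rho a b c d (f + g) = rho a b c d f + rho a b c d g"
  by (cases f; cases g; simp add: algebra_simps)+

lemma bil_rho: "bil (rho a b c d f) (rho a b c d g) = (a * d - b * c) ^ 2 * bil f g"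
  by (cases f; cases g) (simp add: algebra_simps power2_eq_square)

lemma cr_rho: "cr (rho a b c d f) (rho a b c d g) = scal (a * d - b * c) (rho a b c d (cr f g))"
  by (cases f; cases g) (simp add: algebra_simps power2_eq_square)

lemma rho_rho: "rho a b c d (rho a' b' c' d' f) =
    rho (a * a' + b * c') (a * b' + b * d') (c * a' + d * c') (c * b' + d * d') f"
  by (cases f) (simp add: algebra_simps power2_eq_square)

lemma rho_scalar: "rho a 0 0 a f = scal (a ^ 2) f"
  by (cases f) (simp add: power2_eq_square)

lemma rho_inverse: "rho d (- b) (- c) a (rho a b c d f) = scal ((a * d - b * c) ^ 2) f"
proof -
  have "rho d (- b) (- c) a (rho a b c d f) = rho (a * d - b * c) 0 0 (a * d - b * c) f"
    by (simp add: rho_rho algebra_simps)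
  then show ?thesis by (simp only: rho_scalar)
qed

lemma ev_rho:
  fixes a :: "'a::field"
  assumes "a + c * t \<noteq> 0"
  shows "ev (rho a b c d f) t = (a + c * t) ^ 2 * ev f ((b + d * t) / (a + c * t))"
proof (cases f)
  case (fields f0 f1 f2)
  define y where "y = (b + d * t) / (a + c * t)"
  have y: "b + d * t = y * (a + c * t)" using assms by (simp add: y_def)
  have "ev (rho a b c d f) t = f0 * (a + c * t) ^ 2 + 2 * f1 * (a + c * t) * (b + d * t) + f2 * (b + d * t) ^ 2"
    unfolding fields rho.simps ev.simps by Groebner_Basis.algebra
  also have "\<dots> = (a + c * t) ^ 2 * ev f y"
    unfolding fields ev.simps y by Groebner_Basis.algebra
  finally show ?thesis by (simp add: y_def)
qed

text \<open>Up to a constant, \<open>bil (cr u u') w\<close> is the determinant of three vectors, so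
  a product of two such values is a multiple of the Gram determinant of \<open>w, u, u'\<close>
  against \<open>w', u, u'\<close>. The swapped arguments of the second \<open>cr\<close> reverse
  the sign.\<close>

lemma gram_identity:
  fixes w :: "'a::idom quad"
  shows "bil (cr u u') w * bil (cr u' u) w' =
    2 * (bil w w' * (bil u u' * bil u u' - bil u u * bil u' u')
       - bil w u' * (bil u w' * bil u u' - bil u u * bil u' w')
       + bil w u * (bil u w' * bil u' u' - bil u u' * bil u' w'))"
proof -
  obtain u0 u1 u2 where u: "u = (u0, u1, u2)" by (cases u)
  obtain v0 v1 v2 where v: "u' = (v0, v1, v2)" by (cases u')
  obtain w0 w1 w2 where w: "w = (w0, w1, w2)" by (cases w)
  obtain x0 x1 x2 where x: "w' = (x0, x1, x2)" by (cases w')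
  show ?thesis unfolding u v w x bil.simps cr.simps by Groebner_Basis.algebra
qed

text \<open>Moving \<open>T\<close> to infinity and \<open>S\<close> to zero turns the hypotheses into
  \<open>w\<^sub>0 w'\<^sub>2 = 2 w\<^sub>1 w'\<^sub>1\<close>, so that only one term of \<open>bil w w'\<close> survives.\<close>

lemma ev_product:
  fixes T S :: "'a::field"
  assumes "ev u T = 0" "ev u' S = 0" "bil u u' = 0" "bil w u' = 0" "bil w' u = 0"
    and "ev u S \<noteq> 0" "ev u' T \<noteq> 0"
  shows "ev w T * ev w' S = bil w w' * (T - S) ^ 2"
proof -
  obtain u0 u1 u2 where u: "u = (u0, u1, u2)" by (cases u)
  obtain v0 v1 v2 where v: "u' = (v0, v1, v2)" by (cases u')
  obtain w0 w1 w2 where w: "w = (w0, w1, w2)" by (cases w)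
  obtain x0 x1 x2 where x: "w' = (x0, x1, x2)" by (cases w')
  have u0: "u0 = - 2 * u1 * T - u2 * T ^ 2" using assms(1) unfolding u ev.simps by Groebner_Basis.algebra
  have v0: "v0 = - 2 * v1 * S - v2 * S ^ 2" using assms(2) unfolding v ev.simps by Groebner_Basis.algebra
  let ?W = "w0 + w1 * (T + S) + w2 * T * S" and ?X = "x0 + x1 * (T + S) + x2 * T * S"
  let ?V = "v0 + v1 * (T + S) + v2 * T * S"
  \<comment> \<open>Multiplied by the nonzero \<open>ev u S * ev u' T\<close>, the claim becomes a
    combination of the three orthogonality relations. \<open>?W\<close>, \<open>?V\<close>,
    \<open>?X\<close> are the polarised values of \<open>w\<close>, \<open>u'\<close>,
    \<open>w'\<close> at the pair \<open>T, S\<close>.\<close>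
  have "(bil w w' * (T - S) ^ 2 - ev w T * ev w' S) * (ev u S * ev u' T)
     = (T - S) ^ 2 * (bil w u' * (ev w' T * ev u S) + 2 * ?W * ?V * bil w' u - 2 * ?W * ?X * bil u u')"
    unfolding u v w x bil.simps ev.simps u0 v0 by Groebner_Basis.algebra
  then show ?thesis using assms by simp
qed

text \<open>Signs arise by comparing \<open>m\<close>-th powers with a square root of
  \<open>-2\<close>: \<open>\<kappa>\<close> is the reference for real points off the conic and
  \<open>\<kappa>'\<close> for the conic. How the two are related is fixed only in
  \<open>hermitian_quads_choice\<close>.\<close>

locale hermitian_quads = quadratic_extension p \<delta> for p :: nat and \<delta> :: "'f::{field,finite}" +
  fixes \<kappa> \<kappa>' :: 'f
  assumes \<kappa>_squared: "\<kappa> ^ 2 = -2" and \<kappa>'_squared: "\<kappa>' ^ 2 = -2"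
begin

fun fr :: "'f quad \<Rightarrow> 'f quad" where
  "fr (u0, u1, u2) = (u0 ^ p, u1 ^ p, u2 ^ p)"

lemma fr_simps [simp]:
  "fr (fr f) = f" "fr (scal c f) = scal (c ^ p) (fr f)" "fr (f + g) = fr f + fr g" "fr (- f) = - fr f"
  by (cases f; cases g; simp)+

lemma fr_zero [simp]: "fr 0 = 0" by (simp add: zero_prod_def)

lemma bil_fr: "bil (fr f) (fr g) = (bil f g) ^ p"
  by (cases f; cases g) simp

lemma cr_fr: "cr (fr f) (fr g) = fr (cr f g)"
  by (cases f; cases g) simp

lemma bil_conj: "bil f (fr g) = (bil g (fr f)) ^ p"
  using bil_fr[of g "fr f"] bil_commute[of f] by (simp only: fr_simps)

lemma fr_rho:
  assumes "rational a" "rational b" "rational c" "rational d"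
  shows "fr (rho a b c d f) = rho a b c d (fr f)"
  by (cases f) (simp add: assms)

lemma ev_emb_fr: "ev (emb (fr f)) (t ^ p) = (ev (emb f) t) ^ p"
  by (cases f) simp

definition isotropic :: "'f quad \<Rightarrow> bool" where
  "isotropic u \<longleftrightarrow> u \<noteq> 0 \<and> bil u (fr u) = 0"

text \<open>A pair \<open>(u, w)\<close> as below spans a generator, see \<open>generator_line\<close>.\<close>

definition flag :: "'f quad \<Rightarrow> 'f quad \<Rightarrow> bool" where
  "flag u w \<longleftrightarrow> isotropic u \<and> bil u (fr w) = 0 \<and> bil w (fr w) = 1"

lemma flagD:
  assumes "flag u w"
  shows "u \<noteq> 0" "isotropic u" "bil u (fr u) = 0" "bil u (fr w) = 0" "bil w (fr u) = 0" "bil w (fr w) = 1"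
proof -
  show "bil w (fr u) = 0" using assms by (simp only: bil_conj[of w u] flag_def frob_zero)
qed (use assms in \<open>auto simp: flag_def isotropic_def\<close>)

lemma isotropic_scal: "c \<noteq> 0 \<Longrightarrow> isotropic (scal c u) \<longleftrightarrow> isotropic u"
  by (simp add: isotropic_def)

lemma flag_scal: "c \<noteq> 0 \<Longrightarrow> flag (scal c u) w \<longleftrightarrow> flag u w"
  by (simp add: flag_def isotropic_scal)

lemma flag_add: "flag u w \<Longrightarrow> flag u (w + scal c u)"
  by (frule flagD(5)) (simp add: flag_def isotropic_def)

lemma flag_norm_one: "l * l ^ p = 1 \<Longrightarrow> flag u w \<Longrightarrow> flag u (scal l w)"
  by (auto simp: flag_def mult.commute)

lemma flag_minus: "flag u w \<Longrightarrow> flag u (- w)"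
  by (simp add: flag_def)

lemma isotropic_conic_cases:
  assumes "isotropic u" "bil u u = 0"
  obtains c where "c \<noteq> 0" "u = scal c (1, 0, 0)"
    | c t where "c \<noteq> 0" "rational t" "u = scal c (t ^ 2, - t, 1)"
proof -
  obtain u0 u1 u2 where u: "u = (u0, u1, u2)" by (cases u)
  have b: "u1 ^ 2 = u0 * u2"
  proof -
    have "2 * (u0 * u2 - u1 ^ 2) = 0" using assms(2) by (simp add: u algebra_simps power2_eq_square)
    then show ?thesis by simp
  qed
  show thesis
  proof (cases "u2 = 0")
    case True
    then have "u = scal u0 (1, 0, 0)" using b by (simp add: u)
    then show thesis using that(1)[of u0] assms(1) by (cases "u0 = 0") (auto simp: isotropic_def zero_prod_def)
  next
    case False
    define t where "t = - u1 / u2"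
    have eq: "u = scal u2 (t ^ 2, - t, 1)"
      using b False by (simp add: u t_def power_divide power2_eq_square)
    have "u2 * u2 ^ p * (t - t ^ p) ^ 2 = bil u (fr u)"
      unfolding eq by (simp add: algebra_simps power2_eq_square)
    then have "t ^ p = t" using assms(1) False by (simp add: isotropic_def)
    then show thesis using that(2)[OF False _ eq] by blast
  qed
qed

text \<open>On the conic \<open>fr u\<close> is a multiple of \<open>u\<close>, so \<open>w\<close>
  lies on the tangent at \<open>u\<close>, where the product with \<open>u\<close> yields multiples
  of \<open>u\<close>. The factor changes sign with \<open>w\<close> and ignores multiples of
  \<open>u\<close> added to \<open>w\<close>: it is the invariant behind the sign of a conic
  flag.\<close>

lemma conic_eigenvalue:
  assumes f: "flag u w" and "bil u u = 0"
  obtains \<nu> where "cr u w = scal \<nu> u" "\<nu> * \<nu> ^ p = -2"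
proof -
  obtain w0 w1 w2 where w: "w = (w0, w1, w2)" by (cases w)
  note D = flagD[OF f]
  show thesis
    using isotropic_conic_cases[OF D(2) assms(2)]
  proof cases
    case (1 c)
    have w2: "w2 = 0" using D(5) 1 by (simp add: w)
    have "-2 * (w1 * w1 ^ p) = 1" using D(6) by (simp add: w w2 algebra_simps)
    moreover have "(2 * w1) * (2 * w1) ^ p = -2 * (-2 * (w1 * w1 ^ p))" by simp
    ultimately have "(2 * w1) * (2 * w1) ^ p = -2" by simp
    moreover have "cr u w = scal (2 * w1) u" by (simp add: 1 w w2)
    ultimately show thesis using that by blast
  next
    case (2 c t)
    have "c ^ p * (w0 + w2 * t ^ 2 + 2 * w1 * t) = 0"
      using D(5) 2(2) by (simp add: w 2(3) algebra_simps power2_eq_square)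
    then have "w0 + w2 * t ^ 2 + 2 * w1 * t = 0" using 2(1) by simp
    then have w0: "w0 = - 2 * w1 * t - w2 * t ^ 2" by Groebner_Basis.algebra
    define \<nu> where "\<nu> = - 2 * (w1 + w2 * t)"
    have "-2 * ((w1 + w2 * t) * (w1 + w2 * t) ^ p) = 1"
      using D(6) 2(2) unfolding w w0 by (simp add: algebra_simps power2_eq_square)
    moreover have "\<nu> * \<nu> ^ p = -2 * (-2 * ((w1 + w2 * t) * (w1 + w2 * t) ^ p))"
      unfolding \<nu>_def frob_mult frob_minus frob_numeral by (simp only: mult_ac mult_minus_left mult_minus_right)
    ultimately have "\<nu> * \<nu> ^ p = -2" by simp
    moreover have "cr u w = scal (c * \<nu>) (t ^ 2, - t, 1)"
      unfolding 2(3) w w0 \<nu>_def by (simp add: algebra_simps power2_eq_square)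
    then have "cr u w = scal \<nu> u" by (simp add: 2(3) mult.commute)
    ultimately show thesis using that by blast
  qed
qed

lemma norm_minus_2_power_m:
  fixes k :: 'f
  assumes "\<nu> * \<nu> ^ p = -2" "k ^ 2 = -2"
  shows "\<nu> ^ m = k \<or> \<nu> ^ m = - k"
proof -
  have "(\<nu> ^ m) ^ 2 = k ^ 2" using assms power_m_squared[of \<nu>] by simp
  then show ?thesis by (simp add: power2_eq_iff)
qed

text \<open>A multiple of the determinant of \<open>u\<close>, \<open>fr u\<close>,
  \<open>w\<close>, hence unchanged when a multiple of \<open>u\<close> is added to
  \<open>w\<close>. It vanishes on the conic, which therefore needs an invariant of its own.\<close>

definition disc_form :: "'f quad \<Rightarrow> 'f quad \<Rightarrow> 'f" where
  "disc_form u w = bil (cr u (fr u)) w"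

lemma disc_form_norm:
  assumes "flag u w"
  shows "disc_form u w * disc_form u w ^ p = -2 * (bil u u * bil u u ^ p)"
proof -
  have "disc_form u w ^ p = bil (cr (fr u) u) (fr w)"
    using bil_fr[of "cr u (fr u)" w] cr_fr[of u "fr u"] by (simp add: disc_form_def)
  then show ?thesis
    using gram_identity[of u "fr u" w "fr w"] flagD[OF assms] bil_fr[of u u]
    by (simp add: disc_form_def)
qed

text \<open>The exponent comes from \<open>2 * m ^ 2 = half + (p + 1)\<close>: if
  \<open>b = bil u u\<close> is a nonzero square, then \<open>b ^ (2 * m ^ 2)\<close> is the norm of
  \<open>b\<close>, so \<open>\<kappa> * b ^ (m ^ 2)\<close> is a square root of the norm of
  \<open>disc_form u w\<close>.\<close>

lemma disc_form_power_m:
  assumes "flag u w" "bil u u ^ half = 1"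
  shows "disc_form u w ^ m = \<kappa> * bil u u ^ (m ^ 2) \<or> disc_form u w ^ m = - (\<kappa> * bil u u ^ (m ^ 2))"
proof -
  let ?b = "bil u u"
  have e: "2 * m ^ 2 = half + (p + 1)"
  proof -
    have "2 * m ^ 2 = m * (p + 1)" unfolding two_m[symmetric] by (simp add: power2_eq_square)
    also have "\<dots> = m * (p - 1) + 2 * m" using p_gt by (cases p) simp_all
    finally show ?thesis using two_m half_eq by simp
  qed
  have "(?b ^ (m ^ 2)) ^ 2 = ?b ^ half * ?b ^ (p + 1)"
    by (simp only: power_mult[symmetric] mult.commute[of _ 2] e power_add)
  then have "(\<kappa> * ?b ^ (m ^ 2)) ^ 2 = -2 * (?b * ?b ^ p)"
    using assms(2) \<kappa>_squared by (simp add: power_mult_distrib)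
  then have "(disc_form u w ^ m) ^ 2 = (\<kappa> * ?b ^ (m ^ 2)) ^ 2"
    using disc_form_norm[OF assms(1)] by (simp add: power_m_squared)
  then show ?thesis by (simp add: power2_eq_iff)
qed

lemma isotropic_nonconic_lead: "isotropic (u0, u1, u2) \<Longrightarrow> bil (u0, u1, u2) (u0, u1, u2) \<noteq> 0 \<Longrightarrow> u2 \<noteq> 0"
  by (auto simp: isotropic_def)

section \<open>Roots of isotropic forms in the algebraic closure\<close>

lemma roots_exist:
  fixes u1 :: 'f
  obtains t t' where "ev (emb (u0, u1, 1)) t = 0" "ev (emb (u0, u1, 1)) t' = 0"
    "to_ac u0 = t * t'" "2 * to_ac u1 = - (t + t')"
    "to_ac (bil (u0, u1, 1) (u0, u1, 1)) * 2 = - ((t - t') ^ 2)"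
proof -
  obtain s where s: "s ^ 2 = to_ac (u1 ^ 2 - u0)"
    using nth_root_exists[of 2 "to_ac (u1 ^ 2 - u0)"] by auto
  then have u0: "to_ac u0 = to_ac u1 ^ 2 - s ^ 2" by simp
  show thesis
  proof (rule that[of "- to_ac u1 + s" "- to_ac u1 - s"])
  qed (simp_all add: u0 power2_eq_square algebra_simps)
qed

lemma ev_emb_monic:
  assumes "to_ac u0 = t * t'" "2 * to_ac u1 = - (t + t')"
  shows "ev (emb (u0, u1, 1)) x = (x - t) * (x - t')"
  unfolding emb.simps ev.simps assms by (simp add: algebra_simps power2_eq_square)

lemma other_root:
  fixes u0 u1 :: 'f
  assumes "ev (emb (u0, u1, 1)) t = 0" and "t' = - 2 * to_ac u1 - t"
  shows "to_ac u0 = t * t'" "2 * to_ac u1 = - (t + t')" "ev (emb (u0, u1, 1)) t' = 0"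
    "to_ac (bil (u0, u1, 1) (u0, u1, 1)) * 2 = - ((t - t') ^ 2)"
proof -
  have u0: "to_ac u0 = - (2 * to_ac u1 * t + t ^ 2)" using assms(1) by (simp add: eq_neg_iff_add_eq_0 add.assoc del: minus_add_distrib)
  show "to_ac u0 = t * t'" "2 * to_ac u1 = - (t + t')" "ev (emb (u0, u1, 1)) t' = 0"
    "to_ac (bil (u0, u1, 1) (u0, u1, 1)) * 2 = - ((t - t') ^ 2)"
    by (simp_all add: u0 assms(2) power2_eq_square algebra_simps)
qed

text \<open>\<open>bil u (fr u) = 0\<close> says that the pairs \<open>t, t'\<close> and
  \<open>t ^ p, t' ^ p\<close> are harmonic; this is the product equation. A root common to both
  pairs would then lead to \<open>t = t'\<close>, that is, to a point of the conic.\<close>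

lemma root_facts:
  assumes iso: "isotropic (u0, u1, 1)" and b: "bil (u0, u1, 1) (u0, u1, 1) \<noteq> 0"
    and t: "ev (emb (u0, u1, 1)) t = 0" and t': "t' = - 2 * to_ac u1 - t"
  shows "t \<noteq> t'" "t ^ p \<noteq> t" "t' ^ p \<noteq> t'" "t ^ p \<noteq> t'" "t' ^ p \<noteq> t"
    "(t - t ^ p) * (t' - t' ^ p) = (t - t' ^ p) * (t ^ p - t')"
proof -
  note o = other_root[OF t t']
  show ne: "t \<noteq> t'"
  proof
    assume "t = t'"
    then have "to_ac (bil (u0, u1, 1) (u0, u1, 1)) * 2 = 0" using o(4) by simp
    then show False using b by (simp del: bil.simps)
  qed
  have o1: "to_ac (u0 ^ p) = t ^ p * t' ^ p" using o(1) by (metis frob_mult_ac to_ac_power)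
  have o2: "2 * to_ac (u1 ^ p) = - (t ^ p + t' ^ p)"
    using arg_cong[OF o(2), of "\<lambda>x. x ^ p"] by simp
  have "to_ac (bil (u0, u1, 1) (fr (u0, u1, 1))) * 2 = 0" using iso by (simp add: isotropic_def del: bil.simps)
  moreover have "to_ac (bil (u0, u1, 1) (fr (u0, u1, 1))) * 2
     = 2 * to_ac u0 + 2 * to_ac (u0 ^ p) - (2 * to_ac u1) * (2 * to_ac (u1 ^ p))"
    by (simp add: algebra_simps)
  ultimately have "2 * (t * t') + 2 * (t ^ p * t' ^ p) - (t + t') * (t ^ p + t' ^ p) = 0"
    unfolding o(1) o1 o(2) o2 by (simp add: minus_mult_minus del: minus_add_distrib)
  then show h: "(t - t ^ p) * (t' - t' ^ p) = (t - t' ^ p) * (t ^ p - t')"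
    by (simp add: algebra_simps)
  show 1: "t ^ p \<noteq> t"
  proof
    assume "t ^ p = t"
    then have "t = t' ^ p \<or> t = t'" using h by auto
    then show False using ne \<open>t ^ p = t\<close> by (metis frob_inj_ac)
  qed
  show 2: "t' ^ p \<noteq> t'"
  proof
    assume "t' ^ p = t'"
    then have "t = t' \<or> t ^ p = t'" using h by auto
    then show False using ne \<open>t' ^ p = t'\<close> by (metis frob_inj_ac)
  qed
  show "t ^ p \<noteq> t'" "t' ^ p \<noteq> t" using h 1 2 by auto
qed

text \<open>An instance of \<open>ev_product\<close> with the conjugates in place of
  \<open>u'\<close>, \<open>w'\<close> and with \<open>S = s ^ p\<close>. For \<open>s = t\<close>
  it puts the point \<open>(w(t), t)\<close> on one of the two curves; for the other root
  \<open>s\<close> it links the values of \<open>w\<close> at the two roots.\<close>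

lemma ev_root_product:
  assumes f: "flag (u0, u1, 1) w" and b: "bil (u0, u1, 1) (u0, u1, 1) \<noteq> 0"
    and t: "ev (emb (u0, u1, 1)) t = 0" and s: "ev (emb (u0, u1, 1)) s = 0"
  shows "ev (emb w) t * (ev (emb w) s) ^ p = (t - s ^ p) ^ 2"
proof -
  let ?u = "(u0, u1, 1)"
  note D = flagD[OF f]
  define t' where "t' = - 2 * to_ac u1 - t"
  define s' where "s' = - 2 * to_ac u1 - s"
  note rt = root_facts[OF D(2) b t t'_def] and rs = root_facts[OF D(2) b s s'_def]
  note ot = other_root[OF t t'_def] and os = other_root[OF s s'_def]
  have ev: "ev (emb ?u) x = (x - t) * (x - t')" for x
    by (rule ev_emb_monic[OF ot(1,2)])
  have st: "s = t \<or> s = t'" using s unfolding ev by simp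
  have ss: "s' = t \<or> s' = t'" using os(3) unfolding ev by simp
  have "ev (emb ?u) (s ^ p) \<noteq> 0" unfolding ev using st rt rs by auto
  moreover have "ev (emb (fr ?u)) t \<noteq> 0"
  proof
    assume "ev (emb (fr ?u)) t = 0"
    moreover have "ev (emb (fr ?u)) t = (t - s ^ p) * (t - s' ^ p)"
    proof -
      have "to_ac (u0 ^ p) = s ^ p * s' ^ p" using os(1) by (metis frob_mult_ac to_ac_power)
      moreover have "2 * to_ac (u1 ^ p) = - (s ^ p + s' ^ p)"
        using arg_cong[OF os(2), of "\<lambda>x. x ^ p"] by simp
      ultimately show ?thesis using ev_emb_monic[of "u0 ^ p" "s ^ p" "s' ^ p" "u1 ^ p" t] by simp
    qed
    ultimately have "t = s ^ p \<or> t = s' ^ p" by simp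
    then show False using st ss rt by metis
  qed
  moreover have "ev (emb (fr ?u)) (s ^ p) = 0" using s by (simp only: ev_emb_fr frob_zero)
  ultimately have "ev (emb w) t * ev (emb (fr w)) (s ^ p) = to_ac (bil w (fr w)) * (t - s ^ p) ^ 2"
    using ev_product[OF t, of "emb (fr ?u)" "s ^ p" "emb w" "emb (fr w)"] D
    by (simp only: bil_emb bil_commute[of "fr w"]) (simp del: bil.simps emb.simps ev.simps fr.simps)
  then show ?thesis using D by (simp add: ev_emb_fr)
qed

lemma ev_root_power_m:
  assumes f: "flag (u0, u1, 1) w" and b: "bil (u0, u1, 1) (u0, u1, 1) \<noteq> 0"
    and t: "ev (emb (u0, u1, 1)) t = 0"
  shows "(ev (emb w) t) ^ m = t ^ p - t \<or> (ev (emb w) t) ^ m = - (t ^ p - t)"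
proof -
  have "((ev (emb w) t) ^ m) ^ 2 = (t ^ p - t) ^ 2"
    using ev_root_product[OF f b t t] by (simp add: power_m_squared power2_commute[of t])
  then show ?thesis by (simp add: power2_eq_iff)
qed

text \<open>Raising to \<open>p ^ 2\<close> fixes the field and permutes the two roots; it fixes
  them exactly if the discriminant is a square. The factor \<open>- 1 / 2\<close> in
  \<open>s ^ 2\<close> is rational, hence itself a square, and does not affect this.\<close>

lemma root_frob_frob:
  fixes u0 u1 :: 'f
  assumes b: "bil (u0, u1, 1) (u0, u1, 1) \<noteq> 0" and t: "ev (emb (u0, u1, 1)) t = 0"
  shows "(t ^ p) ^ p = (if bil (u0, u1, 1) (u0, u1, 1) ^ half = 1 then t else - 2 * to_ac u1 - t)"
proof -
  let ?b = "bil (u0, u1, 1) (u0, u1, 1)"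
  define s where "s = t + to_ac u1"
  have s2: "s ^ 2 = to_ac (- 1 / 2 * ?b)"
  proof -
    have u0: "to_ac u0 = - (2 * to_ac u1 * t + t ^ 2)"
      using t by (simp add: eq_neg_iff_add_eq_0 add.assoc del: minus_add_distrib)
    have "2 * s ^ 2 = - to_ac ?b"
      by (simp add: s_def u0 algebra_simps power2_eq_square)
    also have "\<dots> = 2 * to_ac (- 1 / 2 * ?b)"
    proof -
      have "- ?b = 2 * (- 1 / 2 * ?b)" by (simp del: bil.simps)
      then show ?thesis by (metis to_ac_minus to_ac_mult to_ac_numeral)
    qed
    finally show ?thesis using two_ac_nz mult_left_cancel by blast
  qed
  have "s ^ (p * p) = s * (s ^ 2) ^ half"
  proof -
    have "2 * half = p ^ 2 - 1" using half_eq two_m card_minus_1 card_f by (metis mult.assoc)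
    then have "p * p = 1 + 2 * half" using p_gt by (simp add: power2_eq_square)
    then show ?thesis by (simp add: power_mult)
  qed
  also have "(s ^ 2) ^ half = to_ac (?b ^ half)"
    using rational_power_half[of "-1/2"] unfolding s2 to_ac_power[symmetric] power_mult_distrib by simp
  finally have s: "s ^ (p * p) = s * to_ac (?b ^ half)" .
  have "(t ^ p) ^ p = (s ^ p) ^ p - to_ac ((u1 ^ p) ^ p)"
    by (simp add: s_def del: frob_frob)
  also have "\<dots> = s * to_ac (?b ^ half) - to_ac u1" using s by (simp add: power_mult del: bil.simps)
  finally have eq: "(t ^ p) ^ p = s * to_ac (?b ^ half) - to_ac u1" .
  show ?thesis
  proof (cases "?b ^ half = 1")
    case True
    then show ?thesis using eq by (simp only: if_True) (simp add: s_def)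
  next
    case False
    then have "?b ^ half = -1" using power_half_cases[OF b] by blast
    then show ?thesis using eq False by (simp only: if_False) (simp add: s_def)
  qed
qed

text \<open>Comparing \<open>ev_root_product\<close> for the pairs \<open>t, t'\<close> and
  \<open>t', t'\<close> gives \<open>w(t) * A' ^ 2 = w(t') * z ^ 2\<close>. In the
  \<open>m\<close>-th power, \<open>A' ^ 2\<close> becomes the norm of \<open>A'\<close>, which is
  \<open>- A' ^ 2\<close> since \<open>A' ^ p = - A'\<close>, and \<open>z ^ 2\<close> becomes the
  norm of \<open>z\<close>, which is \<open>A * A'\<close> by harmonicity. The minus sign separates
  the two roots.\<close>

lemma real_roots_opposite:
  assumes f: "flag (u0, u1, 1) w" and b: "bil (u0, u1, 1) (u0, u1, 1) \<noteq> 0"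
    and sq: "bil (u0, u1, 1) (u0, u1, 1) ^ half = 1"
    and t: "ev (emb (u0, u1, 1)) t = 0" and t': "t' = - 2 * to_ac u1 - t"
    and v: "(ev (emb w) t) ^ m = e * (t ^ p - t)"
  shows "(ev (emb w) t') ^ m = - e * (t' ^ p - t')"
proof -
  note r = root_facts[OF flagD(2)[OF f] b t t'] and o = other_root[OF t t']
  let ?v = "ev (emb w)" and ?z = "t - t' ^ p"
  let ?A = "t - t ^ p" and ?A' = "t' - t' ^ p"
  have ff: "(t' ^ p) ^ p = t'" using root_frob_frob[OF b o(3)] sq by simp
  have "?v t * ?v t' ^ p = ?z ^ 2" by (rule ev_root_product[OF f b t o(3)])
  moreover have "?v t' * ?v t' ^ p = ?A' ^ 2" by (rule ev_root_product[OF f b o(3) o(3)])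
  moreover have "?v t * (?v t' * ?v t' ^ p) = ?v t' * (?v t * ?v t' ^ p)" by (simp only: mult_ac)
  ultimately have "?v t * ?A' ^ 2 = ?v t' * ?z ^ 2" by simp
  then have "?v t ^ m * (?A' ^ 2) ^ m = ?v t' ^ m * (?z ^ 2) ^ m"
    by (metis power_mult_distrib)
  moreover have "(?A' ^ 2) ^ m = - (?A' ^ 2)"
    unfolding power_mult[symmetric] two_m power_p_plus_1 by (simp add: ff power2_eq_square algebra_simps)
  moreover have "(?z ^ 2) ^ m = ?A * ?A'"
    unfolding power_mult[symmetric] two_m power_p_plus_1 using r(6) by (simp add: ff algebra_simps)
  ultimately have "?v t ^ m * (- (?A' ^ 2)) = ?v t' ^ m * (?A * ?A')" by simp
  then have "?A' * (- (?v t ^ m) * ?A') = ?A' * (?v t' ^ m * ?A)"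
    by (simp only: power2_eq_square mult_minus_left mult_minus_right mult.assoc mult.commute mult.left_commute)
  then have "- (?v t ^ m) * ?A' = ?v t' ^ m * ?A" using r(3) mult_left_cancel[of ?A'] by (metis right_minus_eq)
  then have "?A * (e * ?A') = ?A * (?v t' ^ m)" unfolding v by (simp add: algebra_simps)
  then have "e * ?A' = ?v t' ^ m" using r(2) mult_left_cancel[of ?A] by (metis right_minus_eq)
  then show ?thesis by (simp add: algebra_simps)
qed

text \<open>Here \<open>t' = (t ^ p) ^ p\<close>, and both \<open>w\<close> and the equation of the
  curve have coefficients in the field, so applying the Frobenius map twice carries the relation
  from \<open>t\<close> to \<open>t'\<close>.\<close>

lemma imaginary_roots_agree:
  fixes u0 u1 :: 'f
  assumes "bil (u0, u1, 1) (u0, u1, 1) \<noteq> 0" "bil (u0, u1, 1) (u0, u1, 1) ^ half \<noteq> 1"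
    and t: "ev (emb (u0, u1, 1)) t = 0" and t': "t' = - 2 * to_ac u1 - t"
    and v: "(ev (emb (w::'f quad)) t) ^ m = e * (t ^ p - t)" and e: "e = 1 \<or> e = -1"
  shows "(ev (emb w) t') ^ m = e * (t' ^ p - t')"
proof -
  have ff: "(t ^ p) ^ p = t'" using root_frob_frob[OF assms(1) t] assms(2) t' by simp
  have "ev (emb w) t' = (ev (emb w) t ^ p) ^ p"
    using ev_emb_fr[of w t] ev_emb_fr[of "fr w" "t ^ p"] ff by simp
  then have "ev (emb w) t' ^ m = ((ev (emb w) t ^ m) ^ p) ^ p"
    by (metis mult.commute power_mult)
  also have "\<dots> = e * (t' ^ p - t')" using v e ff by auto
  finally show ?thesis .
qed

end

context hermitian_quads
begin

section \<open>The sign of a flag\<close>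

text \<open>The point \<open>u\<close> of the Hermitian curve lies on the conic if \<open>bil u u = 0\<close>, and otherwise
  \<open>bil u u ^ half\<close> tells whether the roots of \<open>u\<close> lie in the field. If they do not, the sign says
  on which of the two curves \<open>x ^ m = \<plusminus>(t ^ p - t)\<close> the roots of \<open>u\<close> lie, where \<open>x = w(t)\<close>.\<close>

definition pos :: "'f quad \<Rightarrow> 'f quad \<Rightarrow> bool" where
  "pos u w \<longleftrightarrow>
    (if bil u u = 0 then \<exists>\<nu>. cr u w = scal \<nu> u \<and> \<nu> ^ m = \<kappa>'
     else if bil u u ^ half = 1 then disc_form u w ^ m = \<kappa> * bil u u ^ (m ^ 2)
     else \<forall>t. ev (emb u) t = 0 \<longrightarrow> ev (emb w) t ^ m = t ^ p - t)"

text \<open>Real means that the roots of \<open>u\<close> lie in the field of order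
  \<open>p ^ 2\<close> or at infinity, not that \<open>u\<close> is rational.\<close>

definition real_pt :: "'f quad \<Rightarrow> bool" where
  "real_pt u \<longleftrightarrow> bil u u = 0 \<or> bil u u ^ half = 1"

lemma \<kappa>_nz [simp]: "\<kappa> \<noteq> 0" "\<kappa>' \<noteq> 0"
  using \<kappa>_squared \<kappa>'_squared by (metis neg_equal_0_iff_equal power_zero_numeral two_nz)+

lemma inverse_cancel: "x \<noteq> 0 \<Longrightarrow> inverse x * (inverse x * x ^ 2) = 1" "x \<noteq> 0 \<Longrightarrow> inverse x * (x * y) = y" for x :: 'f
  by (simp_all add: power2_eq_square field_simps)

lemma eq_minus_self_iff [simp]: "x = - x \<longleftrightarrow> x = 0" for x :: 'f
proof
  assume "x = - x"
  then have "2 * x = 0" by (metis add.right_inverse mult_2)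
  then show "x = 0" by simp
qed simp

lemma square_power_half: "c \<noteq> 0 \<Longrightarrow> (c * c) ^ half = 1" for c :: 'f
  using power_half_squared[of c] by (simp add: power_mult_distrib power2_eq_square)

lemma bil_cr_self: "bil (cr f g) f = 0" "bil (cr f g) g = 0"
  by (cases f; cases g; simp add: algebra_simps)+

text \<open>Scaling \<open>u\<close> by \<open>c\<close> multiplies \<open>disc_form u w ^ m\<close>
  by the left-hand side and \<open>bil u u ^ (m ^ 2)\<close> by the right-hand side, so the sign
  belongs to the projective point.\<close>

lemma norm_power_m: "(c * c ^ p) ^ m = (c * c) ^ (m ^ 2)" for c :: 'f
proof -
  have "(c * c ^ p) ^ m = (c ^ (p + 1)) ^ m" by simp
  also have "\<dots> = (c ^ (2 * m)) ^ m" by (simp only: two_m)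
  also have "\<dots> = (c * c) ^ (m ^ 2)" by (simp add: power_mult power2_eq_square)
  finally show ?thesis .
qed

lemma disc_form_scal: "disc_form (scal (c::'f) u) w = c * c ^ p * disc_form u w"
  by (simp add: disc_form_def mult.commute)

lemma half_scal: "(c::'f) \<noteq> 0 \<Longrightarrow> bil (scal c u) (scal c u) ^ half = bil u u ^ half"
  using square_power_half[of c] by (simp add: power_mult_distrib mult.assoc[symmetric])

lemma real_pt_scal: "c \<noteq> 0 \<Longrightarrow> real_pt (scal c u) \<longleftrightarrow> real_pt u"
  using half_scal[of c u] by (simp add: real_pt_def)

lemma scal_inj: "c \<noteq> 0 \<Longrightarrow> scal c f = scal c g \<longleftrightarrow> f = g" for c :: 'f
  by (cases f; cases g) auto

lemma pos_scal:
  assumes c: "c \<noteq> 0" shows "pos (scal c u) w \<longleftrightarrow> pos u w"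
proof -
  have "cr (scal c u) w = scal \<nu> (scal c u) \<longleftrightarrow> cr u w = scal \<nu> u" for \<nu>
    using scal_inj[OF c, of "cr u w" "scal \<nu> u"] by (simp add: mult.commute)
  moreover have "disc_form (scal c u) w ^ m = \<kappa> * bil (scal c u) (scal c u) ^ (m ^ 2)
      \<longleftrightarrow> disc_form u w ^ m = \<kappa> * bil u u ^ (m ^ 2)"
  proof -
    have "disc_form (scal c u) w ^ m = (c * c) ^ (m ^ 2) * disc_form u w ^ m"
      by (simp only: disc_form_scal power_mult_distrib[of "c * c ^ p"] norm_power_m)
    moreover have "bil (scal c u) (scal c u) ^ (m ^ 2) = (c * c) ^ (m ^ 2) * bil u u ^ (m ^ 2)"
      by (simp add: power_mult_distrib)
    ultimately show ?thesis using c by (auto simp: mult.left_commute)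
  qed
  ultimately show ?thesis using c half_scal[OF c, of u] unfolding pos_def by simp
qed

lemma pos_add: "pos u (w + scal c u) \<longleftrightarrow> pos u w"
  by (simp add: pos_def disc_form_def bil_cr_self cong: conj_cong)

lemma pos_torsion_imp:
  assumes l: "l ^ m = 1" and "pos u w" shows "pos u (scal l w)"
proof -
  have "\<exists>\<mu>. scal l (scal \<nu> u) = scal \<mu> u \<and> \<mu> ^ m = \<nu> ^ m" for \<nu>
    by (rule exI[of _ "l * \<nu>"]) (simp add: power_mult_distrib l)
  then show ?thesis using assms
    by (auto simp: pos_def disc_form_def power_mult_distrib simp flip: to_ac_power split: if_splits)
qed

lemma pos_torsion:
  assumes l: "l ^ m = 1" shows "pos u (scal l w) \<longleftrightarrow> pos u w"
proof
  have "l \<noteq> 0" using l m_pos by (auto simp: power_0_left)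
  assume "pos u (scal l w)"
  then have "pos u (scal (inverse l) (scal l w))"
    by (rule pos_torsion_imp[rotated]) (simp add: l power_inverse)
  then show "pos u w" using \<open>l \<noteq> 0\<close> by simp
qed (rule pos_torsion_imp[OF l])

text \<open>Picks one vector from each projective point. An isotropic form without a
  \<open>t ^ 2\<close> term is constant, as the norm of its middle coefficient must vanish, so
  \<open>(1, 0, 0)\<close> is the only point at infinity.\<close>

definition nm :: "'f quad \<Rightarrow> 'f quad" where
  "nm u = (if snd (snd u) = 0 then scal (inverse (fst u)) u else scal (inverse (snd (snd u))) u)"

lemma nm_scal_ex: "isotropic u \<Longrightarrow> \<exists>c. c \<noteq> 0 \<and> nm u = scal c u"
proof -
  assume "isotropic u"
  then have "snd (snd u) = 0 \<Longrightarrow> fst u \<noteq> 0" by (cases u) (auto simp: isotropic_def zero_prod_def)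
  then show ?thesis
    by (intro exI[of _ "if snd (snd u) = 0 then inverse (fst u) else inverse (snd (snd u))"]) (auto simp: nm_def)
qed

definition unit_pts :: "'f quad set" where
  "unit_pts = {u. isotropic u \<and> (snd (snd u) = 1 \<or> u = (1, 0, 0))}"

lemma isotropic_infinity: "isotropic (1, 0, 0)"
  by (simp add: isotropic_def zero_prod_def)

lemma nm_unit_pts: "isotropic u \<Longrightarrow> nm u \<in> unit_pts"
proof -
  assume iso: "isotropic u"
  obtain c where c: "c \<noteq> 0" "nm u = scal c u" using nm_scal_ex[OF iso] by blast
  have "isotropic (nm u)" using c iso by (simp add: isotropic_scal)
  then show ?thesis using iso
    by (cases u) (auto simp: unit_pts_def nm_def isotropic_def zero_prod_def)
qed

lemma nm_scal: "c \<noteq> 0 \<Longrightarrow> isotropic u \<Longrightarrow> nm (scal c u) = nm u"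
  by (cases u) (auto simp: nm_def isotropic_def zero_prod_def field_simps)

lemma nm_id: "u \<in> unit_pts \<Longrightarrow> nm u = u"
  by (cases u) (auto simp: unit_pts_def nm_def)

lemma imaginary_monic:
  assumes "isotropic u" "\<not> real_pt u"
  obtains c u0 u1 where "c \<noteq> 0" "u = scal c (u0, u1, 1)"
proof -
  obtain u0 u1 u2 where u: "u = (u0, u1, u2)" by (cases u)
  have "u2 \<noteq> 0" using isotropic_nonconic_lead assms unfolding u real_pt_def by blast
  then show thesis using that[of u2 "u0 / u2" "u1 / u2"] by (simp add: u)
qed

lemma imaginary_pos_iff:
  assumes f: "flag (u0, u1, 1) w" and im: "\<not> real_pt (u0, u1, 1)" and t: "ev (emb (u0, u1, 1)) t = 0"
  shows "pos (u0, u1, 1) w \<longleftrightarrow> ev (emb w) t ^ m = t ^ p - t"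
proof
  have b: "bil (u0, u1, 1) (u0, u1, 1) \<noteq> 0" "bil (u0, u1, 1) (u0, u1, 1) ^ half \<noteq> 1"
    using im by (auto simp only: real_pt_def)
  assume v: "ev (emb w) t ^ m = t ^ p - t"
  define t' where "t' = - 2 * to_ac u1 - t"
  note o = other_root[OF t t'_def]
  have v': "ev (emb w) t' ^ m = t' ^ p - t'"
    using imaginary_roots_agree[OF b t t'_def, of w 1] v by simp
  have "s = t \<or> s = t'" if "ev (emb (u0, u1, 1)) s = 0" for s
    using that ev_emb_monic[OF o(1,2), of s] by simp
  then show "pos (u0, u1, 1) w" using b v v' unfolding pos_def by metis
next
  assume "pos (u0, u1, 1) w"
  then show "ev (emb w) t ^ m = t ^ p - t"
    using im t unfolding pos_def real_pt_def by presburger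
qed

text \<open>In each of the three cases the \<open>m\<close>-th power in question is one of two
  opposite nonzero values, and \<open>m\<close> is odd, so negating \<open>w\<close> moves from one
  value to the other.\<close>

lemma pos_minus:
  assumes f: "flag u w" shows "pos u (- w) \<longleftrightarrow> \<not> pos u w"
proof -
  note D = flagD[OF f]
  consider "bil u u = 0" | "bil u u \<noteq> 0" "bil u u ^ half = 1" | "\<not> real_pt u"
    by (auto simp: real_pt_def)
  then show ?thesis
  proof cases
    case 1
    obtain \<nu> where \<nu>: "cr u w = scal \<nu> u" "\<nu> * \<nu> ^ p = -2" by (rule conic_eigenvalue[OF f 1])
    have "pos u w \<longleftrightarrow> \<nu> ^ m = \<kappa>'" using 1 \<nu>(1) D(1) by (auto simp: pos_def)
    moreover have "- scal \<nu> u = scal \<mu> u \<longleftrightarrow> \<mu> = - \<nu>" for \<mu>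
      using scal_cancel[OF D(1), of "- \<nu>" \<mu>] by auto
    then have "pos u (- w) \<longleftrightarrow> - (\<nu> ^ m) = \<kappa>'" using 1 \<nu>(1) odd_m by (simp add: pos_def)
    ultimately show ?thesis using norm_minus_2_power_m[OF \<nu>(2) \<kappa>'_squared] \<kappa>_nz(2)
      by (metis add.inverse_inverse eq_minus_self_iff)
  next
    case 2
    have nz: "\<kappa> * bil u u ^ (m ^ 2) \<noteq> 0" using 2 by simp
    have "disc_form u (- w) ^ m = - (disc_form u w ^ m)" using odd_m by (simp add: disc_form_def)
    then show ?thesis using 2 disc_form_power_m[OF f 2(2)] nz unfolding pos_def
      by (auto simp del: mult_eq_0_iff)
  next
    case 3
    obtain c u0 u1 where u: "c \<noteq> 0" "u = scal c (u0, u1, 1)" by (rule imaginary_monic[OF D(2) 3])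
    have f': "flag (u0, u1, 1) w" and im: "\<not> real_pt (u0, u1, 1)"
      using f 3 u(1) flag_scal[of c "(u0, u1, 1)" w] real_pt_scal[of c "(u0, u1, 1)"]
      unfolding u(2) by blast+
    have b: "bil (u0, u1, 1) (u0, u1, 1) \<noteq> 0" using im by (auto simp only: real_pt_def)
    obtain t where t: "ev (emb (u0, u1, 1)) t = 0" using roots_exist[of u0 u1] by blast
    have nz: "t ^ p - t \<noteq> 0" using root_facts(2)[OF flagD(2)[OF f'] b t refl] by simp
    then have nz': "t ^ p - t \<noteq> - (t ^ p - t)"
      using two_ac_nz by (metis add_eq_0_iff mult_2 mult_eq_0_iff)
    have "ev (emb (- w)) t ^ m = - (ev (emb w) t ^ m)" using odd_m by simp
    then have "pos (u0, u1, 1) (- w) \<longleftrightarrow> \<not> pos (u0, u1, 1) w"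
      unfolding imaginary_pos_iff[OF flag_minus[OF f'] im t] imaginary_pos_iff[OF f' im t]
      using ev_root_power_m[OF f' b t] nz' by (metis add.inverse_inverse)
    then show ?thesis unfolding u(2) pos_scal[OF u(1)] .
  qed
qed

lemma isotropic_rho:
  assumes r: "rational a" "rational b" "rational c" "rational d" and nz: "a * d - b * c \<noteq> 0"
    and "isotropic u"
  shows "isotropic (rho a b c d u)"
proof -
  have "rho a b c d u \<noteq> 0"
  proof
    assume "rho a b c d u = 0"
    then have "scal ((a * d - b * c) ^ 2) u = 0" using rho_inverse[of d b c a u]
      by (simp add: zero_prod_def)
    then show False using assms by (simp add: isotropic_def)
  qed
  then show ?thesis using assms by (simp add: isotropic_def fr_rho[OF r] bil_rho)
qed

lemma flag_rho:
  assumes r: "rational a" "rational b" "rational c" "rational d" and nz: "a * d - b * c \<noteq> 0"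
    and "flag u w"
  shows "flag (rho a b c d u) (scal (inverse (a * d - b * c)) (rho a b c d w))"
proof -
  let ?D = "a * d - b * c"
  have "inverse ?D ^ p = inverse ?D" using r by (simp add: power_inverse)
  moreover note inverse_cancel(1)[OF nz]
  ultimately show ?thesis
    using assms by (auto simp: flag_def isotropic_rho fr_rho[OF r] bil_rho)
qed

lemma rational_norm_power: "rational c \<Longrightarrow> c ^ (2 * m) = c ^ 2"
  by (simp only: two_m power_p_plus_1 power2_eq_square)

lemma real_pt_rho: "a * d - b * c \<noteq> 0 \<Longrightarrow> real_pt (rho a b c d u) \<longleftrightarrow> real_pt u"
  using square_power_half[of "a * d - b * c"]
  by (simp add: real_pt_def bil_rho power_mult_distrib power2_eq_square)

lemma pos_rho_real_imp:
  assumes r: "rational a" "rational b" "rational c" "rational d" and nz: "a * d - b * c \<noteq> 0"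
    and "real_pt u" "pos u w"
  shows "pos (rho a b c d u) (scal (inverse (a * d - b * c)) (rho a b c d w))"
proof -
  let ?D = "a * d - b * c" and ?R = "rho a b c d"
  have bil: "bil (?R u) (?R u) = ?D ^ 2 * bil u u" by (rule bil_rho)
  show ?thesis
  proof (cases "bil u u = 0")
    case True
    then obtain \<nu> where \<nu>: "cr u w = scal \<nu> u" "\<nu> ^ m = \<kappa>'" using assms by (auto simp: pos_def)
    have "cr (?R u) (scal (inverse ?D) (?R w)) = scal \<nu> (?R u)"
      by (simp add: cr_rho \<nu>(1) inverse_cancel(2)[OF nz])
    then show ?thesis using True \<nu>(2) bil by (auto simp: pos_def)
  next
    case False
    then have sq: "bil u u ^ half = 1" and eq: "disc_form u w ^ m = \<kappa> * bil u u ^ (m ^ 2)"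
      using assms by (auto simp: real_pt_def pos_def)
    have rD: "rational ?D" using r by simp
    have "disc_form (?R u) (scal (inverse ?D) (?R w)) = inverse ?D * (?D * (?D ^ 2 * disc_form u w))"
      by (simp add: disc_form_def fr_rho[OF r] cr_rho bil_rho)
    also have "\<dots> = ?D ^ 2 * disc_form u w" by (rule inverse_cancel(2)[OF nz])
    finally have "disc_form (?R u) (scal (inverse ?D) (?R w)) ^ m = ?D ^ (2 * m) * disc_form u w ^ m"
      by (simp only: power_mult_distrib power_mult)
    also have "\<dots> = ?D ^ 2 * (\<kappa> * bil u u ^ (m ^ 2))"
      using rational_norm_power[OF rD] by (simp only: eq)
    \<comment> \<open>For rational \<open>D\<close> the power \<open>2 * m\<close> is the norm
      \<open>D ^ 2\<close>; used twice, this produces the exponent by which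
      \<open>bil u u ^ (m ^ 2)\<close> changes.\<close>
    also have "?D ^ 2 = ?D ^ (2 * (m ^ 2))"
      using rational_norm_power[OF rD] by (simp only: power2_eq_square[of m] mult.assoc[symmetric] power_mult[of _ "2 * m"]) (simp flip: power_mult)
    finally have "disc_form (?R u) (scal (inverse ?D) (?R w)) ^ m = \<kappa> * bil (?R u) (?R u) ^ (m ^ 2)"
      unfolding bil power_mult_distrib power_mult by (simp only: mult_ac)
    then show ?thesis using bil False nz sq square_power_half[OF nz]
      by (simp add: pos_def power_mult_distrib power2_eq_square)
  qed
qed

lemma pos_rho_real:
  assumes r: "rational a" "rational b" "rational c" "rational d" and nz: "a * d - b * c \<noteq> 0"
    and re: "real_pt u"
  shows "pos (rho a b c d u) (scal (inverse (a * d - b * c)) (rho a b c d w)) \<longleftrightarrow> pos u w"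
proof
  let ?D = "a * d - b * c"
  assume "pos (rho a b c d u) (scal (inverse ?D) (rho a b c d w))"
  then have "pos (rho d (- b) (- c) a (rho a b c d u))
      (scal (inverse (d * a - (- b) * (- c))) (rho d (- b) (- c) a (scal (inverse ?D) (rho a b c d w))))"
    by (rule pos_rho_real_imp[rotated -1]) (use r nz re in \<open>simp_all add: real_pt_rho mult.commute\<close>)
  moreover have "inverse (d * a - (- b) * (- c)) * (inverse ?D * ?D ^ 2) = 1"
    using inverse_cancel(1)[OF nz] by (simp add: mult.commute[of d])
  ultimately have "pos (scal (?D ^ 2) u) w" by (simp add: rho_inverse mult.assoc)
  then show "pos u w" using nz by (simp add: pos_scal)
qed (rule pos_rho_real_imp[OF assms])

text \<open>For an imaginary point, the Moebius image \<open>s\<close> of \<open>t\<close> satisfies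
  \<open>K * K ^ p * (s ^ p - s) = t ^ p - t\<close> because the determinant is one, and the factor
  \<open>K ^ 2\<close> gained by \<open>w\<close> has the same \<open>m\<close>-th power
  \<open>K * K ^ p\<close>. So the curve is mapped to itself.\<close>

lemma pos_rho_imp:
  assumes r: "rational a" "rational b" "rational c" "rational d" and det: "a * d - b * c = 1"
    and f: "flag u w" and "pos u w"
  shows "pos (rho a b c d u) (rho a b c d w)"
proof (cases "real_pt u")
  case True
  then show ?thesis using pos_rho_real_imp[OF r _ True \<open>pos u w\<close>] det by simp
next
  case im: False
  have im': "\<not> real_pt (rho a b c d u)" using im det by (simp add: real_pt_rho)
  have rho_emb: "emb (rho a b c d f) = rho (to_ac a) (to_ac b) (to_ac c) (to_ac d) (emb f)" for f
    by (cases f) simp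
  have "ev (emb (rho a b c d w)) t ^ m = t ^ p - t" if t: "ev (emb (rho a b c d u)) t = 0" for t
  proof -
    have iso': "isotropic (rho a b c d u)" using isotropic_rho[OF r] det flagD(2)[OF f] by simp
    obtain k v0 v1 where v: "k \<noteq> 0" "rho a b c d u = scal k (v0, v1, 1)"
      by (rule imaginary_monic[OF iso' im'])
    have tp: "t ^ p \<noteq> t"
    proof (rule root_facts(2)[OF _ _ _ refl])
      show "isotropic (v0, v1, 1)" using iso' v(1) unfolding v(2) by (simp only: isotropic_scal simp_thms)
      show "bil (v0, v1, 1) (v0, v1, 1) \<noteq> 0"
        using im' v(1) real_pt_scal[of k "(v0, v1, 1)"] unfolding v(2) real_pt_def[of "(v0, v1, 1)"] by blast
      show "ev (emb (v0, v1, 1)) t = 0" using t v(1) unfolding v(2) by (simp only: emb_simps ev_linear mult_eq_0_iff to_ac_eq_0_iff simp_thms)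
    qed
    define K where "K = to_ac a + to_ac c * t"
    have rac: "to_ac a ^ p = to_ac a" "to_ac b ^ p = to_ac b" "to_ac c ^ p = to_ac c" "to_ac d ^ p = to_ac d"
      using r by (simp_all flip: to_ac_power)
    \<comment> \<open>A zero of the denominator would be rational, whereas the roots of an imaginary
      point are not.\<close>
    have K: "K \<noteq> 0"
    proof
      assume K0: "K = 0"
      show False
      proof (cases "c = 0")
        case True
        then show False using K0 det by (simp add: K_def)
      next
        case False
        then have "t = - to_ac a / to_ac c" using K0 by (simp add: K_def field_simps add_eq_0_iff)
        then have "t ^ p = t" by (simp add: power_divide rac)
        then show False using tp by simp
      qed
    qed
    define s where "s = (to_ac b + to_ac d * t) / K"
    have "K ^ 2 * ev (emb u) s = 0"
      using t K unfolding rho_emb K_def s_def by (simp add: ev_rho)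
    then have "ev (emb u) s = 0" using K by simp
    then have v: "ev (emb w) s ^ m = s ^ p - s" using \<open>pos u w\<close> im by (simp add: pos_def real_pt_def)
    have "ev (emb (rho a b c d w)) t ^ m = (K ^ 2 * ev (emb w) s) ^ m"
      using K unfolding rho_emb K_def s_def by (simp add: ev_rho)
    also have "\<dots> = K * K ^ p * (s ^ p - s)"
      by (simp only: v power_mult_distrib power_mult[symmetric] two_m power_p_plus_1)
    also have "\<dots> = t ^ p - t"
    proof -
      have sK: "s * K = to_ac b + to_ac d * t" using K by (simp add: s_def)
      then have "(s * K) ^ p = (to_ac b + to_ac d * t) ^ p" by simp
      then have sKp: "s ^ p * K ^ p = to_ac b + to_ac d * t ^ p" by (simp add: rac)
      have Kp: "K ^ p = to_ac a + to_ac c * t ^ p" by (simp add: K_def rac)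
      have "K * K ^ p * (s ^ p - s) = K * (s ^ p * K ^ p) - K ^ p * (s * K)" by (simp add: algebra_simps)
      also have "\<dots> = (to_ac a * to_ac d - to_ac b * to_ac c) * (t ^ p - t)"
        unfolding sK sKp unfolding Kp by (simp add: K_def algebra_simps)
      also have "to_ac a * to_ac d - to_ac b * to_ac c = to_ac (a * d - b * c)" by simp
      finally show ?thesis by (simp add: det)
    qed
    finally show ?thesis .
  qed
  then show ?thesis using im' unfolding pos_def real_pt_def by auto
qed

end

context hermitian_quads
begin

section \<open>Points of the Hermitian curve on a line\<close>

definition line_pts :: "'f quad \<Rightarrow> 'f quad set" where
  "line_pts v = {u \<in> unit_pts. bil u (fr v) = 0}"

lemma line_pts_flag: "bil v (fr v) = 1 \<Longrightarrow> u \<in> line_pts v \<Longrightarrow> flag u v"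
  by (simp add: line_pts_def unit_pts_def flag_def)

lemma line_pts_monic_iff:
  "(u0, u1, 1) \<in> line_pts (v0, v1, v2) \<longleftrightarrow>
    u0 + u0 ^ p = 2 * (u1 * u1 ^ p) \<and> u0 * v2 ^ p + v0 ^ p = 2 * (u1 * v1 ^ p)"
  by (auto simp: line_pts_def unit_pts_def isotropic_def zero_prod_def mult.assoc)

lemma line_pts_infinity_iff: "(1, 0, 0) \<in> line_pts (v0, v1, v2) \<longleftrightarrow> v2 = 0"
  using isotropic_infinity p_gt by (auto simp: line_pts_def unit_pts_def)

lemma line_pts_cases:
  assumes "u \<in> line_pts v"
  obtains "u = (1, 0, 0)" | u0 u1 where "u = (u0, u1, 1)"
  using assms by (cases u) (auto simp: line_pts_def unit_pts_def)

text \<open>The line contains \<open>(1, 0, 0)\<close> exactly if \<open>v2 = 0\<close>; then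
  \<open>u1\<close> is constant on the affine points and \<open>u0\<close> solves a trace equation.
  Otherwise \<open>u0\<close> is determined by \<open>u1\<close>, and completing the norm leaves a
  norm equation for \<open>u1 - c ^ p\<close>, whose right-hand side \<open>k\<close> is nonzero
  because \<open>v\<close> is a unit vector.\<close>

lemma card_line_pts:
  assumes h: "bil v (fr v) = 1"
  shows "card (line_pts v) = p + 1" and "card {u \<in> line_pts v. snd (snd u) = 1} = (if snd (snd v) = 0 then p else p + 1)"
proof -
  obtain v0 v1 v2 where v: "v = (v0, v1, v2)" by (cases v)
  let ?F = "{u \<in> line_pts v. snd (snd u) = 1}"
  show F: "card ?F = (if snd (snd v) = 0 then p else p + 1)"
  proof (cases "v2 = 0")
    case True
    have "v1 \<noteq> 0" using h by (auto simp: v True)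
    define b where "b = v0 ^ p / (2 * v1 ^ p)"
    have "(u0, u1, 1) \<in> line_pts v \<longleftrightarrow> u1 = b \<and> u0 + u0 ^ p = 2 * (b * b ^ p)" for u0 u1
    proof -
      have "v0 ^ p = 2 * (u1 * v1 ^ p) \<longleftrightarrow> u1 = b"
        using \<open>v1 \<noteq> 0\<close> by (auto simp: b_def field_simps)
      then show ?thesis unfolding v line_pts_monic_iff True by auto
    qed
    then have "bij_betw (\<lambda>x. (x, b, 1)) {x. x + x ^ p = 2 * (b * b ^ p)} ?F"
      by (intro bij_betw_byWitness[where f' = fst]) auto
    then show ?thesis
      using bij_betw_same_card trace_fiber[of "2 * (b * b ^ p)"] by (fastforce simp: v True mult.commute)
  next
    case False
    define c e k where "c = v1 ^ p / v2 ^ p" and "e = v0 ^ p / v2 ^ p" and "k = - 1 / (2 * (v2 * v2 ^ p))"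
    have hk: "c * c ^ p - (e + e ^ p) / 2 = k"
    proof -
      have "v0 * v2 ^ p + v2 * v0 ^ p - 2 * v1 * v1 ^ p = 1" using h by (simp add: v)
      then have k: "k = - (v0 * v2 ^ p + v2 * v0 ^ p - 2 * v1 * v1 ^ p) / (2 * (v2 * v2 ^ p))"
        by (simp only: k_def)
      show ?thesis unfolding k c_def e_def using False by (simp add: field_simps)
    qed
    have iff: "(u0, u1, 1) \<in> line_pts v \<longleftrightarrow>
        u0 = 2 * (c * u1) - e \<and> (u1 - c ^ p) * (u1 - c ^ p) ^ p = k" for u0 u1
    proof -
      have "u0 * v2 ^ p + v0 ^ p = 2 * (u1 * v1 ^ p) \<longleftrightarrow> u0 = 2 * (c * u1) - e"
        using False by (auto simp: c_def e_def field_simps)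
      moreover have "u0 + u0 ^ p = 2 * (u1 * u1 ^ p) \<longleftrightarrow> (u1 - c ^ p) * (u1 - c ^ p) ^ p = k"
        if "u0 = 2 * (c * u1) - e"
      proof -
        have "2 * ((u1 - c ^ p) * (u1 - c ^ p) ^ p - k) = 2 * (u1 * u1 ^ p) - (u0 + u0 ^ p)"
          unfolding that hk[symmetric] by (simp add: algebra_simps)
        then show ?thesis by (metis eq_iff_diff_eq_0 mult_eq_0_iff two_nz)
      qed
      ultimately show ?thesis unfolding v line_pts_monic_iff by blast
    qed
    have "bij_betw (\<lambda>x. (2 * (c * (x + c ^ p)) - e, x + c ^ p, 1)) {x. x * x ^ p = k} ?F"
      by (rule bij_betw_byWitness[where f' = "\<lambda>u. fst (snd u) - c ^ p"]) (auto simp: iff)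
    moreover have "k \<noteq> 0" "k ^ p = k" using False by (simp_all add: k_def mult.commute)
    ultimately show ?thesis
      using bij_betw_same_card norm_fiber[of k] by (fastforce simp: v False)
  qed
  have fin: "finite (line_pts v)" by simp
  show "card (line_pts v) = p + 1"
  proof (cases "v2 = 0")
    case True
    then have "line_pts v = insert (1, 0, 0) ?F"
      using line_pts_infinity_iff[of v0 v1 v2] by (auto simp: v elim: line_pts_cases)
    moreover have "(1, 0, 0) \<notin> ?F" by simp
    ultimately have "card (line_pts v) = Suc (card ?F)"
      using card_insert_disjoint[of ?F "(1, 0, 0)"] by (metis finite)
    then show ?thesis using F True by (simp add: v)
  next
    case False
    then have "(1, 0, 0) \<notin> line_pts v" using line_pts_infinity_iff[of v0 v1 v2] by (simp add: v)
    then have "line_pts v = ?F" by (auto simp: line_pts_def unit_pts_def)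
    then show ?thesis using F False by (simp add: v)
  qed
qed

text \<open>The right-hand side is the degree of \<open>v(t) ^ m - e (t ^ p - t)\<close> as a polynomial in \<open>t\<close>.\<close>

lemma curve_section_bound:
  fixes e :: "'f alg_closure"
  assumes h: "bil v (fr v) = 1" and e: "e \<noteq> 0"
  shows "finite {t. ev (emb v) t ^ m = e * (t ^ p - t)}"
    "card {t. ev (emb v) t ^ m = e * (t ^ p - t)} \<le> card {u \<in> line_pts v. snd (snd u) = 1}"
proof -
  obtain v0 v1 v2 where v: "v = (v0, v1, v2)" by (cases v)
  define V where "V = [:to_ac v0, 2 * to_ac v1, to_ac v2:]"
  define f where "f = V ^ m - Polynomial.smult e (Polynomial.monom 1 p - Polynomial.monom 1 1)"
  have poly: "poly f t = ev (emb v) t ^ m - e * (t ^ p - t)" for t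
    by (simp add: f_def V_def poly_monom v algebra_simps power2_eq_square)
  have nz_deg: "f \<noteq> 0 \<and> Polynomial.degree f \<le> (if v2 = 0 then p else p + 1)"
  proof (cases "v2 = 0")
    case True
    have "Polynomial.degree V \<le> 1" by (simp add: V_def True)
    then have "Polynomial.degree (V ^ m) \<le> 1 * m" by (rule order_trans[OF degree_power_le mult_le_mono1])
    then have d: "Polynomial.degree (V ^ m) \<le> m" by simp
    have "m < p" using two_m p_gt by simp
    then have "Polynomial.coeff f p = - e" using d p_gt by (simp add: f_def coeff_eq_0)
    then have "f \<noteq> 0" using e by auto
    moreover have "Polynomial.degree f \<le> p" unfolding f_def
      using d \<open>m < p\<close> p_gt
      by (intro degree_diff_le order_trans[OF degree_smult_le]) (auto simp: degree_monom_eq)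
    ultimately show ?thesis by (simp add: True)
  next
    case False
    have dV: "Polynomial.degree V = 2" by (simp add: V_def False)
    then have d: "Polynomial.degree (V ^ m) = p + 1" using two_m by (simp add: degree_power_eq V_def False)
    have "Polynomial.coeff f (p + 1) = Polynomial.lead_coeff (V ^ m)"
      using d p_gt by (simp add: f_def)
    also have "\<dots> \<noteq> 0" by (simp add: V_def False)
    finally have "f \<noteq> 0" by auto
    moreover have "Polynomial.degree f \<le> p + 1" unfolding f_def
      using d p_gt
      by (intro degree_diff_le order_trans[OF degree_smult_le]) (auto simp: degree_monom_eq)
    ultimately show ?thesis by (simp add: False)
  qed
  have "{t. ev (emb v) t ^ m = e * (t ^ p - t)} = {t. poly f t = 0}" by (simp add: poly)
  then show "finite {t. ev (emb v) t ^ m = e * (t ^ p - t)}"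
    "card {t. ev (emb v) t ^ m = e * (t ^ p - t)} \<le> card {u \<in> line_pts v. snd (snd u) = 1}"
    using card_poly_roots_bound[of f] poly_roots_finite[of f] nz_deg card_line_pts(2)[OF h]
    by (auto simp: v)
qed

text \<open>The difference of the two forms is linear, so a common root \<open>y\<close> lies in the
  field; then \<open>fr v\<close> is a multiple of \<open>(y ^ 2, - y, 1)\<close>, and all forms of
  the line vanish at \<open>y\<close>. Hence on a line with an imaginary point distinct monic forms
  share no root.\<close>

lemma common_root_rational:
  assumes h: "bil v (fr v) = 1"
    and u: "(u0, u1, 1) \<in> line_pts v" "(w0, w1, 1) \<in> line_pts v" "(u0, u1, 1) \<noteq> (w0, w1, 1)"
    and t: "ev (emb (u0, u1, 1)) t = 0" "ev (emb (w0, w1, 1)) t = 0"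
    and x: "(x0, x1, 1) \<in> line_pts v"
  obtains y where "ev (emb (x0, x1, 1)) (to_ac y) = 0"
proof -
  obtain v0 v1 v2 where v: "v = (v0, v1, v2)" by (cases v)
  have bu: "u0 * v2 ^ p + v0 ^ p = 2 * (u1 * v1 ^ p)" and bw: "w0 * v2 ^ p + v0 ^ p = 2 * (w1 * v1 ^ p)"
    and bx: "x0 * v2 ^ p + v0 ^ p = 2 * (x1 * v1 ^ p)"
    using u x unfolding v line_pts_monic_iff by blast+
  have d: "to_ac (u0 - w0) + 2 * to_ac (u1 - w1) * t = 0"
  proof -
    have "to_ac (u0 - w0) + 2 * to_ac (u1 - w1) * t
        = ev (emb (u0, u1, 1)) t - ev (emb (w0, w1, 1)) t" by (simp add: algebra_simps)
    then show ?thesis unfolding t by simp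
  qed
  have ne: "u1 \<noteq> w1" using d u(3) by auto
  have "\<exists>y. b = - 2 * y * r" if "r \<noteq> 0" for b r :: 'f
    by (rule exI[of _ "- b / (2 * r)"]) (use that in simp)
  then obtain y where y: "u0 - w0 = - 2 * y * (u1 - w1)" using ne by (metis right_minus_eq)
  have "2 * to_ac (u1 - w1) * (t - to_ac y) = 0"
    using d unfolding y by (simp add: algebra_simps)
  then have ty: "t = to_ac y" using ne by simp
  have "to_ac (y ^ 2 + 2 * u1 * y + u0) = 0" using t(1) by (simp add: ty algebra_simps)
  then have uy: "y ^ 2 + 2 * u1 * y + u0 = 0" by (simp only: to_ac_eq_0_iff)
  have "2 * (u1 - w1) * (v1 ^ p + y * v2 ^ p) = 0"
  proof -
    have "(u0 - w0) * v2 ^ p = 2 * (u1 - w1) * v1 ^ p" 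
    proof -
      have "(u0 - w0) * v2 ^ p = (u0 * v2 ^ p + v0 ^ p) - (w0 * v2 ^ p + v0 ^ p)" by (simp add: algebra_simps)
      then show ?thesis unfolding bu bw by (simp add: algebra_simps)
    qed
    then show ?thesis unfolding y by (simp add: algebra_simps)
  qed
  then have v1: "v1 ^ p = - y * v2 ^ p" using ne by (simp add: eq_neg_iff_add_eq_0)
  have v0: "v0 ^ p = y ^ 2 * v2 ^ p"
  proof -
    have "v0 ^ p = 2 * (u1 * v1 ^ p) - u0 * v2 ^ p" using bu by (simp add: eq_diff_eq add.commute)
    also have "\<dots> = - (2 * u1 * y + u0) * v2 ^ p" unfolding v1 by (simp add: algebra_simps)
    also have "- (2 * u1 * y + u0) = y ^ 2" using uy by (metis add.assoc add_eq_0_iff minus_minus)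
    finally show ?thesis .
  qed
  have v2: "v2 \<noteq> 0" using v1 v0 h by (auto simp: v)
  have "v2 ^ p * (y ^ 2 + 2 * x1 * y + x0) = (x0 * v2 ^ p + v0 ^ p) - 2 * (x1 * v1 ^ p)"
    unfolding v1 v0 by (simp add: algebra_simps)
  then have "v2 ^ p * (y ^ 2 + 2 * x1 * y + x0) = 0" unfolding bx by simp
  then have "to_ac (y ^ 2 + 2 * x1 * y + x0) = 0" using v2 by simp
  then have "ev (emb (x0, x1, 1)) (to_ac y) = 0" by (simp add: algebra_simps)
  then show thesis by (rule that)
qed

definition on_curve :: "'f alg_closure \<Rightarrow> 'f quad \<Rightarrow> 'f quad \<Rightarrow> bool" where
  "on_curve e v u \<longleftrightarrow> (\<forall>t. ev (emb u) t = 0 \<longrightarrow> ev (emb v) t ^ m = e * (t ^ p - t))"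

text \<open>Bezout's argument: a plane meets each of the two curves in at most \<open>p + 1\<close> points,
  and together the points \<open>u\<close> of the line account for all \<open>2 (p + 1)\<close> intersections.\<close>

lemma imaginary_balance_le:
  fixes e :: "'f alg_closure"
  assumes h: "bil v (fr v) = 1" and e: "e = 1 \<or> e = -1"
    and ex: "u' \<in> line_pts v" "\<not> real_pt u'"
  shows "card {u \<in> line_pts v. \<not> real_pt u \<and> on_curve e v u}
    \<le> card {u \<in> line_pts v. \<not> real_pt u \<and> \<not> on_curve e v u}"
    (is "card ?P \<le> card ?N")
proof -
  let ?Z = "{t. ev (emb v) t ^ m = e * (t ^ p - t)}"
  let ?F = "{u \<in> line_pts v. snd (snd u) = 1}"
  define g where "g u = {t \<in> ?Z. ev (emb u) t = 0}" for u
  have e0: "e \<noteq> 0" using e by auto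
  note Z = curve_section_bound[OF h e0]
  have finF: "finite ?F" by simp
  have im_monic: "u \<in> ?F" if "u \<in> line_pts v" "\<not> real_pt u" for u
    using that by (auto elim!: line_pts_cases simp: real_pt_def)
  \<comment> \<open>Elements of the field are fixed by the \<open>p ^ 2\<close>-th power, which
    exchanges the two distinct roots of an imaginary form.\<close>
  have im_root: "ev (emb u) (to_ac y) \<noteq> 0" if im: "u \<in> line_pts v" "\<not> real_pt u" for u y
  proof
    assume r: "ev (emb u) (to_ac y) = 0"
    obtain u0 u1 where u: "u = (u0, u1, 1)" using im_monic[OF im] by (cases u) auto
    have b: "bil (u0, u1, 1) (u0, u1, 1) \<noteq> 0" "bil (u0, u1, 1) (u0, u1, 1) ^ half \<noteq> 1"
      using im(2) unfolding u real_pt_def by blast+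
    have "(to_ac y ^ p) ^ p = to_ac y" by (simp flip: to_ac_power)
    then have "to_ac y = - 2 * to_ac u1 - to_ac y" using root_frob_frob[OF b(1)] r b(2) unfolding u by metis
    moreover have "isotropic (u0, u1, 1)" using im(1) u by (simp add: line_pts_def unit_pts_def)
    ultimately show False using root_facts(1)[OF _ b(1) _ refl] r unfolding u by metis
  qed
  have disj: "g u \<inter> g w = {}" if uw: "u \<in> ?F" "w \<in> ?F" "u \<noteq> w" for u w
  proof (rule ccontr)
    assume "g u \<inter> g w \<noteq> {}"
    then obtain t where t: "ev (emb u) t = 0" "ev (emb w) t = 0" by (auto simp: g_def)
    obtain u0 u1 where u: "u = (u0, u1, 1)" using uw(1) by (cases u) auto
    obtain w0 w1 where w: "w = (w0, w1, 1)" using uw(2) by (cases w) auto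
    obtain x0 x1 where x: "u' = (x0, x1, 1)" using im_monic[OF ex] by (cases u') auto
    obtain y where "ev (emb (x0, x1, 1)) (to_ac y) = 0"
      by (rule common_root_rational[of v u0 u1 w0 w1 t x0 x1]) (use h uw t ex u w x in simp_all)
    then show False using im_root[OF ex] x by blast
  qed
  have "(\<Sum>u\<in>?F. card (g u)) = card (\<Union>u\<in>?F. g u)"
    by (rule card_UN_disjoint[symmetric]) (use Z disj in \<open>auto simp: g_def\<close>)
  also have "\<dots> \<le> card ?Z" by (rule card_mono) (use Z in \<open>auto simp: g_def\<close>)
  also have "\<dots> \<le> card ?F" by (rule Z)
  finally have upper: "(\<Sum>u\<in>?F. card (g u)) \<le> card ?F" .
  \<comment> \<open>A real point meets the curve at least once: on the conic in its double root,
    where \<open>v\<close> vanishes as well, and otherwise because its two roots lie on opposite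
    curves. A point of \<open>?P\<close> contributes both its roots, a point of \<open>?N\<close> is
    counted as zero. In the sum, the surplus of \<open>?P\<close> over \<open>?N\<close> has to fit
    under the bound \<open>card ?F\<close>.\<close>
  have lower: "int (card (g u)) \<ge> 1 + (if u \<in> ?P then 1 else 0) - (if u \<in> ?N then 1 else 0)" if uF: "u \<in> ?F" for u
  proof -
    have fl: "flag u v" using line_pts_flag[OF h] uF by blast
    obtain u0 u1 where u: "u = (u0, u1, 1)" using uF by (cases u) auto
    have fing: "finite (g u)" using Z(1) by (auto simp: g_def)
    consider "bil u u = 0" | "bil u u \<noteq> 0" "bil u u ^ half = 1" | "u \<in> ?P" "u \<notin> ?N" | "u \<in> ?N" "u \<notin> ?P"
      using uF unfolding real_pt_def by blast
    then show ?thesis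
    proof cases
      case 1
      then have np: "u \<notin> ?P" "u \<notin> ?N" by (auto simp: real_pt_def)
      obtain c t where ct: "c \<noteq> 0" "rational t" "u = scal c (t ^ 2, - t, 1)"
        using isotropic_conic_cases[OF flagD(2)[OF fl] 1] by (metis scal.simps snd_conv mult_zero_right u zero_neq_one)
      then have "c = 1" using u by simp
      then have ut: "u = (t ^ 2, - t, 1)" using ct by simp
      have "ev v t = 0" using flagD(5)[OF fl] ct(2) by (cases v) (simp add: ut algebra_simps)
      then have "ev (emb v) (to_ac t) = 0" by (cases v) (simp flip: to_ac_power to_ac_mult to_ac_add to_ac_numeral)
      moreover have "to_ac t ^ p = to_ac t" using ct(2) by (simp flip: to_ac_power)
      moreover have "ev (emb u) (to_ac t) = 0" by (simp add: ut power2_eq_square)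
      ultimately have "to_ac t \<in> g u" using m_pos by (simp add: g_def power_0_left)
      then have "card (g u) > 0" using fing card_gt_0_iff by blast
      then show ?thesis unfolding if_not_P[OF np(1)] if_not_P[OF np(2)] by simp
    next
      case 2
      then have np: "u \<notin> ?P" "u \<notin> ?N" by (auto simp: real_pt_def)
      obtain t where t: "ev (emb (u0, u1, 1)) t = 0" using roots_exist[of u0 u1] by blast
      define t' where "t' = - 2 * to_ac u1 - t"
      have "\<exists>s. s \<in> g u"
      proof (cases "ev (emb v) t ^ m = e * (t ^ p - t)")
        case True
        then show ?thesis using t u by (auto simp: g_def)
      next
        case False
        then have "ev (emb v) t ^ m = - e * (t ^ p - t)"
          using ev_root_power_m[of u0 u1 v t] fl 2 t e unfolding u by (auto simp del: ev.simps emb.simps bil.simps)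
        then have "ev (emb v) t' ^ m = - (- e) * (t' ^ p - t')"
          using real_roots_opposite[OF _ _ _ t t'_def, of v "- e"] fl 2 unfolding u by blast
        then have "t' \<in> g u" using other_root(3)[OF t t'_def] u by (simp add: g_def)
        then show ?thesis by blast
      qed
      then have "card (g u) > 0" using fing card_gt_0_iff by blast
      then show ?thesis unfolding if_not_P[OF np(1)] if_not_P[OF np(2)] by simp
    next
      case 3
      obtain t where t: "ev (emb (u0, u1, 1)) t = 0" using roots_exist[of u0 u1] by blast
      define t' where "t' = - 2 * to_ac u1 - t"
      have b: "bil (u0, u1, 1) (u0, u1, 1) \<noteq> 0" using 3(1) unfolding u real_pt_def by blast
      have "t \<noteq> t'" using root_facts(1)[OF _ b t t'_def] flagD(2)[OF fl] unfolding u by blast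
      moreover have "{t, t'} \<subseteq> g u" using 3(1) t other_root(3)[OF t t'_def] u by (simp add: g_def on_curve_def)
      ultimately have "card (g u) \<ge> 2" using card_mono[OF fing, of "{t, t'}"] by simp
      then show ?thesis unfolding if_P[OF 3(1)] if_not_P[OF 3(2)] by simp
    next
      case 4
      then show ?thesis unfolding if_P[OF 4(1)] if_not_P[OF 4(2)] by simp
    qed
  qed
  have "(\<Sum>u\<in>?F. 1 + (if u \<in> ?P then 1 else 0) - (if u \<in> ?N then 1 else 0)) \<le> (\<Sum>u\<in>?F. int (card (g u)))"
    by (rule sum_mono) (use lower in blast)
  moreover have "?F \<inter> ?P = ?P" "?F \<inter> ?N = ?N" using im_monic by auto
  then have "(\<Sum>u\<in>?F. 1 + (if u \<in> ?P then 1 else 0) - (if u \<in> ?N then 1 else 0))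
      = int (card ?F) + int (card ?P) - int (card ?N)"
    by (simp only: sum_subtractf sum.distrib) (simp only: sum.If_cases[OF finF] Collect_mem_eq, simp)
  moreover have "(\<Sum>u\<in>?F. int (card (g u))) \<le> int (card ?F)"
    using upper by (simp flip: of_nat_sum)
  ultimately show ?thesis by linarith
qed

text \<open>Replacing \<open>v\<close> by \<open>- v\<close> exchanges the two curves, so by
  \<open>pos_minus\<close> an imaginary point off one curve is on the other. The inequality for
  \<open>e = -1\<close> is therefore the reverse of the one for \<open>e = 1\<close>.\<close>

lemma imaginary_balance:
  assumes h: "bil v (fr v) = 1"
  shows "card {u \<in> line_pts v. \<not> real_pt u \<and> pos u v} = card {u \<in> line_pts v. \<not> real_pt u \<and> \<not> pos u v}"
proof (cases "\<exists>u'\<in>line_pts v. \<not> real_pt u'")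
  case False
  then show ?thesis by (metis (no_types, lifting))
next
  case True
  then obtain u' where u': "u' \<in> line_pts v" "\<not> real_pt u'" by blast
  have pos_iff: "on_curve 1 v u \<longleftrightarrow> pos u v"
    if "\<not> real_pt u" for u using that by (simp add: on_curve_def pos_def real_pt_def)
  have neg_iff: "on_curve (-1) v u \<longleftrightarrow> \<not> pos u v"
    if "\<not> real_pt u" "u \<in> line_pts v" for u
  proof -
    have "ev (emb v) t ^ m = -1 * (t ^ p - t) \<longleftrightarrow> ev (emb (- v)) t ^ m = t ^ p - t" for t
    proof -
      have "ev (emb (- v)) t ^ m = - (ev (emb v) t ^ m)" using odd_m by simp
      then show ?thesis by (metis minus_minus mult_minus1)
    qed
    then have "on_curve (-1) v u \<longleftrightarrow> pos u (- v)"
      using that(1) by (simp add: on_curve_def pos_def real_pt_def)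
    then show ?thesis using pos_minus[OF line_pts_flag[OF h that(2)]] by simp
  qed
  have "{u \<in> line_pts v. \<not> real_pt u \<and> on_curve 1 v u}
      = {u \<in> line_pts v. \<not> real_pt u \<and> pos u v}"
    "{u \<in> line_pts v. \<not> real_pt u \<and> \<not> on_curve 1 v u}
      = {u \<in> line_pts v. \<not> real_pt u \<and> \<not> pos u v}"
    "{u \<in> line_pts v. \<not> real_pt u \<and> on_curve (-1) v u}
      = {u \<in> line_pts v. \<not> real_pt u \<and> \<not> pos u v}"
    "{u \<in> line_pts v. \<not> real_pt u \<and> \<not> on_curve (-1) v u}
      = {u \<in> line_pts v. \<not> real_pt u \<and> pos u v}"
    using pos_iff neg_iff by blast+
  then show ?thesis
    using imaginary_balance_le[OF h _ u', of 1] imaginary_balance_le[OF h _ u', of "-1"] by simp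
qed

end

context hermitian_quads
begin

section \<open>Cancellation of the signs at the real points\<close>

definition np :: "'f quad \<Rightarrow> nat" where
  "np v = card {u \<in> line_pts v. real_pt u \<and> pos u v}"

definition nn :: "'f quad \<Rightarrow> nat" where
  "nn v = card {u \<in> line_pts v. real_pt u \<and> \<not> pos u v}"

lemma nm_rho:
  assumes r: "rational a" "rational b" "rational c" "rational d" and nz: "a * d - b * c \<noteq> 0"
    and v': "v' = scal (inverse (a * d - b * c)) (rho a b c d v)" and u: "u \<in> line_pts v"
  shows "nm (rho a b c d u) \<in> line_pts v'" "real_pt (nm (rho a b c d u)) \<longleftrightarrow> real_pt u"
    "real_pt u \<Longrightarrow> pos (nm (rho a b c d u)) v' \<longleftrightarrow> pos u v"
proof -
  have iso: "isotropic (rho a b c d u)"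
    using u by (intro isotropic_rho[OF r nz]) (simp add: line_pts_def unit_pts_def)
  obtain k where k: "k \<noteq> 0" "nm (rho a b c d u) = scal k (rho a b c d u)"
    using nm_scal_ex[OF iso] by blast
  have "bil (rho a b c d u) (fr v') = 0"
    using u by (simp add: v' fr_rho[OF r] bil_rho line_pts_def)
  then show "nm (rho a b c d u) \<in> line_pts v'"
    using nm_unit_pts[OF iso] k by (simp add: line_pts_def)
  show "real_pt (nm (rho a b c d u)) \<longleftrightarrow> real_pt u"
    using k nz by (simp add: real_pt_scal real_pt_rho)
  show "pos (nm (rho a b c d u)) v' \<longleftrightarrow> pos u v" if "real_pt u"
    using pos_rho_real[OF r nz that] k by (simp add: pos_scal v')
qed

lemma nm_rho_inverse:
  assumes r: "rational a" "rational b" "rational c" "rational d" and nz: "a * d - b * c \<noteq> 0"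
    and u: "u \<in> unit_pts"
  shows "nm (rho d (- b) (- c) a (nm (rho a b c d u))) = u"
proof -
  have iso: "isotropic u" using u by (simp add: unit_pts_def)
  obtain k where k: "k \<noteq> 0" "nm (rho a b c d u) = scal k (rho a b c d u)"
    using nm_scal_ex[OF isotropic_rho[OF r nz iso]] by blast
  have "rho d (- b) (- c) a (nm (rho a b c d u)) = scal (k * (a * d - b * c) ^ 2) u"
    by (simp add: k rho_inverse)
  then show ?thesis using nm_scal[OF _ iso] k nz nm_id[OF u] by simp
qed

lemma np_rho:
  assumes r: "rational a" "rational b" "rational c" "rational d" and nz: "a * d - b * c \<noteq> 0"
    and v': "v' = scal (inverse (a * d - b * c)) (rho a b c d v)"
  shows "np v' = np v" "nn v' = nn v"
proof -
  let ?f = "\<lambda>u. nm (rho a b c d u)" and ?g = "\<lambda>u. nm (rho d (- b) (- c) a u)"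
  have r': "rational d" "rational (- b)" "rational (- c)" "rational a" using r by simp_all
  have nz': "d * a - (- b) * (- c) \<noteq> 0" using nz by (simp add: mult.commute)
  have v: "v = scal (inverse (d * a - (- b) * (- c))) (rho d (- b) (- c) a v')"
  proof -
    have "inverse (d * a - (- b) * (- c)) * (inverse (a * d - b * c) * (a * d - b * c) ^ 2) = 1"
      using inverse_cancel(1)[OF nz] by (simp add: mult.commute[of d])
    then show ?thesis unfolding v' by (simp only: rho_linear rho_inverse scal_simps)
  qed
  note f = nm_rho[OF r nz v'] and g = nm_rho[OF r' nz' v]
  have gf: "?g (?f u) = u" if "u \<in> line_pts v" for u
    using nm_rho_inverse[OF r nz] that by (simp add: line_pts_def)
  have fg: "?f (?g u) = u" if "u \<in> line_pts v'" for u
    using nm_rho_inverse[OF r' nz'] that by (simp add: line_pts_def)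
  have "bij_betw ?f {u \<in> line_pts v. real_pt u \<and> pos u v} {u \<in> line_pts v'. real_pt u \<and> pos u v'}"
    by (rule bij_betw_byWitness[where f' = ?g]) (use f g gf fg in auto)
  then show "np v' = np v" by (simp add: np_def bij_betw_same_card)
  have "bij_betw ?f {u \<in> line_pts v. real_pt u \<and> \<not> pos u v} {u \<in> line_pts v'. real_pt u \<and> \<not> pos u v'}"
    by (rule bij_betw_byWitness[where f' = ?g]) (use f g gf fg in auto)
  then show "nn v' = nn v" by (simp add: nn_def bij_betw_same_card)
qed

lemma np_minus:
  assumes h: "bil v (fr v) = 1" shows "np (- v) = nn v"
proof -
  have "line_pts (- v) = line_pts v" by (simp add: line_pts_def)
  then show ?thesis
    using pos_minus[OF line_pts_flag[OF h]] by (auto simp: np_def nn_def intro!: arg_cong[of _ _ card])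
qed

text \<open>The half turn about a rational non-isotropic \<open>e\<close> maps \<open>v\<close> to \<open>- v\<close>.\<close>

lemma balance_half_turn:
  assumes h: "bil v (fr v) = 1" and e: "rational e0" "rational e1" "rational e2"
    and "bil (e0, e1, e2) (e0, e1, e2) \<noteq> 0" and perp: "bil (e0, e1, e2) v = 0"
  shows "np v = nn v"
proof -
  obtain v0 v1 v2 where v: "v = (v0, v1, v2)" by (cases v)
  \<comment> \<open>The determinant of the traceless matrix with rows \<open>(e1, - e0)\<close> and
    \<open>(e2, - e1)\<close>. Its square is scalar, and on forms it acts, after division by
    \<open>D\<close>, as the half turn about \<open>e\<close>, by the reflection formula
    below.\<close>
  define D where "D = e1 * (- e1) - (- e0) * e2"
  have "bil (e0, e1, e2) (e0, e1, e2) = 2 * D" by (simp add: D_def algebra_simps)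
  then have D: "D \<noteq> 0" using assms(5) by auto
  have "rho e1 (- e0) e2 (- e1) v = scal (- D) v + scal (bil (e0, e1, e2) v) (e0, e1, e2)"
    by (simp add: v D_def algebra_simps power2_eq_square)
  then have rho: "rho e1 (- e0) e2 (- e1) v = scal (- D) v"
    by (simp only: perp scal_simps add_0_right)
  have "- v = scal (inverse D) (rho e1 (- e0) e2 (- e1) v)" using D by (simp add: rho)
  then have "np (- v) = np v"
    using np_rho(1)[of e1 "- e0" e2 "- e1" "- v" v] D e unfolding D_def by simp
  then show ?thesis using np_minus[OF h] by simp
qed

text \<open>There are \<open>p ^ 3\<close> rational vectors \<open>e\<close>, but
  \<open>bil e v\<close> takes at most \<open>p ^ 2\<close> values; the difference of two vectors
  with the same value is orthogonal to \<open>v\<close>.\<close>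

lemma rational_perp_exists:
  obtains e0 e1 e2 where "rational e0" "rational e1" "rational e2" "(e0, e1, e2) \<noteq> 0" "bil (e0, e1, e2) v = 0"
proof -
  let ?R = "{x::'f. rational x}"
  let ?A = "?R \<times> ?R \<times> ?R"
  have "card ((\<lambda>e. bil e v) ` ?A) \<le> CARD('f)" by (rule card_mono) auto
  also have "\<dots> < card ?A"
    using p_gt by (simp add: card_cartesian_product card_rational card_f power2_eq_square)
  finally obtain e e' where e: "e \<in> ?A" "e' \<in> ?A" "e \<noteq> e'" "bil e v = bil e' v"
    using pigeonhole[of "\<lambda>e. bil e v" ?A] by (auto simp: inj_on_def)
  obtain e0 e1 e2 where ee: "e + - e' = (e0, e1, e2)" by (cases "e + - e'")
  have r: "rational e0" "rational e1" "rational e2"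
    using e(1,2) ee by (cases e; cases e'; auto)+
  have nz: "(e0, e1, e2) \<noteq> 0" using e(3) by (simp flip: ee)
  have "bil (e0, e1, e2) v = 0" using e(4) by (simp flip: ee del: add_uminus_conv_diff)
  then show thesis using that[OF r nz] by blast
qed

text \<open>If \<open>b ^ half = 1\<close>, then \<open>b ^ quarter\<close> is \<open>1\<close> or
  \<open>-1\<close>. By the second equation of \<open>quarter_eq\<close>, \<open>b ^ (p * m)\<close>
  splits into the reference value \<open>b ^ (m ^ 2)\<close> of \<open>pos\<close> and this
  sign.\<close>

definition quarter :: nat where "quarter = (p ^ 2 - 1) div 4"

lemma quarter_eq: "half = 2 * quarter" "m * p = m ^ 2 + quarter"
proof -
  obtain k where k: "p = 4 * k + 1" using p_mod_4 by (metis mod_mult_div_eq add.commute)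
  have mk: "m = 2 * k + 1" using two_m k by simp
  have "p ^ 2 - 1 = 4 * (2 * k * (2 * k + 1))" by (simp add: k power2_eq_square algebra_simps)
  then have q: "quarter = 2 * k * (2 * k + 1)" by (simp add: quarter_def)
  have "half = 4 * k * (2 * k + 1)" using half_eq mk by (simp add: k)
  then show "half = 2 * quarter" unfolding q by simp
  show "m * p = m ^ 2 + quarter"
    unfolding q mk unfolding k by (simp add: power2_eq_square algebra_simps)
qed

text \<open>Up to a nonzero rational square, \<open>\<delta> * (y - \<delta>)\<close> is the value
  of \<open>bil\<close> at the affine points of an exceptional line, with parameter
  \<open>y\<close>. The value of the \<open>quarter\<close> power decides between the two signs of
  such a point.\<close>

definition quartic_pos :: "'f set" where
  "quartic_pos = {y. rational y \<and> (\<delta> * (y - \<delta>)) ^ quarter = 1}"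

definition quartic_neg :: "'f set" where
  "quartic_neg = {y. rational y \<and> (\<delta> * (y - \<delta>)) ^ quarter = -1}"

end

locale hermitian_quads_choice = hermitian_quads p \<delta> \<kappa> \<kappa>'
  for p :: nat and \<delta> :: "'f::{field,finite}" and \<kappa> \<kappa>' :: 'f +
  assumes choice: "int (card quartic_pos) - int (card quartic_neg) = (if \<kappa>' = \<kappa> then - 1 else 1)"
begin

text \<open>The rational vectors orthogonal to this \<open>v\<close> are the multiples of
  \<open>(1, 0, 0)\<close>, so no half turn is available and the signs have to be computed.\<close>

lemma balance_parabolic:
  assumes h: "bil (v0, v1, 0) (fr (v0, v1, 0)) = 1" and nr: "\<not> rational (v0 / (2 * v1))"
  shows "np (v0, v1, 0) = nn (v0, v1, 0)"
proof -
  let ?v = "(v0, v1, 0)"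
  define \<alpha> where "\<alpha> = v0 / (2 * v1)"
  have v1n: "-2 * (v1 * v1 ^ p) = 1" using h by (simp add: algebra_simps)
  then have v1: "v1 \<noteq> 0" by auto
  have v0: "v0 = 2 * v1 * \<alpha>" using v1 by (simp add: \<alpha>_def)
  obtain a b where ab: "rational a" "rational b" "\<alpha> = a + b * \<delta>" by (rule rational_parts)
  have b0: "b \<noteq> 0" using nr ab unfolding \<alpha>_def[symmetric] by auto
  have \<alpha>p: "\<alpha> ^ p = a - b * \<delta>" by (simp add: ab(3) \<delta>_conj) (simp add: ab(1,2))
  \<comment> \<open>The affine points of the line have \<open>u1 = \<alpha> ^ p\<close> and
    \<open>u0\<close> of prescribed trace, so \<open>u0\<close> is determined up to a rational
    multiple of \<open>\<delta>\<close>. The parameter is normalised to turn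
    \<open>bil (g y) (g y)\<close> into a rational square times
    \<open>\<delta> * (y - \<delta>)\<close>.\<close>
  define g where "g y = (\<alpha> * \<alpha> ^ p + (2 * b ^ 2 * y - 2 * b * a) * \<delta>, \<alpha> ^ p, 1 :: 'f)" for y
  let ?R = "{y. rational y}" and ?inf = "(1, 0, 0) :: 'f quad"
  have inj: "inj g" using b0 \<delta>_nz by (auto simp: inj_def g_def)
  have g_pts: "g ` ?R = {u \<in> line_pts ?v. snd (snd u) = 1}"
  proof (rule card_subset_eq)
    show "g ` ?R \<subseteq> {u \<in> line_pts ?v. snd (snd u) = 1}"
    proof
      fix u assume "u \<in> g ` ?R"
      then obtain y where y: "rational y" and u: "u = g y" by blast
      have "(\<alpha> * \<alpha> ^ p + (2 * b ^ 2 * y - 2 * b * a) * \<delta>, \<alpha> ^ p, 1) \<in> line_pts ?v"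
        unfolding line_pts_monic_iff v0
        by (simp add: \<delta>_conj y ab(1,2))
      then show "u \<in> {u \<in> line_pts ?v. snd (snd u) = 1}" by (simp add: u g_def)
    qed
    show "card (g ` ?R) = card {u \<in> line_pts ?v. snd (snd u) = 1}"
      using card_line_pts(2)[OF h] card_image[OF inj_on_subset[OF inj subset_UNIV], of ?R] card_rational by simp
  qed simp
  have inf: "?inf \<in> line_pts ?v" by (simp add: line_pts_infinity_iff)
  have pts: "line_pts ?v = insert ?inf (g ` ?R)"
    unfolding g_pts using inf by (auto simp: line_pts_def unit_pts_def)
  have inf_g: "?inf \<notin> g ` ?R" by (auto simp: g_def)
  define z where "z y = (\<delta> * (y - \<delta>)) ^ quarter" for y
  have bil_g: "bil (g y) (g y) = (2 * b) ^ 2 * (\<delta> * (y - \<delta>))" for y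
    unfolding g_def \<alpha>p unfolding ab(3) by (simp add: algebra_simps power2_eq_square)
  have bil_nz: "bil (g y) (g y) \<noteq> 0" if "rational y" for y
  proof -
    have "y \<noteq> \<delta>" using that \<delta>_conj \<delta>_nz by auto
    then show ?thesis using b0 \<delta>_nz by (simp add: bil_g)
  qed
  have bil_quarter: "bil (g y) (g y) ^ quarter = z y" for y
  proof -
    have "((2 * b) ^ 2) ^ quarter = 1"
      using rational_power_half[of "2 * b"] ab(2) b0 by (simp add: quarter_eq(1) power_mult)
    then show ?thesis unfolding bil_g z_def by (simp only: power_mult_distrib mult_1)
  qed
  have real_g: "real_pt (g y) \<longleftrightarrow> z y = 1 \<or> z y = -1" if "rational y" for y
  proof -
    have "bil (g y) (g y) ^ half = z y ^ 2"
      unfolding quarter_eq(1) mult.commute[of 2] power_mult bil_quarter ..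
    then show ?thesis using bil_nz[OF that] by (simp add: real_pt_def power2_eq_1_iff)
  qed
  \<comment> \<open>\<open>2 * v1\<close> is the eigenvalue \<open>\<nu>\<close> at the conic point
    \<open>(1, 0, 0)\<close> and also the constant factor of \<open>disc_form\<close> at the affine
    points, so \<open>s\<close> governs both kinds of sign.\<close>
  define s where "s = (2 * v1) ^ m"
  have disc: "disc_form (g y) ?v = 2 * v1 * bil (g y) (g y) ^ p" if "rational y" for y
  proof -
    have bp: "bil (g y) (g y) ^ p = (2 * b) ^ 2 * (- \<delta> * (y + \<delta>))"
      unfolding bil_g by (simp add: \<delta>_conj ab(2) that)
    have fg: "fr (g y) = (\<alpha> * \<alpha> ^ p - (2 * b ^ 2 * y - 2 * b * a) * \<delta>, \<alpha>, 1)"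
      by (simp add: g_def \<delta>_conj ab(1,2) that)
    show ?thesis
      unfolding bp disc_form_def fg unfolding g_def cr.simps bil.simps v0 \<alpha>p unfolding ab(3)
      by Groebner_Basis.algebra
  qed
  have pos_g: "pos (g y) ?v \<longleftrightarrow> s * z y = \<kappa>" if "rational y" "real_pt (g y)" for y
  proof -
    let ?b = "bil (g y) (g y)"
    have "disc_form (g y) ?v ^ m = s * ?b ^ (p * m)"
      unfolding disc[OF that(1)] s_def by (simp only: power_mult_distrib power_mult)
    also have "\<dots> = (s * z y) * ?b ^ (m ^ 2)"
      unfolding mult.commute[of p] quarter_eq(2) power_add bil_quarter by (simp only: mult_ac)
    finally have "disc_form (g y) ?v ^ m = (s * z y) * ?b ^ (m ^ 2)" .
    moreover have "?b \<noteq> 0" by (rule bil_nz[OF that(1)])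
    ultimately show ?thesis using that(2) by (simp add: pos_def real_pt_def)
  qed
  have "(2 * v1) * (2 * v1) ^ p = -2 * (-2 * (v1 * v1 ^ p))" by simp
  then have "(2 * v1) * (2 * v1) ^ p = -2" unfolding v1n by simp
  then have s: "s = \<kappa> \<or> s = - \<kappa>" "s = \<kappa>' \<or> s = - \<kappa>'"
    unfolding s_def using norm_minus_2_power_m \<kappa>_squared \<kappa>'_squared by blast+
  have pos_inf: "pos ?inf ?v \<longleftrightarrow> s = \<kappa>'" "real_pt ?inf"
    unfolding s_def by (auto simp: pos_def real_pt_def)
  have zpm: "s * z y = \<kappa> \<longleftrightarrow> (if s = \<kappa> then z y = 1 else z y = -1)" if "z y = 1 \<or> z y = -1" for y
    using that s(1) by auto
  let ?P = "if s = \<kappa> then quartic_pos else quartic_neg"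
  let ?N = "if s = \<kappa> then quartic_neg else quartic_pos"
  have card_if: "card (A \<union> (if b then {i} else {})) = card A + (if b then 1 else 0)"
    "card (A \<union> (if b then {} else {i})) = card A + (if b then 0 else 1)"
    if "i \<notin> A" for A :: "'f quad set" and b i using that by (cases b; simp)+
  have "{u \<in> line_pts ?v. real_pt u \<and> pos u ?v} = g ` ?P \<union> (if s = \<kappa>' then {?inf} else {})"
    unfolding pts quartic_pos_def quartic_neg_def z_def[symmetric]
    using real_g pos_g zpm pos_inf by (auto simp: two_nz[symmetric] split: if_splits)
  moreover have "card (g ` ?P \<union> (if s = \<kappa>' then {?inf} else {})) = card ?P + (if s = \<kappa>' then 1 else 0)"
  proof -
    have "?inf \<notin> g ` ?P" using inf_g by (auto simp: quartic_pos_def quartic_neg_def)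
    moreover have "card (g ` ?P) = card ?P" by (rule card_image[OF inj_on_subset[OF inj subset_UNIV]])
    ultimately show ?thesis using card_if(1) by metis
  qed
  ultimately have np: "np ?v = card ?P + (if s = \<kappa>' then 1 else 0)" by (simp add: np_def)
  have "{u \<in> line_pts ?v. real_pt u \<and> \<not> pos u ?v} = g ` ?N \<union> (if s = \<kappa>' then {} else {?inf})"
    unfolding pts quartic_pos_def quartic_neg_def z_def[symmetric]
    using real_g pos_g zpm pos_inf by (auto simp: two_nz[symmetric] split: if_splits)
  moreover have "card (g ` ?N \<union> (if s = \<kappa>' then {} else {?inf})) = card ?N + (if s = \<kappa>' then 0 else 1)"
  proof -
    have "?inf \<notin> g ` ?N" using inf_g by (auto simp: quartic_pos_def quartic_neg_def)
    moreover have "card (g ` ?N) = card ?N" by (rule card_image[OF inj_on_subset[OF inj subset_UNIV]])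
    ultimately show ?thesis using card_if(2) by metis
  qed
  ultimately have nn: "nn ?v = card ?N + (if s = \<kappa>' then 0 else 1)" by (simp add: nn_def)
  \<comment> \<open>Passing from \<open>s\<close> to \<open>- s\<close> exchanges the two quartic
    sets and also reverses the sign at infinity. So only the relation between
    \<open>\<kappa>\<close> and \<open>\<kappa>'\<close> matters, and \<open>choice\<close> fixes
    it.\<close>
  show ?thesis using choice s \<kappa>_nz unfolding np nn by (cases "\<kappa>' = \<kappa>") (auto split: if_splits)
qed

lemma balance_infinity:
  assumes h: "bil (v0, v1, 0) (fr (v0, v1, 0)) = 1"
  shows "np (v0, v1, 0) = nn (v0, v1, 0)"
proof (cases "rational (v0 / (2 * v1))")
  case True
  have v1: "v1 \<noteq> 0" using h by auto
  define r where "r = 2 * (v0 / (2 * v1))"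
  have r: "rational r" using True by (simp only: r_def frob_mult frob_numeral)
  \<comment> \<open>\<open>(x, r, 2)\<close> is orthogonal to \<open>v\<close> for every
    \<open>x\<close>; with this \<open>x\<close> its value under \<open>bil\<close> is 2.\<close>
  define x where "x = (r ^ 2 + 1) / 2"
  have x: "2 * x = r ^ 2 + 1" by (simp add: x_def)
  show ?thesis
  proof (rule balance_half_turn[OF h])
    show "rational x" "rational r" "rational 2" using r by (simp_all add: x_def)
    have "bil (x, r, 2) (x, r, 2) = 2 * (2 * x) - 2 * r ^ 2" by (simp add: power2_eq_square)
    then show "bil (x, r, 2) (x, r, 2) \<noteq> 0" unfolding x by simp
    show "bil (x, r, 2) (v0, v1, 0) = 0" using v1 by (simp add: r_def)
  qed
qed (rule balance_parabolic[OF h])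

lemma real_balance:
  assumes h: "bil v (fr v) = 1"
  shows "np v = nn v"
proof -
  obtain e0 e1 e2 where e: "rational e0" "rational e1" "rational e2" "(e0, e1, e2) \<noteq> 0" "bil (e0, e1, e2) v = 0"
    by (rule rational_perp_exists)
  show ?thesis
  proof (cases "bil (e0, e1, e2) (e0, e1, e2) = 0")
    case False
    then show ?thesis using balance_half_turn[OF h] e by blast
  next
    case True
    have iso: "isotropic (e0, e1, e2)" using e(1-4) True unfolding isotropic_def fr.simps by (simp add: mult.commute)
    show ?thesis using iso True
    proof (cases rule: isotropic_conic_cases)
      case (1 c)
      obtain v0 v1 v2 where v: "v = (v0, v1, v2)" by (cases v)
      have "v2 = 0" using e(5) 1 by (simp add: v)
      then show ?thesis using balance_infinity h unfolding v by simp
    next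
      case (2 c t)
      \<comment> \<open>This map of determinant one takes \<open>(t ^ 2, - t, 1)\<close> to
        \<open>(1, 0, 0)\<close>, so that the transformed line passes through infinity.\<close>
      let ?R = "rho 0 (-1) 1 t"
      have d: "0 * t - (-1) * 1 = (1::'f)" by simp
      have r: "rational 0" "rational (-1)" "rational 1" "rational t" using 2(2) by simp_all
      have nz: "0 * t - (-1) * 1 \<noteq> (0::'f)" by simp
      have eq: "?R v = scal (inverse (0 * t - (-1) * 1)) (?R v)" by simp
      obtain v0 v1 v2 where v: "?R v = (v0, v1, v2)" by (cases "?R v")
      have "bil (?R (t ^ 2, - t, 1)) (?R v) = (0 * t - (-1) * 1) ^ 2 * bil (t ^ 2, - t, 1) v"
        by (rule bil_rho)
      also have "\<dots> = 0" using e(5) 2(1) unfolding 2(3) by (simp only: bil_linear mult_eq_0_iff simp_thms)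
      finally have "v2 = 0" by (simp add: v power2_eq_square)
      moreover have "bil (?R v) (fr (?R v)) = 1" by (simp add: fr_rho[OF r] bil_rho h)
      ultimately have "np (?R v) = nn (?R v)" using balance_infinity unfolding v by simp
      then show ?thesis using np_rho[OF r nz eq] by simp
    qed
  qed
qed

theorem card_pos_line_pts:
  assumes h: "bil v (fr v) = 1"
  shows "card {u \<in> line_pts v. pos u v} = m"
proof -
  let ?S = "\<lambda>P. {u \<in> line_pts v. P u}"
  have split: "card (?S Q) = card {u \<in> line_pts v. real_pt u \<and> Q u} + card {u \<in> line_pts v. \<not> real_pt u \<and> Q u}" for Q
    by (subst card_Un_disjoint[symmetric]) (auto intro!: arg_cong[of _ _ card])
  have "card (?S (\<lambda>u. pos u v)) = card (?S (\<lambda>u. \<not> pos u v))"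
    using split[of "\<lambda>u. pos u v"] split[of "\<lambda>u. \<not> pos u v"] real_balance[OF h] imaginary_balance[OF h]
    by (simp add: np_def nn_def)
  moreover have "card (?S (\<lambda>u. pos u v)) + card (?S (\<lambda>u. \<not> pos u v)) = card (line_pts v)"
    by (subst card_Un_disjoint[symmetric]) (auto intro!: arg_cong[of _ _ card])
  ultimately have "2 * card (?S (\<lambda>u. pos u v)) = p + 1" using card_line_pts(1)[OF h] by simp
  then show ?thesis using two_m by simp
qed

end


section \<open>Hermitian forms\<close>

context quadratic_extension
begin

lemma frob_sum: "(\<Sum>i\<in>A. f i :: 'f) ^ p = (\<Sum>i\<in>A. f i ^ p)"
  by (rule freshmans_dream_sum) (simp_all add: prime_p)

lemma hform_scale [simp]:
  fixes x :: "'f^'n"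
  shows "hform p H (c *s x) y = c * hform p H x y" "hform p H x (c *s y) = c ^ p * hform p H x y"
  by (simp_all add: hform_def sum_distrib_left mult_ac)

lemma hform_add [simp]:
  fixes x :: "'f^'n"
  shows "hform p H (x + x') y = hform p H x y + hform p H x' y" "hform p H x (y + y') = hform p H x y + hform p H x y'"
  by (simp_all add: hform_def distrib_left distrib_right sum.distrib)

lemma hform_diff [simp]:
  fixes x :: "'f^'n"
  shows "hform p H (x - x') y = hform p H x y - hform p H x' y" "hform p H x (y - y') = hform p H x y - hform p H x y'"
  by (simp_all add: hform_def left_diff_distrib right_diff_distrib sum_subtractf)

end

lemma pg_points_span:
  fixes P :: "('a::field^'n) set"
  assumes "P \<in> pg_points"
  obtains z where "z \<noteq> 0" "P = vec.span {z}"
proof -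
  have P: "vec.subspace P" "vec.dim P = 1" using assms by (auto simp: pg_points_def)
  obtain B where B: "B \<subseteq> P" "vec.independent B" "P \<subseteq> vec.span B" "card B = vec.dim P"
    by (rule vec.basis_exists)
  then obtain z where z: "B = {z}" using P(2) by (metis card_1_singletonE)
  have "P = vec.span {z}" using B(1,3) P(1) z by (metis subset_antisym vec.span_minimal)
  moreover have "z \<noteq> 0" using B(2) z by (auto simp: vec.dependent_zero)
  ultimately show thesis using that by blast
qed

lemma span_singleton_scale:
  fixes z :: "'a::field^'n"
  assumes "c \<noteq> 0" shows "vec.span {c *s z} = vec.span {z}"
proof -
  have "vec.span {k *s y} \<subseteq> vec.span {y}" for k and y :: "'a^'n"
    by (rule vec.span_minimal) (simp_all add: vec.span_base vec.span_scale)
  from this[of c z] this[of "inverse c" "c *s z"] show ?thesis using assms by simp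
qed

lemma span_singleton_subset_iff: "vec.subspace L \<Longrightarrow> vec.span {z} \<subseteq> L \<longleftrightarrow> z \<in> L" for z :: "'a::field^'n"
  using vec.span_base[of z "{z}"] vec.span_minimal[of "{z}" L] by auto

lemma span_pair: "vec.span {x, y} = {c *s x + d *s y | c d. True}" for x :: "'a::field^'n"
proof -
  have "z \<in> vec.span {x, y} \<longleftrightarrow> (\<exists>c d. z = c *s x + d *s y)" for z
    unfolding vec.span_breakdown_eq[of z x] vec.span_singleton image_iff by (simp add: diff_eq_eq add.commute)
  then show ?thesis by blast
qed

context hermitian_quads_choice
begin

section \<open>The hemisystem of the standard Hermitian surface\<close>

definition V :: "'f \<Rightarrow> 'f quad \<Rightarrow> 'f^4" where
  "V x u = (\<chi> i. if i = 1 then x else if i = 2 then fst u else if i = 3 then fst (snd u) else snd (snd u))"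

definition H0 :: "'f^4^4" where
  "H0 = (\<chi> i j. if i = 1 \<and> j = 1 then - 1 else if i = 2 \<and> j = 4 \<or> i = 4 \<and> j = 2 then 1
     else if i = 3 \<and> j = 3 then - 2 else 0)"

lemma V_nth [simp]: "V x u $ 1 = x" "V x u $ 2 = fst u" "V x u $ 3 = fst (snd u)" "V x u $ 4 = snd (snd u)"
  by (simp_all add: V_def)

lemma V_eq_iff [simp]: "V x u = V y w \<longleftrightarrow> x = y \<and> u = w"
  by (cases u; cases w) (auto simp: vec_eq_iff forall_4)

lemma V_exhaust: obtains x u where "z = V x u"
proof
  show "z = V (z $ 1) (z $ 2, z $ 3, z $ 4)" by (simp add: vec_eq_iff forall_4)
qed

lemma V_linear [simp]: "V x u + V y w = V (x + y) (u + w)" "c *s V x u = V (c * x) (scal c u)"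
  by (cases u; cases w; simp add: vec_eq_iff forall_4)+

lemma V_zero: "V 0 0 = 0" by (simp add: vec_eq_iff forall_4 zero_prod_def)

lemma V_eq_zero_iff [simp]: "V x u = 0 \<longleftrightarrow> x = 0 \<and> u = 0"
  using V_eq_iff[of x u 0 0] by (simp add: V_zero)

lemma hform_V: "hform p H0 (V x u) (V y w) = - (x * y ^ p) + bil u (fr w)"
  by (cases u; cases w) (simp add: hform_def H0_def sum_4 algebra_simps)

definition gen :: "'f quad \<Rightarrow> 'f quad \<Rightarrow> ('f^4) set" where
  "gen u w = {V y (scal c u + scal y w) | c y. True}"

lemma V_in_gen: "V y t \<in> gen u w \<longleftrightarrow> (\<exists>c. t = scal c u + scal y w)"
  by (auto simp: gen_def)

lemma scal_distrib: "scal c (f + g) = scal c f + scal c g" "scal (c + d) f = scal c f + scal d f" for c :: 'f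
  by (cases f; cases g; simp add: algebra_simps)+

lemma gen_span: "gen u w = vec.span {V 0 u, V 1 w}"
  unfolding span_pair by (simp add: gen_def)

lemma gen_subspace: "vec.subspace (gen u w)"
  by (simp add: gen_span)

lemma gen_pg_line: assumes "u \<noteq> 0" shows "gen u w \<in> pg_lines"
proof -
  have "V 1 w \<notin> vec.span {V 0 u}" by (auto simp: vec.span_singleton)
  moreover have "vec.independent {V 0 u}" using assms by simp
  ultimately have "vec.independent {V 1 w, V 0 u}" by (rule vec.independent_insertI)
  then have "vec.independent {V 0 u, V 1 w}" by (simp add: insert_commute)
  then have "vec.dim (gen u w) = card {V 0 u, V 1 w}"
    unfolding gen_span by (rule vec.dim_span_eq_card_independent)
  then show ?thesis using gen_subspace by (simp add: pg_lines_def)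
qed

lemma generator_line:
  assumes f: "flag u w" shows "gen u w \<in> generators p H0"
proof -
  note D = flagD[OF f]
  have zero: "hform p H0 x y = 0" if "x \<in> gen u w" "y \<in> gen u w" for x y
    using that D by (auto simp: gen_def hform_V)
  have "P \<in> herm_points p H0" if "P \<in> pg_points" "P \<subseteq> gen u w" for P
    using that zero by (auto simp: herm_points_def polar_def)
  then show ?thesis using gen_pg_line[OF D(1)] by (simp add: generators_def)
qed

lemma gen_add: "gen u (w + scal k u) = gen u w"
proof -
  have sub: "gen u (w + scal k u) \<subseteq> gen u w" for w k
  proof
    fix z assume "z \<in> gen u (w + scal k u)"
    then obtain c y where z: "z = V y (scal c u + scal y (w + scal k u))" by (auto simp: gen_def)
    have "scal c u + scal y (w + scal k u) = scal (c + y * k) u + scal y w" by (simp add: scal_distrib)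
    then show "z \<in> gen u w" unfolding z V_in_gen by blast
  qed
  have "w = (w + scal k u) + scal (- k) u" by simp
  then have "gen u w \<subseteq> gen u (w + scal k u)" using sub[of "w + scal k u" "- k"] by simp
  then show ?thesis using sub by blast
qed

lemma gen_scal: assumes "k \<noteq> 0" shows "gen (scal k u) w = gen u w"
proof -
  have sub: "gen (scal k u) w \<subseteq> gen u w" for k u
    by (auto simp: gen_def)
  have "u = scal (inverse k) (scal k u)" using assms by simp
  then show ?thesis using sub[of k u] sub[of "inverse k" "scal k u"] by simp
qed

definition hemi :: "('f^4) set set" where
  "hemi = {gen u w | u w. flag u w \<and> pos u w}"

lemma hemi_unit: "hemi = {gen u w | u w. u \<in> unit_pts \<and> flag u w \<and> pos u w}"
proof -
  have "\<exists>u'. gen u w = gen u' w \<and> u' \<in> unit_pts \<and> flag u' w \<and> pos u' w" if "flag u w" "pos u w" for u w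
  proof -
    have iso: "isotropic u" using that(1) by (rule flagD)
    obtain c where c: "c \<noteq> 0" "nm u = scal c u" using nm_scal_ex[OF iso] by blast
    show ?thesis
      by (rule exI[of _ "nm u"]) (use c that nm_unit_pts[OF iso] in \<open>simp add: gen_scal flag_scal pos_scal\<close>)
  qed
  then show ?thesis unfolding hemi_def by blast
qed

lemma unit_pts_scal_eq: "u \<in> unit_pts \<Longrightarrow> u' \<in> unit_pts \<Longrightarrow> u' = scal c u \<Longrightarrow> u' = u"
proof -
  assume h: "u \<in> unit_pts" "u' \<in> unit_pts" "u' = scal c u"
  then have "c \<noteq> 0" by (auto simp: unit_pts_def isotropic_def)
  moreover have "isotropic u" using h by (simp add: unit_pts_def)
  ultimately have "nm u' = nm u" using nm_scal h by simp
  then show ?thesis using nm_id h by simp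
qed

definition pencil :: "'f quad \<Rightarrow> ('f^4) set set" where
  "pencil u = {gen u w | w. flag u w \<and> pos u w}"

lemma flag_exists:
  assumes "u \<in> unit_pts"
  obtains w where "flag u w" "\<And>w'. flag u w' \<Longrightarrow> \<exists>l c. w' = scal l w + scal c u"
proof -
  have iso: "isotropic u" using assms by (simp add: unit_pts_def)
  obtain x :: 'f where x: "x * x ^ p = - 1 / 2"
    by (rule norm_exists[of "- 1 / 2"]) (simp_all)
  have x0: "x \<noteq> 0" using x by auto
  have x2: "- (2 * x * x ^ p) = 1" using x by (simp add: mult.assoc)
  show thesis
  proof (cases "u = (1, 0, 0)")
    case True
    show thesis
    proof (rule that)
      show "flag u (0, x, 0)" using iso x2 by (simp add: flag_def True)
      fix w' assume "flag u w'"
      then have "bil w' (fr u) = 0" by (rule flagD)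
      then have "w' = scal (fst (snd w') / x) (0, x, 0) + scal (fst w') u"
        using x0 by (cases w') (simp add: True)
      then show "\<exists>l c. w' = scal l (0, x, 0) + scal c u" by blast
    qed
  next
    case False
    then obtain u0 u1 where u: "u = (u0, u1, 1)" using assms by (cases u) (auto simp: unit_pts_def)
    let ?w = "(2 * x * u1 ^ p, x, 0)"
    show thesis
    proof (rule that)
      have "bil ?w (fr u) = 0" by (simp add: u)
      then have "bil u (fr ?w) = 0" using bil_conj[of u ?w] by simp
      then show "flag u ?w" using iso x2 by (simp add: flag_def)
      fix w' assume "flag u w'"
      then have b: "bil w' (fr u) = 0" by (rule flagD)
      obtain w0 w1 w2 where w: "w' = (w0, w1, w2)" by (cases w')
      have "bil u (fr u) = 0" using iso by (simp add: isotropic_def)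
      moreover have "w0 - w2 * u0 - 2 * (w1 - w2 * u1) * u1 ^ p = bil w' (fr u) - w2 * bil u (fr u)"
        by (simp add: u w algebra_simps)
      ultimately have "w0 - w2 * u0 = 2 * (w1 - w2 * u1) * u1 ^ p" using b by simp
      then have eq: "w0 = 2 * (w1 - w2 * u1) * u1 ^ p + w2 * u0" by (simp add: diff_eq_eq)
      define l where "l = (w1 - w2 * u1) / x"
      have lx: "l * x = w1 - w2 * u1" using x0 by (simp add: l_def)
      have "scal l ?w + scal w2 u = (2 * (l * x) * u1 ^ p + w2 * u0, l * x + w2 * u1, w2)"
        by (simp add: u mult_ac)
      then have "w' = scal l ?w + scal w2 u" unfolding lx by (simp add: w eq)
      then show "\<exists>l c. w' = scal l ?w + scal c u" by blast
    qed
  qed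
qed

text \<open>Relative to one positive \<open>w\<close>, the generators on \<open>u\<close> correspond
  to factors \<open>l\<close> of norm one. An \<open>m\<close>-th root of unity keeps the sign, its
  negative reverses it, and by \<open>norm_one_cases\<close> there are no other factors.\<close>

lemma card_pencil:
  assumes u: "u \<in> unit_pts" shows "card (pencil u) = m"
proof -
  obtain w0 where w0: "flag u w0" "\<And>w'. flag u w' \<Longrightarrow> \<exists>l c. w' = scal l w0 + scal c u"
    by (rule flag_exists[OF u]) blast
  define w where "w = (if pos u w0 then w0 else - w0)"
  have w: "flag u w" "pos u w" using w0(1) flag_minus pos_minus[OF w0(1)] by (auto simp: w_def)
  have all: "\<exists>l c. w' = scal l w + scal c u" if fw: "flag u w'" for w'
  proof (cases "pos u w0")
    case True
    then show ?thesis using w0(2)[OF fw] by (simp add: w_def)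
  next
    case False
    obtain l c where "w' = scal l w0 + scal c u" using w0(2)[OF fw] by blast
    then have "w' = scal (- l) w + scal c u" using False by (simp add: w_def)
    then show ?thesis by blast
  qed
  note D = flagD[OF w(1)]
  have "pencil u = (\<lambda>l. gen u (scal l w)) ` {l. l ^ m = 1}"
  proof (intro equalityI subsetI)
    fix L assume "L \<in> pencil u"
    then obtain w' where w': "flag u w'" "pos u w'" "L = gen u w'" unfolding pencil_def by blast
    obtain l c where l: "w' = scal l w + scal c u" using all[OF w'(1)] by blast
    have "bil w' (fr w') = 1" using w'(1) by (rule flagD)
    then have n: "l * l ^ p = 1" using D by (simp add: l mult.commute)
    have "l ^ m = 1"
    proof (rule ccontr)
      assume "l ^ m \<noteq> 1"
      then have nl: "(- l) ^ m = 1" using norm_one_cases[OF n] by simp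
      have "flag u (scal (- l) w)" by (rule flag_norm_one) (use n w in simp_all)
      then have "pos u (- scal (- l) w) \<longleftrightarrow> \<not> pos u (scal (- l) w)" by (rule pos_minus)
      then have "\<not> pos u (scal l w)" using pos_torsion[OF nl] w(2) by simp
      then show False using w'(2) by (simp add: l pos_add)
    qed
    then show "L \<in> (\<lambda>l. gen u (scal l w)) ` {l. l ^ m = 1}" using w'(3) by (simp add: l gen_add)
  next
    fix L assume "L \<in> (\<lambda>l. gen u (scal l w)) ` {l. l ^ m = 1}"
    then obtain l where l: "l ^ m = 1" "L = gen u (scal l w)" by blast
    have "l * l ^ p = 1" using power_m_squared[of l] l(1) by simp
    then show "L \<in> pencil u"
      using flag_norm_one[OF _ w(1)] w(2) pos_torsion[OF l(1)] l(2) unfolding pencil_def by blast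
  qed
  moreover have "inj_on (\<lambda>l. gen u (scal l w)) {l. l ^ m = 1}"
  proof (rule inj_onI)
    fix l l' assume "gen u (scal l w) = gen u (scal l' w)"
    moreover have "V 1 (scal l w) \<in> gen u (scal l w)"
      unfolding V_in_gen by (rule exI[of _ 0]) simp
    ultimately obtain c where "scal l w = scal c u + scal l' w" by (auto simp: V_in_gen)
    then have "bil (scal l w) (fr w) = bil (scal c u + scal l' w) (fr w)" by simp
    then show "l = l'" using D by simp
  qed
  ultimately show ?thesis using card_m_torsion by (simp add: card_image)
qed

lemma gen_unit_eq:
  assumes "gen u w = gen u' w'" "u \<in> unit_pts" "u' \<in> unit_pts" shows "u = u'"
proof -
  have "V 0 u \<in> gen u w" unfolding V_in_gen by (rule exI[of _ 1]) simp
  then obtain c where "u = scal c u'" using assms(1) by (auto simp: V_in_gen)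
  then show ?thesis using unit_pts_scal_eq assms by blast
qed

lemma hemi_pencils: "hemi = (\<Union>u\<in>unit_pts. pencil u)"
  unfolding hemi_unit pencil_def by blast

lemma card_unit_pts: "card unit_pts = p ^ 3 + 1"
proof -
  let ?f = "\<lambda>(x::'f, y::'f). (y, x, 1::'f)"
  let ?S = "SIGMA x:UNIV. {y::'f. y + y ^ p = 2 * (x * x ^ p)}"
  have T: "unit_pts = insert (1, 0, 0) (?f ` ?S)"
    (is "_ = ?T")
  proof (intro equalityI subsetI)
    fix u assume "u \<in> unit_pts"
    moreover obtain u0 u1 u2 where "u = (u0, u1, u2)" by (cases u)
    ultimately show "u \<in> ?T" by (auto simp: unit_pts_def isotropic_def zero_prod_def mult.assoc)
  next
    fix u assume "u \<in> ?T"
    then show "u \<in> unit_pts"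
      using isotropic_infinity by (auto simp: unit_pts_def isotropic_def zero_prod_def mult.assoc)
  qed
  have I: "inj_on ?f ?S" by (auto simp: inj_on_def)
  have C: "card ?S = p ^ 3"
  proof -
    have "card {y::'f. y + y ^ p = 2 * (x * x ^ p)} = p" for x
      by (rule trace_fiber) (simp add: mult.commute)
    then show ?thesis by (simp add: card_f power2_eq_square power3_eq_cube)
  qed
  have N: "(1, 0, 0) \<notin> ?f ` ?S" by auto
  show ?thesis
    unfolding T card_insert_disjoint[OF finite N] card_image[OF I] C by simp
qed

lemma card_hemi: "card hemi = (p ^ 3 + 1) * m"
proof -
  have "card hemi = (\<Sum>u\<in>unit_pts. card (pencil u))"
    unfolding hemi_pencils
  proof (rule card_UN_disjoint)
    show "\<forall>u\<in>unit_pts. \<forall>u'\<in>unit_pts. u \<noteq> u' \<longrightarrow> pencil u \<inter> pencil u' = {}"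
      using gen_unit_eq unfolding pencil_def by blast
  qed simp_all
  then show ?thesis by (simp add: card_pencil card_unit_pts)
qed

text \<open>A point is either \<open>V 0 u\<close> with \<open>u\<close> on the Hermitian curve, and
  its chosen generators form the pencil of \<open>u\<close>; or it can be scaled to
  \<open>V 1 v\<close> with \<open>v\<close> of norm one. Then each \<open>u\<close> on the polar
  line of \<open>v\<close> carries one generator through it, and \<open>card_pos_line_pts\<close>
  counts the positive ones.\<close>

lemma card_hemi_point:
  assumes P: "P \<in> herm_points p H0"
  shows "card {L \<in> hemi. P \<subseteq> L} = m"
proof -
  obtain z where z: "z \<noteq> 0" "P = vec.span {z}" using P by (auto simp: herm_points_def elim: pg_points_span)
  obtain x u where xu: "z = V x u" by (rule V_exhaust)
  have "hform p H0 z z = 0" using P vec.span_base[of z "{z}"]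
    by (auto simp: herm_points_def polar_def z(2))
  then have h: "bil u (fr u) = x * x ^ p" by (simp add: xu hform_V)
  show ?thesis
  proof (cases "x = 0")
    case True
    then have iso: "isotropic u" using h z(1) by (simp add: isotropic_def xu)
    obtain c where c: "c \<noteq> 0" "nm u = scal c u" using nm_scal_ex[OF iso] by blast
    have "P = vec.span {V 0 (nm u)}"
      using span_singleton_scale[OF c(1), of "V 0 u"] by (simp add: z(2) xu True c(2))
    then have sub: "P \<subseteq> L \<longleftrightarrow> V 0 (nm u) \<in> L" if "vec.subspace L" for L
      using span_singleton_subset_iff[OF that] by simp
    have n: "nm u \<in> unit_pts" by (rule nm_unit_pts[OF iso])
    have "{L \<in> hemi. P \<subseteq> L} = pencil (nm u)"
    proof (intro equalityI subsetI)
      fix L assume "L \<in> {L \<in> hemi. P \<subseteq> L}"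
      then obtain u' w where L: "L = gen u' w" "u' \<in> unit_pts" "flag u' w" "pos u' w" "V 0 (nm u) \<in> L"
        using sub gen_subspace unfolding hemi_unit by blast
      then obtain k where "nm u = scal k u'" by (auto simp: V_in_gen)
      then have "nm u = u'" using unit_pts_scal_eq[OF L(2) n] by blast
      then show "L \<in> pencil (nm u)" using L unfolding pencil_def by blast
    next
      fix L assume "L \<in> pencil (nm u)"
      then obtain w where L: "L = gen (nm u) w" "flag (nm u) w" "pos (nm u) w" unfolding pencil_def by blast
      have "V 0 (nm u) \<in> L" unfolding L(1) V_in_gen by (rule exI[of _ 1]) simp
      then have "P \<subseteq> L" using sub gen_subspace L(1) by blast
      then show "L \<in> {L \<in> hemi. P \<subseteq> L}" using L unfolding hemi_def by blast
    qed
    then show ?thesis using card_pencil[OF n] by simp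
  next
    case False
    define v where "v = scal (inverse x) u"
    have "bil v (fr v) = inverse x * (inverse x ^ p * (x * x ^ p))" by (simp add: v_def h)
    also have "\<dots> = 1" using False by (simp add: power_inverse field_simps)
    finally have h: "bil v (fr v) = 1" .
    have "P = vec.span {V 1 v}"
      using span_singleton_scale[of "inverse x" "V x u"] False by (simp add: z(2) xu v_def)
    then have sub: "P \<subseteq> L \<longleftrightarrow> V 1 v \<in> L" if "vec.subspace L" for L
      using span_singleton_subset_iff[OF that] by simp
    have "{L \<in> hemi. P \<subseteq> L} = (\<lambda>u. gen u v) ` {u \<in> line_pts v. pos u v}"
    proof (intro equalityI subsetI)
      fix L assume "L \<in> {L \<in> hemi. P \<subseteq> L}"
      then obtain u' w where L: "L = gen u' w" "u' \<in> unit_pts" "flag u' w" "pos u' w" "V 1 v \<in> L"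
        using sub gen_subspace unfolding hemi_unit by blast
      then obtain c where v: "v = w + scal c u'" by (auto simp: V_in_gen add.commute)
      have "L = gen u' v" using L(1) by (simp add: v gen_add)
      moreover have "flag u' v" using flag_add[OF L(3)] by (simp add: v)
      moreover have "pos u' v" using L(4) by (simp add: v pos_add)
      ultimately show "L \<in> (\<lambda>u. gen u v) ` {u \<in> line_pts v. pos u v}"
        using L(2) unfolding line_pts_def flag_def by blast
    next
      fix L assume "L \<in> (\<lambda>u. gen u v) ` {u \<in> line_pts v. pos u v}"
      then obtain u' where L: "L = gen u' v" "u' \<in> line_pts v" "pos u' v" by blast
      have "V 1 v \<in> L" unfolding L(1) V_in_gen by (rule exI[of _ 0]) simp
      then have "P \<subseteq> L" using sub gen_subspace L(1) by blast
      then show "L \<in> {L \<in> hemi. P \<subseteq> L}" using L line_pts_flag[OF h L(2)] unfolding hemi_def by blast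
    qed
    moreover have "inj_on (\<lambda>u. gen u v) {u \<in> line_pts v. pos u v}"
      using gen_unit_eq unfolding inj_on_def line_pts_def by blast
    ultimately show ?thesis using card_pos_line_pts[OF h] by (simp add: card_image)
  qed
qed

theorem hemisystem_H0: "hemisystem p H0 hemi"
proof -
  have "(p ^ 3 + 1) * (p + 1) div 2 = (p ^ 3 + 1) * m"
    unfolding two_m[symmetric] by simp
  moreover have hemi_gen: "hemi \<subseteq> generators p H0" using generator_line unfolding hemi_def by blast
  ultimately show ?thesis
    using odd_p card_hemi card_hemi_point hemi_gen unfolding hemisystem_def m_def[symmetric] by simp
qed

end


section \<open>Collineations\<close>

lemma mat_vector_mult: "mat c *v x = c *s x" for x :: "'a::field^'n"
  by (simp add: matrix_vector_mult_def mat_def vec_eq_iff if_distrib if_distribR cong: if_cong)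

lemma collin_mult: "collin (g ** h) S = collin g (collin h S)" for g :: "'a::field^'n^'n"
  by (simp add: collin_def image_image matrix_vector_mul_assoc)

lemma collin_one: "collin (mat 1) S = S"
  by (simp add: collin_def)

lemma collin_mono: "S \<subseteq> T \<Longrightarrow> collin g S \<subseteq> collin g T"
  by (auto simp: collin_def)

lemma collin_subspace: "vec.subspace S \<Longrightarrow> vec.subspace (collin g S)" for g :: "'a::field^'n^'n"
  unfolding collin_def by (rule vec.linear_subspace_image[OF matrix_vector_mul_linear_gen])

lemma dim_collin:
  fixes g :: "'a::field^'n^'n"
  assumes "g' ** g = mat 1"
  shows "vec.dim (collin g S) = vec.dim S"
  unfolding collin_def
proof (rule vec.dim_image_eq[OF matrix_vector_mul_linear_gen])
  show "inj_on ((*v) g) (vec.span S)"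
    using matrix_left_invertible_injective[of g] assms by (blast intro: inj_on_subset)
qed

lemma collin_pg_points: "g' ** g = mat 1 \<Longrightarrow> P \<in> pg_points \<Longrightarrow> collin g P \<in> pg_points"
  and collin_pg_lines: "g' ** g = mat 1 \<Longrightarrow> P \<in> pg_lines \<Longrightarrow> collin g P \<in> pg_lines"
  for g :: "'a::field^'n^'n"
  by (auto simp: pg_points_def pg_lines_def collin_subspace dim_collin)

lemma collin_scalar_mult:
  fixes g :: "'a::field^'n^'n"
  assumes "vec.subspace S" "c \<noteq> 0"
  shows "collin (mat c ** g) S = collin g S"
proof -
  have sub: "collin (mat c) T \<subseteq> T" if "vec.subspace T" for c and T :: "('a^'n) set"
    using vec.subspace_scale[OF that] by (auto simp: collin_def mat_vector_mult)
  have T: "vec.subspace (collin g S)" by (rule collin_subspace[OF assms(1)])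
  have "collin g S = collin (mat c) (collin (mat (inverse c)) (collin g S))"
    unfolding collin_mult[of "mat c" "mat (inverse c)", symmetric] mat_mult_mat
    using assms(2) by (simp add: collin_one)
  also have "\<dots> \<subseteq> collin (mat c) (collin g S)" by (rule collin_mono[OF sub[OF T]])
  finally show ?thesis using sub[OF T, of c] by (simp add: collin_mult)
qed

lemma in_scalar_coset: "h \<in> scalars #>\<^bsub>GL\<^esub> g \<longleftrightarrow> (\<exists>c. c \<noteq> 0 \<and> h = mat c ** g)" for g :: "'a::field^'n^'n"
  by (auto simp: r_coset_def scalars_def)

lemma preserves_scalar_coset:
  fixes g :: "'a::field^'n^'n"
  assumes "\<And>S. S \<in> N \<Longrightarrow> vec.subspace S" "collin g ` N = N"
  shows "preserves (scalars #>\<^bsub>GL\<^esub> g) N"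
  unfolding preserves_def
proof
  fix h assume "h \<in> scalars #>\<^bsub>GL\<^esub> g"
  then obtain c where c: "c \<noteq> 0" "h = mat c ** g" by (auto simp: in_scalar_coset)
  have "collin h ` N = collin g ` N"
    unfolding c(2) by (rule image_cong[OF refl]) (rule collin_scalar_mult[OF assms(1) c(1)])
  then show "collin h ` N = N" using assms(2) by simp
qed

lemma collin_image_eqI:
  fixes g :: "'a::field^'n^'n"
  assumes "g ** g' = mat 1" "\<And>S. S \<in> N \<Longrightarrow> collin g S \<in> N" "\<And>S. S \<in> N \<Longrightarrow> collin g' S \<in> N"
  shows "collin g ` N = N"
proof
  show "N \<subseteq> collin g ` N"
  proof
    fix S assume "S \<in> N"
    then have "collin g (collin g' S) \<in> collin g ` N" using assms(3) by blast
    then show "S \<in> collin g ` N" using assms(1) by (simp add: collin_one flip: collin_mult)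
  qed
qed (use assms(2) in blast)

lemma scalar_coset_mult:
  fixes g h :: "'a::field^'n^'n"
  assumes "invertible g" "invertible h"
  shows "(scalars #>\<^bsub>GL\<^esub> g) \<otimes>\<^bsub>PGL\<^esub> (scalars #>\<^bsub>GL\<^esub> h) = scalars #>\<^bsub>GL\<^esub> (g ** h)"
  using normal.rcos_sum[OF scalars_normal_GL, of g h] assms by (simp add: PGL_def FactGroup_def)

lemma scalar_coset_carrier: "invertible g \<Longrightarrow> scalars #>\<^bsub>GL\<^esub> g \<in> carrier PGL" for g :: "'a::field^'n^'n"
  by (auto simp: PGL_def FactGroup_def RCOSETS_def)

lemma scalar_coset_eqD:
  fixes g h :: "'a::field^'n^'n"
  assumes "scalars #>\<^bsub>GL\<^esub> g = scalars #>\<^bsub>GL\<^esub> h"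
  obtains c where "c \<noteq> 0" "g = mat c ** h"
proof -
  have "g \<in> scalars #>\<^bsub>GL\<^esub> g" unfolding in_scalar_coset by (rule exI[of _ 1]) simp
  then show thesis using assms that by (auto simp: in_scalar_coset)
qed

section \<open>The group\<close>

text \<open>An arbitrary non-degenerate Hermitian form is reached from \<open>H0\<close> through the
  isometry \<open>Q\<close>. The root \<open>\<zeta>\<close> generates the cyclic factor, acting on
  the first coordinate, and \<open>\<iota>\<close> lets matrices over the separate type
  \<open>'k\<close> act on forms.\<close>

locale surface_group = hermitian_quads_choice p \<delta> \<kappa> \<kappa>' + field_embedding \<iota>
  for p :: nat and \<delta> :: "'f::{field,finite}" and \<kappa> \<kappa>' :: 'f
    and \<iota> :: "'k::{field,finite} \<Rightarrow> 'f" +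
  fixes \<zeta> :: 'f and H Q Q' :: "'f^4^4"
  assumes \<iota>_rational: "rational (\<iota> x)"
    and \<zeta>_torsion: "\<zeta> ^ m = 1" and \<zeta>_order: "j < m \<Longrightarrow> \<zeta> ^ j = 1 \<Longrightarrow> j = 0"
    and QQ': "Q ** Q' = mat 1" "Q' ** Q = mat 1"
    and isometry: "hform p H (Q *v z) (Q *v z') = hform p H0 z z'"
begin

abbreviation act :: "'k^2^2 \<Rightarrow> 'f quad \<Rightarrow> 'f quad" where
  "act A \<equiv> rho (\<iota> (A $ 1 $ 1)) (\<iota> (A $ 1 $ 2)) (\<iota> (A $ 2 $ 1)) (\<iota> (A $ 2 $ 2))"

lemma det_\<iota>: "\<iota> (A $ 1 $ 1) * \<iota> (A $ 2 $ 2) - \<iota> (A $ 1 $ 2) * \<iota> (A $ 2 $ 1) = \<iota> (det A)" for A :: "'k^2^2"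
  by (simp add: det_2 \<iota>_diff \<iota>_mult)

lemma act_act: "act A (act B u) = act (A ** B) u"
  by (simp add: rho_rho matrix_matrix_mult_def sum_2 \<iota>_add \<iota>_mult)

lemma act_one: "act (mat 1) u = u"
  by (simp add: mat_def \<iota>_0 \<iota>_1) (simp add: rho_scalar)

definition Dmat :: "'f \<Rightarrow> 'k^2^2 \<Rightarrow> 'f^4^4" where
  "Dmat l A = (\<chi> i j.
     if i = 1 then (if j = 1 then l else 0)
     else if j = 1 then 0
     else if j = 2 then V 0 (act A (1, 0, 0)) $ i
     else if j = 3 then V 0 (act A (0, 1, 0)) $ i
     else V 0 (act A (0, 0, 1)) $ i)"

lemma Dmat_V: "Dmat l A *v V x u = V (l * x) (act A u)"
  by (cases u) (simp add: vec_eq_iff forall_4 matrix_vector_mult_def sum_4 Dmat_def algebra_simps)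

lemma Dmat_eqI: "(\<And>x u. g *v V x u = h *v V x u) \<Longrightarrow> g = h"
  unfolding matrix_eq by (metis V_exhaust)

lemma Dmat_mult: "Dmat l A ** Dmat l' A' = Dmat (l * l') (A ** A')"
  by (rule Dmat_eqI) (simp only: matrix_vector_mul_assoc[symmetric] Dmat_V act_act mult.assoc)

lemma Dmat_one: "Dmat 1 (mat 1) = mat 1"
  by (rule Dmat_eqI) (simp add: Dmat_V act_one del: rho.simps)

definition elt :: "'f \<Rightarrow> 'k^2^2 \<Rightarrow> 'f^4^4" where
  "elt l A = Q ** Dmat l A ** Q'"

lemma elt_mult: "elt l A ** elt l' A' = elt (l * l') (A ** A')"
proof -
  have "elt l A ** elt l' A' = Q ** Dmat l A ** (Q' ** Q) ** Dmat l' A' ** Q'"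
    by (simp only: elt_def matrix_mul_assoc)
  also have "\<dots> = Q ** (Dmat l A ** Dmat l' A') ** Q'" by (simp add: QQ' matrix_mul_assoc)
  finally show ?thesis by (simp only: Dmat_mult elt_def)
qed

lemma elt_one: "elt 1 (mat 1) = mat 1"
  by (simp add: elt_def Dmat_one QQ')

lemma elt_inverse:
  assumes "l \<noteq> 0" "det A = 1"
  obtains A' where "det A' = 1" "A' ** A = mat 1" "A ** A' = mat 1"
    "elt l A ** elt (inverse l) A' = mat 1" "elt (inverse l) A' ** elt l A = mat 1"
proof -
  have "invertible A" using assms(2) by (simp add: invertible_det_nz)
  then obtain A' where A': "A ** A' = mat 1" "A' ** A = mat 1" by (auto simp: invertible_def)
  then have "det A * det A' = 1" by (metis det_I det_mul)
  then have "det A' = 1" using assms(2) by simp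
  then show thesis using that A' assms(1) by (simp add: elt_mult elt_one)
qed

lemma elt_invertible: "l \<noteq> 0 \<Longrightarrow> det A = 1 \<Longrightarrow> invertible (elt l A)"
  by (rule elt_inverse) (auto simp: invertible_def)

lemma torsion_nz: "l ^ m = 1 \<Longrightarrow> l \<noteq> 0" for l :: 'f
  using m_pos by (auto simp: power_0_left)

lemma torsion_norm: "l ^ m = 1 \<Longrightarrow> l * l ^ p = 1" for l :: 'f
  using power_m_squared[of l] by simp

lemma hform_Dmat:
  assumes "l ^ m = 1" "det A = 1"
  shows "hform p H0 (Dmat l A *v z) (Dmat l A *v z') = hform p H0 z z'"
proof -
  obtain x u where z: "z = V x u" by (rule V_exhaust)
  obtain y w where z': "z' = V y w" by (rule V_exhaust)
  have "bil (act A u) (fr (act A w)) = bil u (fr w)"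
    by (simp only: fr_rho[OF \<iota>_rational \<iota>_rational \<iota>_rational \<iota>_rational] bil_rho det_\<iota>) (simp add: assms(2) \<iota>_1)
  moreover have "(l * x) * (l * y) ^ p = (l * l ^ p) * (x * y ^ p)" by (simp add: mult_ac)
  ultimately show ?thesis
    unfolding z z' Dmat_V hform_V using torsion_norm[OF assms(1)] by simp
qed

lemma hform_elt:
  assumes "l ^ m = 1" "det A = 1"
  shows "hform p H (elt l A *v z) (elt l A *v z') = hform p H z z'"
proof -
  have e: "elt l A *v z = Q *v (Dmat l A *v (Q' *v z))" for z
    by (simp add: elt_def matrix_vector_mul_assoc matrix_mul_assoc)
  have q: "z = Q *v (Q' *v z)" for z by (simp add: matrix_vector_mul_assoc QQ')
  have "hform p H (elt l A *v z) (elt l A *v z') = hform p H0 (Q' *v z) (Q' *v z')"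
    unfolding e isometry hform_Dmat[OF assms] ..
  also have "\<dots> = hform p H (Q *v (Q' *v z)) (Q *v (Q' *v z'))" by (rule isometry[symmetric])
  finally show ?thesis by (simp flip: q)
qed

lemma herm_points_image:
  fixes H1 H2 g g' :: "'f^4^4"
  assumes "g' ** g = mat 1" "\<And>x y. hform p H2 (g *v x) (g *v y) = hform p H1 x y" "P \<in> herm_points p H1"
  shows "collin g P \<in> herm_points p H2"
  using assms collin_pg_points[OF assms(1), of P]
  by (auto simp: herm_points_def polar_def collin_def)

lemma herm_points_subspace: "P \<in> herm_points p H \<Longrightarrow> vec.subspace P"
  by (simp add: herm_points_def pg_points_def)

lemma elt_preserves_points:
  assumes l: "l ^ m = 1" "det A = 1"
  shows "preserves (scalars #>\<^bsub>GL\<^esub> elt l A) (herm_points p H)"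
proof (rule preserves_scalar_coset)
  obtain A' where A': "det A' = 1" "elt l A ** elt (inverse l) A' = mat 1" "elt (inverse l) A' ** elt l A = mat 1"
    by (rule elt_inverse[OF torsion_nz[OF l(1)] l(2)])
  have l': "inverse l ^ m = 1" using l(1) by (simp add: power_inverse)
  show "collin (elt l A) ` herm_points p H = herm_points p H"
    by (intro collin_image_eqI[OF A'(2)] herm_points_image[OF A'(3) hform_elt[OF l]]
        herm_points_image[OF A'(2) hform_elt[OF l' A'(1)]])
qed (rule herm_points_subspace)

definition hemi_H :: "('f^4) set set" where
  "hemi_H = collin Q ` hemi"

lemma collin_Dmat_gen: "l \<noteq> 0 \<Longrightarrow> collin (Dmat l A) (gen u w) = gen (act A u) (scal (inverse l) (act A w))"
proof -
  assume l: "l \<noteq> 0"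
  have ly: "l * y * inverse l = y" for y using l by simp
  have D: "Dmat l A *v V y (scal c u + scal y w) = V (l * y) (scal c (act A u) + scal (l * y) (scal (inverse l) (act A w)))" for c y
    unfolding Dmat_V by (simp only: rho_linear scal_simps ly)
  have "collin (Dmat l A) (gen u w) = {Dmat l A *v V y (scal c u + scal y w) | c y. True}"
    unfolding collin_def gen_def by blast
  also have "\<dots> = {V (l * y) (scal c (act A u) + scal (l * y) (scal (inverse l) (act A w))) | c y. True}"
    by (simp only: D)
  also have "\<dots> = gen (act A u) (scal (inverse l) (act A w))"
  proof -
    have "V y (scal c (act A u) + scal y (scal (inverse l) (act A w)))
      \<in> {V (l * y) (scal c (act A u) + scal (l * y) (scal (inverse l) (act A w))) | c y. True}" for c y
    proof -
      obtain k where k: "y = l * k" using l by (metis nonzero_mult_div_cancel_left times_divide_eq_right)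
      show ?thesis unfolding k by blast
    qed
    then show ?thesis unfolding gen_def by blast
  qed
  finally show ?thesis .
qed

lemma Dmat_hemi:
  assumes l: "l ^ m = 1" "det A = 1" and L: "L \<in> hemi"
  shows "collin (Dmat l A) L \<in> hemi"
proof -
  obtain u w where uw: "L = gen u w" "flag u w" "pos u w" using L unfolding hemi_def by blast
  have l': "inverse l ^ m = 1" using l(1) by (simp add: power_inverse)
  note r = \<iota>_rational[of "A $ 1 $ 1"] \<iota>_rational[of "A $ 1 $ 2"] \<iota>_rational[of "A $ 2 $ 1"] \<iota>_rational[of "A $ 2 $ 2"]
  have d: "\<iota> (A $ 1 $ 1) * \<iota> (A $ 2 $ 2) - \<iota> (A $ 1 $ 2) * \<iota> (A $ 2 $ 1) = 1"
    unfolding det_\<iota> l(2) by (rule \<iota>_1)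
  have "flag (act A u) (act A w)" using flag_rho[OF r _ uw(2)] d by (simp del: rho.simps)
  then have "flag (act A u) (scal (inverse l) (act A w))"
    by (rule flag_norm_one[OF torsion_norm[OF l']])
  moreover have "pos (act A u) (scal (inverse l) (act A w))"
    unfolding pos_torsion[OF l'] by (rule pos_rho_imp[OF r d uw(2,3)])
  ultimately show ?thesis unfolding uw(1) collin_Dmat_gen[OF torsion_nz[OF l(1)]] hemi_def by blast
qed

lemma elt_hemi:
  assumes l: "l ^ m = 1" "det A = 1" and L: "L \<in> hemi_H"
  shows "collin (elt l A) L \<in> hemi_H"
proof -
  obtain L0 where L0: "L = collin Q L0" "L0 \<in> hemi" using L unfolding hemi_H_def by blast
  have "collin (elt l A) L = collin Q (collin (Dmat l A) (collin (Q' ** Q) L0))"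
    by (simp add: L0(1) elt_def collin_mult)
  also have "\<dots> = collin Q (collin (Dmat l A) L0)" by (simp add: QQ' collin_one)
  finally show ?thesis using Dmat_hemi[OF l L0(2)] by (simp add: hemi_H_def)
qed

lemma hemi_H_subspace: "L \<in> hemi_H \<Longrightarrow> vec.subspace L"
  unfolding hemi_H_def hemi_def using collin_subspace gen_subspace by blast

lemma elt_preserves_hemi:
  assumes l: "l ^ m = 1" "det A = 1"
  shows "preserves (scalars #>\<^bsub>GL\<^esub> elt l A) hemi_H"
proof (rule preserves_scalar_coset)
  obtain A' where A': "det A' = 1" "elt l A ** elt (inverse l) A' = mat 1" "elt (inverse l) A' ** elt l A = mat 1"
    by (rule elt_inverse[OF torsion_nz[OF l(1)] l(2)])
  have l': "inverse l ^ m = 1" using l(1) by (simp add: power_inverse)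
  show "collin (elt l A) ` hemi_H = hemi_H"
    by (intro collin_image_eqI[OF A'(2)] elt_hemi l l' A'(1))
qed (rule hemi_H_subspace)

theorem hemisystem_H: "hemisystem p H hemi_H"
proof -
  have isometry': "hform p H0 (Q' *v x) (Q' *v y) = hform p H x y" for x y
    using isometry[of "Q' *v x" "Q' *v y"] by (simp add: matrix_vector_mul_assoc QQ')
  have cQ: "collin Q (collin Q' S) = S" "collin Q' (collin Q S) = S" for S
    by (simp_all add: QQ' collin_one flip: collin_mult)
  have inj: "inj (collin Q)" by (rule inj_on_inverseI[of _ "collin Q'"]) (rule cQ)
  note h0 = hemisystem_H0[unfolded hemisystem_def]
  have "hemi_H \<subseteq> generators p H"
  proof
    fix L assume "L \<in> hemi_H"
    then obtain L0 where L0: "L = collin Q L0" "L0 \<in> generators p H0" using h0 unfolding hemi_H_def by blast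
    have "P \<in> herm_points p H" if P: "P \<in> pg_points" "P \<subseteq> L" for P
    proof -
      have "collin Q' P \<subseteq> L0" using collin_mono[OF P(2), of Q'] by (simp add: L0(1) cQ)
      moreover have "collin Q' P \<in> pg_points" by (rule collin_pg_points[OF QQ'(1) P(1)])
      ultimately have "collin Q' P \<in> herm_points p H0" using L0(2) by (simp add: generators_def)
      then have "collin Q (collin Q' P) \<in> herm_points p H"
        by (rule herm_points_image[OF QQ'(2) isometry])
      then show ?thesis by (simp add: cQ)
    qed
    moreover have "L \<in> pg_lines" using L0 collin_pg_lines[OF QQ'(2), of L0] by (simp add: generators_def)
    ultimately show "L \<in> generators p H" by (simp add: generators_def)
  qed
  moreover have "card hemi_H = card hemi" unfolding hemi_H_def by (rule card_image[OF inj_on_subset[OF inj subset_UNIV]])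
  moreover have "card {L \<in> hemi_H. P \<subseteq> L} = (p + 1) div 2" if P: "P \<in> herm_points p H" for P
  proof -
    have P0: "collin Q' P \<in> herm_points p H0" by (rule herm_points_image[OF QQ'(1) isometry' P])
    have "P \<subseteq> collin Q L0 \<longleftrightarrow> collin Q' P \<subseteq> L0" for L0
      using collin_mono[of P "collin Q L0" Q'] collin_mono[of "collin Q' P" L0 Q] by (auto simp: cQ)
    then have "{L \<in> hemi_H. P \<subseteq> L} = collin Q ` {L0 \<in> hemi. collin Q' P \<subseteq> L0}"
      unfolding hemi_H_def by blast
    then have "card {L \<in> hemi_H. P \<subseteq> L} = card {L0 \<in> hemi. collin Q' P \<subseteq> L0}"
      using card_image[OF inj_on_subset[OF inj subset_UNIV]] by simp
    then show ?thesis using h0 P0 by simp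
  qed
  ultimately show ?thesis using h0 unfolding hemisystem_def by simp
qed

lemma det_mat_2: "det (mat c :: 'a::field^2^2) = c ^ 2"
  by (simp add: det_2 mat_def power2_eq_square)

lemma scalar_SL_iff: "mat c \<in> scalars \<inter> carrier (SL :: ('k^2^2) monoid) \<longleftrightarrow> c ^ 2 = 1"
  unfolding scalars_def SL_simps by (auto simp: det_mat_2)

lemma PSL_coset:
  assumes "C \<in> carrier (PSL :: ('k^2^2) set monoid)"
  obtains A where "det A = 1" "C = {mat e ** A | e. e ^ 2 = 1}"
proof -
  obtain A where A: "A \<in> carrier SL" "C = (scalars \<inter> carrier SL) #>\<^bsub>SL\<^esub> A"
    using assms by (auto simp: PSL_def FactGroup_def RCOSETS_def)
  have "C = {mat e ** A | e. e ^ 2 = 1}"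
  proof (intro equalityI subsetI)
    fix B assume "B \<in> C"
    then obtain S where S: "S \<in> scalars \<inter> carrier SL" "B = S ** A" by (auto simp: A(2) r_coset_def)
    then obtain e where e: "S = mat e" by (auto simp: scalars_def)
    then have "e ^ 2 = 1" using S(1) scalar_SL_iff by simp
    then show "B \<in> {mat e ** A | e. e ^ 2 = 1}" using S(2) e by blast
  next
    fix B assume "B \<in> {mat e ** A | e. e ^ 2 = 1}"
    then obtain e where "B = mat e ** A" "e ^ 2 = 1" by blast
    then show "B \<in> C" using scalar_SL_iff[of e] unfolding A(2) r_coset_def SL_simps by blast
  qed
  then show thesis using that A(1) by simp
qed

lemma PSL_member_det: "C \<in> carrier PSL \<Longrightarrow> A \<in> C \<Longrightarrow> det A = 1" for A :: "'k^2^2"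
proof -
  assume h: "C \<in> carrier PSL" "A \<in> C"
  obtain B where B: "det B = 1" "C = {mat e ** B | e. e ^ 2 = 1}" by (rule PSL_coset[OF h(1)])
  then obtain e where "A = mat e ** B" "e ^ 2 = 1" using h(2) by blast
  then show ?thesis using B(1) by (simp add: det_mul det_mat_2)
qed

lemma PSL_nonempty: "C \<in> carrier (PSL :: ('k^2^2) set monoid) \<Longrightarrow> \<exists>A. A \<in> C"
proof -
  assume "C \<in> carrier (PSL :: ('k^2^2) set monoid)"
  then obtain A where "C = {mat e ** A | e. e ^ 2 = 1}" by (rule PSL_coset)
  then have "mat 1 ** A \<in> C" by (metis (mono_tags, lifting) mem_Collect_eq power_one)
  then show ?thesis by blast
qed

lemma PSL_member_sign:
  assumes "C \<in> carrier (PSL :: ('k^2^2) set monoid)" "A \<in> C" "B \<in> C"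
  obtains e where "e ^ 2 = 1" "B = mat e ** A"
proof -
  obtain A0 where A0: "C = {mat e ** A0 | e. e ^ 2 = 1}" using PSL_coset[OF assms(1)] by blast
  then obtain e f where ef: "A = mat e ** A0" "e ^ 2 = 1" "B = mat f ** A0" "f ^ 2 = 1" using assms(2,3) by blast
  have "mat (f * e) ** A = mat (f * e * e) ** A0" by (simp add: ef(1) matrix_mul_assoc mat_mult_mat)
  also have "f * e * e = f" using ef(2) by (simp add: power2_eq_square mult.assoc)
  finally have "B = mat (f * e) ** A" using ef(3) by simp
  moreover have "(f * e) ^ 2 = 1" using ef by (simp add: power_mult_distrib)
  ultimately show thesis using that by blast
qed

lemma PSL_eqI:
  assumes C: "C \<in> carrier (PSL :: ('k^2^2) set monoid)" "D \<in> carrier PSL" and "A \<in> C" "mat e ** A \<in> D" "e ^ 2 = 1"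
  shows "C = D"
proof -
  obtain A0 where A0: "C = {mat e ** A0 | e. e ^ 2 = 1}" using PSL_coset[OF C(1)] by blast
  obtain B0 where B0: "D = {mat e ** B0 | e. e ^ 2 = 1}" using PSL_coset[OF C(2)] by blast
  have mm: "mat a ** (mat b ** Z) = mat (a * b) ** Z" for a b :: 'k and Z :: "'k^2^2"
    by (simp add: matrix_mul_assoc mat_mult_mat)
  obtain f where f: "f ^ 2 = 1" "A = mat f ** A0" using assms(3) A0 by blast
  obtain g where g: "g ^ 2 = 1" "mat e ** A = mat g ** B0" using assms(4) B0 by blast
  have sq: "x * x = 1" if "x ^ 2 = 1" for x :: 'k using that by (simp add: power2_eq_square)
  have "B0 = mat (g * g) ** B0" using sq[OF g(1)] by simp
  also have "\<dots> = mat (g * e * f) ** A0" by (simp only: mm[symmetric] g(2)[symmetric] f(2))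
  finally have "B0 = mat (g * e * f) ** A0" .
  moreover define t where "t = g * e * f"
  ultimately have B: "B0 = mat t ** A0" by simp
  have k: "t ^ 2 = 1" using f g assms(5) by (simp add: t_def power_mult_distrib)
  have A: "A0 = mat t ** B0" unfolding B mm using sq[OF k] by simp
  show ?thesis
  proof (intro equalityI subsetI)
    fix Z assume "Z \<in> C"
    then obtain a where "a ^ 2 = 1" "Z = mat a ** A0" using A0 by blast
    then have "Z = mat (a * t) ** B0" "(a * t) ^ 2 = 1"
      using k by (simp_all only: mm[symmetric] A[symmetric] power_mult_distrib[of a] mult_1)
    then show "Z \<in> D" unfolding B0 by blast
  next
    fix Z assume "Z \<in> D"
    then obtain a where "a ^ 2 = 1" "Z = mat a ** B0" using B0 by blast
    then have "Z = mat (a * t) ** A0" "(a * t) ^ 2 = 1"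
      using k by (simp_all only: mm[symmetric] B[symmetric] power_mult_distrib[of a] mult_1)
    then show "Z \<in> C" unfolding A0 by blast
  qed
qed

text \<open>\<open>rho\<close> is quadratic in the matrix entries and so loses the sign of the
  matrix; hence \<open>SL\<close> acts through \<open>PSL\<close>.\<close>

lemma elt_sign:
  assumes "e ^ 2 = 1" shows "elt l (mat e ** A) = elt l A"
proof -
  have "(\<iota> e) ^ 2 = 1" using assms by (metis \<iota>_1 \<iota>_mult power2_eq_square)
  then have "act (mat e ** A) u = act A u" for u
    unfolding act_act[symmetric] by (simp add: mat_def \<iota>_0 rho_scalar del: rho.simps)
  then have "Dmat l (mat e ** A) = Dmat l A" by (intro Dmat_eqI) (simp only: Dmat_V)
  then show ?thesis by (simp add: elt_def)
qed

definition \<Phi> :: "('k^2^2) set \<times> int \<Rightarrow> ('f^4^4) set" where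
  "\<Phi> = (\<lambda>(C, j). scalars #>\<^bsub>GL\<^esub> elt (\<zeta> ^ nat j) (SOME A. A \<in> C))"

lemma \<Phi>_eq:
  assumes "C \<in> carrier PSL" "A \<in> C" shows "\<Phi> (C, j) = scalars #>\<^bsub>GL\<^esub> elt (\<zeta> ^ nat j) A"
proof -
  have "(SOME A. A \<in> C) \<in> C" using assms(2) by (rule someI)
  then obtain e where "e ^ 2 = 1" "(SOME A. A \<in> C) = mat e ** A" by (rule PSL_member_sign[OF assms])
  then show ?thesis by (simp add: \<Phi>_def elt_sign)
qed

lemma \<zeta>_power_torsion: "(\<zeta> ^ j) ^ m = 1"
  by (metis \<zeta>_torsion mult.commute power_mult power_one)

lemma group_PGU: "group (PGU p H)"
proof -
  have "PGU p H = PGL\<lparr>carrier := carrier (PGU p H)\<rparr>" by (simp add: PGU_def)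
  then show ?thesis using group.subgroup_imp_group[OF group_PGL PGU_subgroup_PGL] by metis
qed

abbreviation \<G> :: "(('k^2^2) set \<times> int) monoid" where
  "\<G> \<equiv> PSL \<times>\<times> integer_mod_group ((p + 1) div 2)"

lemma \<G>_carrierD:
  assumes "x \<in> carrier \<G>"
  obtains C j A where "x = (C, j)" "C \<in> carrier PSL" "A \<in> C" "det A = 1" "0 \<le> j" "j < int m"
proof -
  obtain C j where x: "x = (C, j)" "C \<in> carrier PSL" "j \<in> carrier (integer_mod_group m)"
    using assms by (cases x) (auto simp: DirProd_def m_def)
  obtain A where A: "A \<in> C" using PSL_nonempty[OF x(2)] by blast
  show thesis
    using x(3) m_pos by (intro that[OF x(1,2) A PSL_member_det[OF x(2) A]]) (simp_all add: carrier_integer_mod_group)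
qed

lemma \<Phi>_carrier:
  assumes "x \<in> carrier \<G>" shows "\<Phi> x \<in> carrier (PGU p H)" "preserves (\<Phi> x) hemi_H"
proof -
  obtain C j A where x: "x = (C, j)" "C \<in> carrier PSL" "A \<in> C" "det A = 1"
    by (rule \<G>_carrierD[OF assms])
  note t = \<zeta>_power_torsion[of "nat j"]
  have e: "\<Phi> x = scalars #>\<^bsub>GL\<^esub> elt (\<zeta> ^ nat j) A" unfolding x(1) by (rule \<Phi>_eq[OF x(2,3)])
  show "\<Phi> x \<in> carrier (PGU p H)" unfolding e PGU_def
    using scalar_coset_carrier[OF elt_invertible[OF torsion_nz[OF t] x(4)]] elt_preserves_points[OF t x(4)] by simp
  show "preserves (\<Phi> x) hemi_H" unfolding e by (rule elt_preserves_hemi[OF t x(4)])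
qed

lemma \<Phi>_hom: "\<Phi> \<in> hom \<G> (PGU p H)"
proof (rule homI)
  fix x y assume "x \<in> carrier \<G>" "y \<in> carrier \<G>"
  obtain C j A where x: "x = (C, j)" "C \<in> carrier PSL" "A \<in> C" "det A = 1" "0 \<le> j" "j < int m"
    by (rule \<G>_carrierD[OF \<open>x \<in> carrier \<G>\<close>])
  obtain D k B where y: "y = (D, k)" "D \<in> carrier PSL" "B \<in> D" "det B = 1" "0 \<le> k" "k < int m"
    by (rule \<G>_carrierD[OF \<open>y \<in> carrier \<G>\<close>])
  have CD: "C \<otimes>\<^bsub>PSL\<^esub> D \<in> carrier PSL"
    by (rule monoid.m_closed[OF group.is_monoid[OF group_PSL] x(2) y(2)])
  have AB: "A ** B \<in> C \<otimes>\<^bsub>PSL\<^esub> D" using x(3) y(3) by (auto simp: PSL_def FactGroup_def set_mult_def)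
  have XY: "x \<otimes>\<^bsub>\<G>\<^esub> y = (C \<otimes>\<^bsub>PSL\<^esub> D, (j + k) mod int m)"
    by (simp add: x(1) y(1) DirProd_def m_def)
  have "nat ((j + k) mod int m) = (nat j + nat k) mod m"
    using x(5) y(5) by (simp add: nat_mod_distrib nat_add_distrib)
  moreover have "\<zeta> ^ (n mod m) = \<zeta> ^ n" for n
  proof -
    have "\<zeta> ^ n = \<zeta> ^ (m * (n div m) + n mod m)" by simp
    also have "\<dots> = \<zeta> ^ (n mod m)" unfolding power_add power_mult \<zeta>_torsion by simp
    finally show ?thesis by simp
  qed
  ultimately have z: "\<zeta> ^ nat ((j + k) mod int m) = \<zeta> ^ nat j * \<zeta> ^ nat k" by (simp add: power_add)
  have "\<Phi> (x \<otimes>\<^bsub>\<G>\<^esub> y) = scalars #>\<^bsub>GL\<^esub> (elt (\<zeta> ^ nat j) A ** elt (\<zeta> ^ nat k) B)"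
    unfolding XY \<Phi>_eq[OF CD AB] z elt_mult ..
  also have "\<dots> = (scalars #>\<^bsub>GL\<^esub> elt (\<zeta> ^ nat j) A) \<otimes>\<^bsub>PGL\<^esub> (scalars #>\<^bsub>GL\<^esub> elt (\<zeta> ^ nat k) B)"
    by (intro scalar_coset_mult[symmetric] elt_invertible torsion_nz \<zeta>_power_torsion x(4) y(4))
  also have "\<dots> = \<Phi> x \<otimes>\<^bsub>PGU p H\<^esub> \<Phi> y"
    unfolding x(1) y(1) \<Phi>_eq[OF x(2,3)] \<Phi>_eq[OF y(2,3)] by (simp add: PGU_def)
  finally show "\<Phi> (x \<otimes>\<^bsub>\<G>\<^esub> y) = \<Phi> x \<otimes>\<^bsub>PGU p H\<^esub> \<Phi> y" .
qed (rule \<Phi>_carrier)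

text \<open>The images of the two extreme basis forms show that \<open>A\<close> is diagonal, and
  the middle one gives \<open>c = det A = 1\<close>. So the scalar is the identity, and passing to
  \<open>PGL\<close> identifies no more than the signs already divided out in
  \<open>PSL\<close>.\<close>

lemma Dmat_scalar:
  assumes "Dmat l A = mat c" "det A = 1"
  shows "l = 1" "\<exists>e. e ^ 2 = 1 \<and> A = mat e"
proof -
  have V: "V (l * x) (act A u) = V (c * x) (scal c u)" for x u
    using arg_cong[OF assms(1), of "\<lambda>g. g *v V x u"] by (simp only: Dmat_V mat_vector_mult V_linear)
  let ?a = "A $ 1 $ 1" and ?b = "A $ 1 $ 2" and ?c = "A $ 2 $ 1" and ?d = "A $ 2 $ 2"
  have lc: "l = c" using V[of 1 0] by simp
  have 1: "act A (1, 0, 0) = scal c (1, 0, 0)" and 2: "act A (0, 1, 0) = scal c (0, 1, 0)"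
    and 3: "act A (0, 0, 1) = scal c (0, 0, 1)" using V by (simp_all only: V_eq_iff)
  have "\<iota> ?c = 0" "\<iota> ?b = 0" using 1 3 by simp_all
  then have c0: "?c = 0" and b0: "?b = 0" using \<iota>_0 \<iota>_eq_iff by metis+
  have d: "?a * ?d = 1" using assms(2) by (simp add: det_2 b0 c0)
  have "c = \<iota> (?a * ?d)" using 2 by (simp add: b0 c0 \<iota>_0 \<iota>_mult)
  then have "c = 1" by (simp only: d \<iota>_1)
  then show "l = 1" using lc by simp
  have "\<iota> (?a ^ 2) = \<iota> 1" using 1 \<open>c = 1\<close> by (simp add: power2_eq_square \<iota>_mult \<iota>_1)
  then have a: "?a ^ 2 = 1" by simp
  have "?d = ?a * (?a * ?d)" using a by (simp add: power2_eq_square flip: mult.assoc)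
  then have "?d = ?a" by (simp add: d)
  then have "A = mat ?a" by (simp add: vec_eq_iff forall_2 mat_def b0 c0)
  then show "\<exists>e. e ^ 2 = 1 \<and> A = mat e" using a by blast
qed

lemma \<Phi>_inj: "inj_on \<Phi> (carrier \<G>)"
proof (rule inj_onI)
  fix x y assume "x \<in> carrier \<G>" "y \<in> carrier \<G>" and eq: "\<Phi> x = \<Phi> y"
  obtain C j A where x: "x = (C, j)" "C \<in> carrier PSL" "A \<in> C" "det A = 1" "0 \<le> j" "j < int m"
    by (rule \<G>_carrierD[OF \<open>x \<in> carrier \<G>\<close>])
  obtain D k B where y: "y = (D, k)" "D \<in> carrier PSL" "B \<in> D" "det B = 1" "0 \<le> k" "k < int m"
    by (rule \<G>_carrierD[OF \<open>y \<in> carrier \<G>\<close>])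
  define l l' where "l = \<zeta> ^ nat j" and "l' = \<zeta> ^ nat k"
  have l: "l \<noteq> 0" "l' \<noteq> 0" unfolding l_def l'_def by (intro torsion_nz \<zeta>_power_torsion)+
  have "scalars #>\<^bsub>GL\<^esub> elt l A = scalars #>\<^bsub>GL\<^esub> elt l' B"
    using eq unfolding x(1) y(1) \<Phi>_eq[OF x(2,3)] \<Phi>_eq[OF y(2,3)] l_def l'_def .
  then obtain c where c: "c \<noteq> 0" "elt l A = mat c ** elt l' B" by (rule scalar_coset_eqD)
  obtain B' where B': "det B' = 1" "B' ** B = mat 1" "B ** B' = mat 1" "elt l' B ** elt (inverse l') B' = mat 1"
    by (rule elt_inverse[OF l(2) y(4)])
  have "elt (l * inverse l') (A ** B') = mat c ** (elt l' B ** elt (inverse l') B')"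
    unfolding elt_mult[symmetric] c(2) by (simp only: matrix_mul_assoc)
  then have e: "elt (l * inverse l') (A ** B') = mat c" by (simp add: B')
  have "Dmat (l * inverse l') (A ** B') = (Q' ** Q) ** Dmat (l * inverse l') (A ** B') ** (Q' ** Q)" by (simp add: QQ')
  also have "\<dots> = Q' ** elt (l * inverse l') (A ** B') ** Q" by (simp only: elt_def matrix_mul_assoc)
  also have "\<dots> = mat c ** (Q' ** Q)" by (simp only: e mat_commute[symmetric] matrix_mul_assoc)
  finally have "Dmat (l * inverse l') (A ** B') = mat c" by (simp add: QQ')
  moreover have "det (A ** B') = 1" by (simp add: det_mul x(4) B'(1))
  ultimately have li: "l * inverse l' = 1" and "\<exists>e. e ^ 2 = 1 \<and> A ** B' = mat e"
    using Dmat_scalar by blast+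
  then obtain e where e: "e ^ 2 = 1" "A ** B' = mat e" by blast
  have "A = A ** (B' ** B)" by (simp add: B')
  also have "\<dots> = mat e ** B" by (simp only: matrix_mul_assoc e(2))
  finally have "mat e ** B \<in> C" using x(3) by simp
  then have "D = C" by (rule PSL_eqI[OF y(2) x(2) y(3) _ e(1)])
  moreover have "j = k"
  proof -
    have ll: "\<zeta> ^ nat j = \<zeta> ^ nat k" using li l by (simp add: l_def l'_def field_simps)
    have aux: "a = b" if "\<zeta> ^ a = \<zeta> ^ b" "a \<le> b" "b < m" for a b
    proof -
      have "\<zeta> ^ b = \<zeta> ^ a * \<zeta> ^ (b - a)" using that(2) by (simp flip: power_add)
      moreover have "\<zeta> ^ a \<noteq> 0" by (intro torsion_nz \<zeta>_power_torsion)
      ultimately have "\<zeta> ^ (b - a) = 1" using that(1) by (metis mult_cancel_left2)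
      then have "b - a = 0" using \<zeta>_order[of "b - a"] that(3) by simp
      then show ?thesis using that(2) by simp
    qed
    have "nat j < m" "nat k < m" using x(5,6) y(5,6) by linarith+
    then have "nat j = nat k" using aux[of "nat j" "nat k"] aux[of "nat k" "nat j"] ll by (metis nat_le_linear)
    then show ?thesis using x(5) y(5) by simp
  qed
  ultimately show "x = y" by (simp add: x(1) y(1))
qed

theorem surface_group_exists:
  "\<exists>M K. hemisystem p H M \<and> subgroup K (PGU p H) \<and> (\<forall>C\<in>K. preserves C M) \<and>
     (PGU p H)\<lparr>carrier := K\<rparr> \<cong> \<G>"
proof (intro exI conjI)
  have G: "group \<G>" by (rule DirProd_group[OF group_PSL group_integer_mod_group])
  interpret group_hom \<G> "PGU p H" \<Phi>
    by (intro group_hom.intro group_hom_axioms.intro G group_PGU \<Phi>_hom)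
  show "hemisystem p H hemi_H" by (rule hemisystem_H)
  show "subgroup (\<Phi> ` carrier \<G>) (PGU p H)" by (rule img_is_subgroup)
  show "\<forall>C\<in>\<Phi> ` carrier \<G>. preserves C hemi_H" using \<Phi>_carrier(2) by blast
  have "\<Phi> \<in> hom \<G> ((PGU p H)\<lparr>carrier := \<Phi> ` carrier \<G>\<rparr>)"
    using \<Phi>_hom by (auto simp: hom_def)
  then have "\<Phi> \<in> iso \<G> ((PGU p H)\<lparr>carrier := \<Phi> ` carrier \<G>\<rparr>)"
    using \<Phi>_inj by (simp add: iso_def bij_betw_def)
  then have "\<G> \<cong> (PGU p H)\<lparr>carrier := \<Phi> ` carrier \<G>\<rparr>" by (rule is_isoI)
  then show "(PGU p H)\<lparr>carrier := \<Phi> ` carrier \<G>\<rparr> \<cong> \<G>" by (rule group.iso_sym[OF G])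
qed

end

section \<open>Orthonormal bases\<close>

context quadratic_extension
begin

lemma hform_zero [simp]: "hform p H 0 y = 0" "hform p H x 0 = 0" for x :: "'f^'n"
  by (simp_all add: hform_def)

lemma hform_sum:
  fixes b :: "'i \<Rightarrow> 'f^'n"
  shows "hform p H (\<Sum>i\<in>A. f i *s b i) y = (\<Sum>i\<in>A. f i * hform p H (b i) y)"
    "hform p H y (\<Sum>i\<in>A. f i *s b i) = (\<Sum>i\<in>A. f i ^ p * hform p H y (b i))"
  by (induction A rule: infinite_finite_induct) simp_all

lemma hform_conj:
  fixes H :: "'f^'n^'n"
  assumes "nondeg_hermitian p H"
  shows "hform p H x y = (hform p H y x) ^ p"
proof -
  have H: "(H $ i $ j) ^ p = H $ j $ i" for i j using assms by (simp add: nondeg_hermitian_def)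
  have "(hform p H y x) ^ p = (\<Sum>i\<in>UNIV. \<Sum>j\<in>UNIV. (y $ i) ^ p * H $ j $ i * x $ j)"
    by (simp add: hform_def frob_sum H)
  also have "\<dots> = hform p H x y"
    unfolding hform_def by (subst sum.swap) (simp add: mult_ac)
  finally show ?thesis by simp
qed

lemma hform_nondegenerate:
  fixes H :: "'f^'n^'n"
  assumes "nondeg_hermitian p H" "\<And>y. hform p H x y = 0"
  shows "x = 0"
proof -
  have inv: "invertible (transpose H)"
    using assms(1) by (simp add: nondeg_hermitian_def invertible_det_nz)
  have "transpose H *v x = 0"
  proof -
    have "(\<Sum>i\<in>UNIV. H $ i $ j * x $ i) = hform p H x (axis j 1)" for j
    proof -
      have "x $ i * H $ i $ k * (axis j 1 $ k) ^ p = (if k = j then H $ i $ j * x $ i else 0)" for i k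
        by (simp add: axis_def mult.commute)
      then show ?thesis by (simp add: hform_def)
    qed
    then show ?thesis using assms(2) by (simp add: vec_eq_iff matrix_vector_mult_def transpose_def)
  qed
  then show ?thesis
    using inv by (metis invertible_def matrix_vector_mul_assoc matrix_vector_mul_lid matrix_vector_mult_0_right)
qed

text \<open>Take an orthonormal set of maximal size. If it did not span, its orthogonal complement
  \<open>W\<close> would contain some \<open>x'\<close> other than 0. If all \<open>?h z z\<close>
  vanished on \<open>W\<close>, the form would vanish on \<open>W\<close> by polarisation and
  \<open>x'\<close> would lie in the radical. So some \<open>?h z z\<close> is nonzero, and
  surjectivity of the norm scales \<open>z\<close> to a further unit vector.\<close>

lemma orthonormal_basis:
  fixes H :: "'f^'n^'n"
  assumes sym: "\<And>x y. hform p H x y = (hform p H y x) ^ p"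
    and nondeg: "\<And>x. (\<And>y. hform p H x y = 0) \<Longrightarrow> x = 0"
  shows "\<exists>b :: 'n \<Rightarrow> 'f^'n. \<forall>i j. hform p H (b i) (b j) = (if i = j then 1 else 0)"
proof -
  let ?h = "hform p H"
  define ortho where "ortho S \<longleftrightarrow> (\<forall>x\<in>S. \<forall>y\<in>S. ?h x y = (if x = y then 1 else 0))" for S
  have indep: "vec.independent S" if "ortho S" for S
  proof
    assume "vec.dependent S"
    then obtain U c where U: "U \<subseteq> S" "(\<Sum>s\<in>U. c s *s s) = 0" "\<exists>s\<in>U. c s \<noteq> 0"
      unfolding vec.dependent_explicit by blast
    then obtain t where t: "t \<in> U" "c t \<noteq> 0" by blast
    have "0 = ?h (\<Sum>s\<in>U. c s *s s) t" by (simp add: U(2))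
    also have "\<dots> = (\<Sum>s\<in>U. if s = t then c s else 0)"
      unfolding hform_sum(1)
    proof (rule sum.cong[OF refl])
      fix s assume "s \<in> U"
      then have "?h s t = (if s = t then 1 else 0)" using that U(1) t(1) unfolding ortho_def by blast
      then show "c s * ?h s t = (if s = t then c s else 0)" by simp
    qed
    also have "\<dots> = c t" using t(1) by simp
    finally show False using t(2) by simp
  qed
  have "\<exists>S. ortho S \<and> (\<forall>T. ortho T \<longrightarrow> card T \<le> card S)"
  proof (rule ex_has_greatest_nat)
    show "ortho {}" by (simp add: ortho_def)
    show "\<forall>S. ortho S \<longrightarrow> card S < Suc (card (UNIV :: ('f^'n) set))"
      unfolding less_Suc_eq_le using card_mono[OF finite subset_UNIV] by blast
  qed
  then obtain S where S: "ortho S" "\<And>T. ortho T \<Longrightarrow> card T \<le> card S" by blast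
  have proj: "?h (x - (\<Sum>s\<in>S. ?h x s *s s)) t = 0" if "t \<in> S" for x t
  proof -
    have "?h (\<Sum>s\<in>S. ?h x s *s s) t = (\<Sum>s\<in>S. if s = t then ?h x s else 0)"
      unfolding hform_sum(1) by (rule sum.cong) (use S(1) that in \<open>auto simp: ortho_def\<close>)
    also have "\<dots> = ?h x t" using that by simp
    finally show ?thesis by simp
  qed
  have "vec.span S = UNIV"
  proof (rule ccontr)
    assume "vec.span S \<noteq> UNIV"
    then obtain x where x: "x \<notin> vec.span S" by blast
    define W where "W = {z. \<forall>s\<in>S. ?h z s = 0}"
    define x' where "x' = x - (\<Sum>s\<in>S. ?h x s *s s)"
    have x'W: "x' \<in> W" using proj unfolding W_def x'_def by blast
    have x'0: "x' \<noteq> 0"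
    proof
      assume "x' = 0"
      then have "x = (\<Sum>s\<in>S. ?h x s *s s)" by (simp add: x'_def)
      moreover have "(\<Sum>s\<in>S. ?h x s *s s) \<in> vec.span S"
        by (intro vec.span_sum vec.span_scale vec.span_base)
      ultimately show False using x by simp
    qed
    have "\<exists>z\<in>W. ?h z z \<noteq> 0"
    proof (rule ccontr)
      assume n: "\<not> ?thesis"
      have W0: "?h z w = 0" if z: "z \<in> W" "w \<in> W" for z w
      proof (rule ccontr)
        assume t: "?h z w \<noteq> 0"
        \<comment> \<open>With this factor both mixed terms of the form at \<open>z + c *s w\<close>
          equal 1, and their sum 2 is nonzero.\<close>
        define c where "c = (1 / ?h z w) ^ p"
        have "z + c *s w \<in> W" using z by (simp add: W_def)
        then have "?h (z + c *s w) (z + c *s w) = 0" using n by blast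
        moreover have "?h z z = 0" "?h w w = 0" using n z by blast+
        ultimately have "c ^ p * ?h z w + c * ?h w z = 0" by (simp add: add.commute)
        moreover have "c ^ p = 1 / ?h z w" unfolding c_def by (rule frob_frob)
        then have "c ^ p * ?h z w = 1" using t by simp
        moreover have "c * ?h w z = (1 / ?h z w * ?h z w) ^ p"
          unfolding c_def sym[of w z] by (simp only: frob_mult)
        then have "c * ?h w z = 1" using t by simp
        ultimately show False by simp
      qed
      have "x' = 0"
      proof (rule nondeg)
        fix y
        have "y - (\<Sum>s\<in>S. ?h y s *s s) \<in> W" using proj unfolding W_def by blast
        then have "?h x' (y - (\<Sum>s\<in>S. ?h y s *s s)) = 0" by (rule W0[OF x'W])
        moreover have "?h x' (\<Sum>s\<in>S. ?h y s *s s) = 0"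
          unfolding hform_sum(2) using x'W by (simp add: W_def)
        ultimately show "?h x' y = 0" by simp
      qed
      then show False using x'0 by simp
    qed
    then obtain z where z: "z \<in> W" "?h z z \<noteq> 0" by blast
    have "?h z z ^ p = ?h z z" by (rule sym[symmetric])
    then have r: "rational (1 / ?h z z)" by simp
    obtain k where k: "k * k ^ p = 1 / ?h z z"
      by (rule norm_exists[OF r]) (use z in auto)
    define w where "w = k *s z"
    have "?h w w = (k * k ^ p) * ?h z z" by (simp add: w_def)
    then have ww: "?h w w = 1" unfolding k using z(2) by simp
    have wS: "?h w s = 0" "?h s w = 0" if "s \<in> S" for s
    proof -
      show "?h w s = 0" using z(1) that by (simp add: W_def w_def)
      then show "?h s w = 0" unfolding sym[of s w] by simp
    qed
    have "w \<notin> S" using wS(1)[of w] ww by auto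
    have "ortho (insert w S)" using S(1) ww wS \<open>w \<notin> S\<close> by (auto simp: ortho_def)
    then have "card (insert w S) \<le> card S" by (rule S(2))
    then show False using \<open>w \<notin> S\<close> by simp
  qed
  then have "vec.dim (UNIV :: ('f^'n) set) = card S"
    by (intro vec.dim_eq_card) (simp_all add: indep[OF S(1)])
  then have "card (UNIV :: 'n set) = card S" by (simp only: vec_dim_card)
  then obtain b where b: "bij_betw b (UNIV :: 'n set) S"
    using finite_same_card_bij[of "UNIV :: 'n set" S] by auto
  have "?h (b i) (b j) = (if i = j then 1 else 0)" for i j
  proof -
    have "b i \<in> S" "b j \<in> S" using b by (auto simp: bij_betw_def)
    moreover have "b i = b j \<longleftrightarrow> i = j" using b by (auto simp: bij_betw_def inj_def)
    ultimately show ?thesis using S(1) unfolding ortho_def by simp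
  qed
  then show ?thesis by blast
qed

lemma orthonormal_matrix:
  fixes H :: "'f^'n^'n"
  assumes sym: "\<And>x y. hform p H x y = (hform p H y x) ^ p"
    and nondeg: "\<And>x. (\<And>y. hform p H x y = 0) \<Longrightarrow> x = 0"
  shows "\<exists>Q Q' :: 'f^'n^'n. Q ** Q' = mat 1 \<and> Q' ** Q = mat 1 \<and>
    (\<forall>x y. hform p H (Q *v x) (Q *v y) = (\<Sum>i\<in>UNIV. x $ i * (y $ i) ^ p))"
proof -
  obtain b :: "'n \<Rightarrow> 'f^'n" where b: "\<And>i j. hform p H (b i) (b j) = (if i = j then 1 else 0)"
    using orthonormal_basis[OF sym nondeg] by auto
  define Q where "Q = (\<chi> i j. b j $ i)"
  have Q: "Q *v x = (\<Sum>i\<in>UNIV. x $ i *s b i)" for x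
    by (simp add: vec_eq_iff matrix_vector_mult_def Q_def mult.commute)
  have form: "hform p H (Q *v x) (Q *v y) = (\<Sum>i\<in>UNIV. x $ i * (y $ i) ^ p)" for x y
  proof -
    have "(\<Sum>i\<in>UNIV. (y $ i) ^ p * hform p H (b j) (b i)) = (y $ j) ^ p" for j
    proof -
      have "(\<Sum>i\<in>UNIV. (y $ i) ^ p * hform p H (b j) (b i)) = (\<Sum>i\<in>UNIV. if i = j then (y $ j) ^ p else 0)"
        by (rule sum.cong) (auto simp: b)
      then show ?thesis by simp
    qed
    then show ?thesis unfolding Q unfolding hform_sum(1) unfolding hform_sum(2) by simp
  qed
  have "x = 0" if "Q *v x = 0" for x
  proof -
    have "x $ j = 0" for j
    proof -
      have "x $ j = (\<Sum>i\<in>UNIV. if i = j then x $ j else 0)" by simp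
      also have "\<dots> = (\<Sum>i\<in>UNIV. x $ i * hform p H (b i) (b j))" by (rule sum.cong) (auto simp: b)
      also have "\<dots> = hform p H (Q *v x) (b j)" unfolding Q hform_sum ..
      also have "\<dots> = 0" by (simp add: that)
      finally show ?thesis .
    qed
    then show ?thesis by (simp add: vec_eq_iff)
  qed
  then obtain Q' where Q': "Q' ** Q = mat 1" using matrix_left_invertible_ker[of Q] by auto
  then have "Q ** Q' = mat 1" by (simp add: matrix_left_right_inverse)
  then show ?thesis using Q' form by blast
qed

end

lemma (in hermitian_quads_choice) isometry_exists:
  fixes H :: "'f^4^4"
  assumes "nondeg_hermitian p H"
  obtains Q Q' where "Q ** Q' = mat 1" "Q' ** Q = mat 1" "\<And>x y. hform p H (Q *v x) (Q *v y) = hform p H0 x y"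
proof -
  obtain P P' :: "'f^4^4" where P: "P ** P' = mat 1" "P' ** P = mat 1"
    "\<And>x y. hform p H (P *v x) (P *v y) = (\<Sum>i\<in>UNIV. x $ i * (y $ i) ^ p)"
    using orthonormal_matrix[OF hform_conj[OF assms] hform_nondegenerate[OF assms]] by auto
  have sym0: "hform p H0 x y = (hform p H0 y x) ^ p" for x y
  proof -
    obtain s u where x: "x = V s u" by (rule V_exhaust)
    obtain t w where y: "y = V t w" by (rule V_exhaust)
    show ?thesis unfolding x y hform_V using bil_conj[of u w] by (simp add: mult.commute)
  qed
  have nondeg0: "x = 0" if h: "\<And>y. hform p H0 x y = 0" for x
  proof -
    obtain s u where x: "x = V s u" by (rule V_exhaust)
    obtain u0 u1 u2 where u: "u = (u0, u1, u2)" by (cases u)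
    have "s = 0" using h[of "V 1 (0, 0, 0)"] by (simp add: x hform_V u)
    moreover have "u0 = 0" using h[of "V 0 (0, 0, 1)"] by (simp add: x hform_V u)
    moreover have "u1 = 0" using h[of "V 0 (0, 1, 0)"] by (simp add: x hform_V u)
    moreover have "u2 = 0" using h[of "V 0 (1, 0, 0)"] by (simp add: x hform_V u)
    ultimately show ?thesis by (simp add: x u zero_prod_def)
  qed
  obtain R R' :: "'f^4^4" where R: "R ** R' = mat 1" "R' ** R = mat 1"
    "\<And>x y. hform p H0 (R *v x) (R *v y) = (\<Sum>i\<in>UNIV. x $ i * (y $ i) ^ p)"
    using orthonormal_matrix[OF sym0 nondeg0] by auto
  show thesis
  proof (rule that)
    have "P ** R' ** (R ** P') = P ** (R' ** R) ** P'" by (simp only: matrix_mul_assoc)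
    then show "P ** R' ** (R ** P') = mat 1" by (simp add: P R)
    have "R ** P' ** (P ** R') = R ** (P' ** P) ** R'" by (simp only: matrix_mul_assoc)
    then show "R ** P' ** (P ** R') = mat 1" by (simp add: P R)
    fix x y
    have "hform p H (P ** R' *v x) (P ** R' *v y) = hform p H (P *v (R' *v x)) (P *v (R' *v y))"
      by (simp add: matrix_vector_mul_assoc)
    also have "\<dots> = hform p H0 (R *v (R' *v x)) (R *v (R' *v y))" by (simp only: P(3) R(3))
    also have "\<dots> = hform p H0 x y" by (simp add: matrix_vector_mul_assoc R)
    finally show "hform p H (P ** R' *v x) (P ** R' *v y) = hform p H0 x y" .
  qed
qed

section \<open>Roots of unity\<close>

lemma ring_of_type_algebra_pow: "g [^]\<^bsub>(ring_of_type_algebra :: 'a::{field,finite} ring)\<^esub> (i::nat) = g ^ i"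
proof (induction i)
  case (Suc i)
  have "g [^]\<^bsub>(ring_of_type_algebra :: 'a ring)\<^esub> Suc i
      = g [^]\<^bsub>(ring_of_type_algebra :: 'a ring)\<^esub> i * g"
    by (simp add: nat_pow_def ring_of_type_algebra_def)
  then show ?case by (simp only: Suc power_Suc2)
qed (simp add: nat_pow_def ring_of_type_algebra_def)

lemma primitive_element:
  "\<exists>g :: 'a::{field,finite}. g \<noteq> 0 \<and> (\<forall>j < CARD('a) - 1. g ^ j = 1 \<longrightarrow> j = 0)"
proof -
  let ?R = "ring_of_type_algebra :: 'a ring"
  have carrier: "carrier (Multiplicative_Group.mult_of ?R) = -{0}" by (auto simp: ring_of_type_algebra_def)
  have "\<exists>g\<in>carrier (Multiplicative_Group.mult_of ?R). carrier (Multiplicative_Group.mult_of ?R) = {g [^]\<^bsub>?R\<^esub> i | i::nat. i \<in> UNIV}"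
    by (rule field.finite_field_mult_group_has_gen[OF field_from_type_algebra]) simp
  then have "\<exists>g\<in>-{0::'a}. -{0} = {g ^ i | i::nat. i \<in> UNIV}"
    unfolding ring_of_type_algebra_pow carrier .
  then obtain g :: 'a where g': "g \<in> -{0}" and g: "-{0} = {g ^ i | i::nat. i \<in> UNIV}" ..
  from g' have g0: "g \<noteq> 0" by simp
  define N where "N = CARD('a) - 1"
  have N: "N > 0"
  proof -
    have "card {0, 1::'a} \<le> CARD('a)" by (rule card_mono) simp_all
    then show ?thesis by (simp add: N_def)
  qed
  have gN: "g ^ N = 1" using power_CARD_minus_1[OF g0] by (simp add: N_def)
  have "-{0} \<subseteq> (\<lambda>i. g ^ i) ` {..<N}"
  proof
    fix x :: 'a assume "x \<in> -{0}"
    then obtain i :: nat where "x = g ^ i" unfolding g by blast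
    also have "g ^ i = g ^ (N * (i div N) + i mod N)" by simp
    also have "\<dots> = g ^ (i mod N)" unfolding power_add power_mult gN by simp
    finally have x: "x = g ^ (i mod N)" .
    show "x \<in> (\<lambda>i. g ^ i) ` {..<N}" unfolding x by (rule imageI) (simp add: N)
  qed
  then have "card (-{0::'a}) \<le> card ((\<lambda>i. g ^ i) ` {..<N})" by (rule card_mono[rotated]) simp
  moreover have "card (-{0::'a}) = N" by (simp add: Compl_eq_Diff_UNIV card_Diff_singleton N_def)
  ultimately have "card ((\<lambda>i. g ^ i) ` {..<N}) = card {..<N}"
    using card_image_le[of "{..<N}" "\<lambda>i. g ^ i"] by simp
  then have inj: "inj_on (\<lambda>i. g ^ i) {..<N}"
    by (rule eq_card_imp_inj_on[OF finite_lessThan])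
  have "j = 0" if "j < N" "g ^ j = 1" for j
    by (rule inj_onD[OF inj]) (use that N in simp_all)
  then show ?thesis using g0 unfolding N_def by blast
qed

lemma (in quadratic_extension) primitive_torsion:
  obtains \<zeta> :: 'f where "\<zeta> ^ m = 1" "\<And>j. j < m \<Longrightarrow> \<zeta> ^ j = 1 \<Longrightarrow> j = 0"
proof -
  obtain g :: 'f where g: "g \<noteq> 0" "\<And>j. j < CARD('f) - 1 \<Longrightarrow> g ^ j = 1 \<Longrightarrow> j = 0"
    using primitive_element[where 'a='f] by auto
  have N: "CARD('f) - 1 = 2 * (p - 1) * m" using card_minus_1 two_m by (simp add: algebra_simps)
  show thesis
  proof (rule that)
    show "(g ^ (2 * (p - 1))) ^ m = 1" using power_CARD_minus_1[OF g(1)] by (simp only: N power_mult)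
    fix j assume j: "j < m" "(g ^ (2 * (p - 1))) ^ j = 1"
    then have "2 * (p - 1) * j < CARD('f) - 1" unfolding N using p_gt by simp
    moreover have "g ^ (2 * (p - 1) * j) = 1" using j(2) by (simp only: power_mult)
    ultimately have "2 * (p - 1) * j = 0" by (rule g(2))
    then show "j = 0" using p_gt by simp
  qed
qed

section \<open>Main theorem\<close>

text \<open>By the Jacobsthal sum, the real points on a line through a point of the conic contribute
  \<open>\<plusminus>1\<close>, which is compensated by the choice of the sign \<open>\<kappa>'\<close> for the conic.\<close>

lemma (in hermitian_quads) quartic_difference:
  fixes \<iota> :: "'k::{field,finite} \<Rightarrow> 'f" and d :: 'k and a :: int
  assumes card_k: "CARD('k) = p" and a: "int p = 1 + 16 * a ^ 2"
    and \<iota>: "field_embedding \<iota>" and \<delta>2: "\<delta> ^ 2 = \<iota> d"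
  shows "int (card quartic_pos) - int (card quartic_neg) \<in> {1, -1}"
proof -
  interpret field_embedding \<iota> by (rule \<iota>)
  interpret J: odd_field p "TYPE('k)" by unfold_locales (use card_k p_mod_4 two_nz_of_CARD_prime[OF prime_p card_k] p_gt in auto)
  have rat: "rational (\<iota> x)" for x using power_CARD_eq[of x] card_k by (simp flip: \<iota>_power)
  have range: "range \<iota> = {y. rational y}"
  proof (rule card_subset_eq)
    show "card (range \<iota>) = card {y::'f. rational y}" using card_image[OF \<iota>_inj] card_k card_rational by simp
  qed (use rat in auto)
  let ?n = "(p - 1) div 4"
  have quarter: "quarter = (p + 1) * ?n"
  proof -
    obtain k where k: "p = 4 * k + 1" using p_mod_4 by (metis mod_mult_div_eq add.commute)
    have "p ^ 2 - 1 = 4 * ((p + 1) * k)" by (simp add: k power2_eq_square algebra_simps)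
    then have "quarter = (p + 1) * k" by (simp add: quarter_def)
    moreover have "?n = k" by (simp add: k)
    ultimately show ?thesis by simp
  qed
  \<comment> \<open>The exponent is the norm exponent \<open>p + 1\<close> times
    \<open>(p - 1) / 4\<close>, and the norm of \<open>\<delta> * (\<iota> x - \<delta>)\<close> is
    \<open>d * (d - x ^ 2)\<close>. So the condition becomes one on fourth powers in the prime
    field, as counted by \<open>quartic_count\<close>.\<close>
  have quart: "(\<delta> * (\<iota> x - \<delta>)) ^ quarter = \<iota> ((d * (d - x ^ 2)) ^ ?n)" for x
  proof -
    have "(\<delta> * (\<iota> x - \<delta>)) ^ (p + 1) = \<delta> ^ 2 * (\<delta> ^ 2 - \<iota> x ^ 2)"
      unfolding power_p_plus_1 by (simp add: \<delta>_conj rat) (simp add: power2_eq_square algebra_simps)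
    also have "\<dots> = \<iota> (d * (d - x ^ 2))" by (simp add: \<delta>2 \<iota>_mult \<iota>_diff \<iota>_power)
    finally show ?thesis by (simp only: quarter power_mult \<iota>_power)
  qed
  have "d \<noteq> 0" using \<delta>2 \<delta>_nz \<iota>_0 by auto
  have chi: "J.chi d = -1"
  proof (rule ccontr)
    assume "J.chi d \<noteq> -1"
    then have "J.chi d = 1" using J.chi_cases[OF \<open>d \<noteq> 0\<close>] by blast
    then have "card {y. y ^ 2 = d} \<noteq> 0" using J.card_sqrt[of d] by simp
    then obtain y where "y ^ 2 = d" by (metis (mono_tags, lifting) card.empty empty_Collect_eq)
    then have "\<delta> ^ 2 = (\<iota> y) ^ 2" by (simp add: \<delta>2 flip: \<iota>_power)
    then have "\<delta> = \<iota> y \<or> \<delta> = - \<iota> y" by (simp add: power2_eq_iff)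
    then have "rational \<delta>" using rat by auto
    then show False using \<delta>_conj \<delta>_nz by (metis add.right_inverse mult_2 mult_eq_0_iff two_nz)
  qed
  have img: "{y. rational y \<and> (\<delta> * (y - \<delta>)) ^ quarter = \<iota> c} = \<iota> ` {x. (d * (d - x ^ 2)) ^ ?n = c}" for c
  proof (intro equalityI subsetI)
    fix y assume y: "y \<in> {y. rational y \<and> (\<delta> * (y - \<delta>)) ^ quarter = \<iota> c}"
    then obtain x where "y = \<iota> x" using range by blast
    then show "y \<in> \<iota> ` {x. (d * (d - x ^ 2)) ^ ?n = c}" using y quart by auto
  qed (use rat quart in auto)
  have "quartic_pos = \<iota> ` {x. (d * (d - x ^ 2)) ^ ?n = 1}" "quartic_neg = \<iota> ` {x. (d * (d - x ^ 2)) ^ ?n = -1}"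
    using img[of 1] img[of "-1"] by (simp_all add: quartic_pos_def quartic_neg_def \<iota>_1 \<iota>_minus)
  then have "card quartic_pos = card {x. (d * (d - x ^ 2)) ^ ?n = 1}"
    "card quartic_neg = card {x. (d * (d - x ^ 2)) ^ ?n = -1}"
    using \<iota>_inj by (simp_all add: card_image inj_on_subset)
  then have "2 * (int (card quartic_pos) - int (card quartic_neg)) = J.jac (-1)"
    using J.quartic_count[OF chi] by simp
  moreover have "J.jac (-1) = 2 \<or> J.jac (-1) = -2" by (rule J.jac_minus_1[OF prime_p a])
  ultimately show ?thesis by auto
qed

theorem theorem1p1:
  fixes p :: nat and a :: int and H :: "'f::{field,finite}^4^4"
  assumes "prime p"
    and "int p = 1 + 16 * a ^ 2"
    and "CARD('f) = p ^ 2"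
    and "CARD('k::{field,finite}) = p"
    and "nondeg_hermitian p H"
  shows "\<exists>M K. hemisystem p H M \<and>
           subgroup K (PGU p H) \<and>
           (\<forall>C\<in>K. preserves C M) \<and>
           (PGU p H)\<lparr>carrier := K\<rparr> \<cong>
             (PSL :: ('k^2^2) set monoid) \<times>\<times> integer_mod_group ((p + 1) div 2)"
proof -
  have "int p = 1 + 4 * (4 * a ^ 2)" using assms(2) by simp
  then have "int p mod 4 = 1" by presburger
  then have p4: "p mod 4 = 1" by presburger
  have p2: "p > 2" using p4 prime_gt_1_nat[OF assms(1)] by (cases "p = 2") auto
  have cf: "CHAR('f) = p" by (rule CHAR_of_CARD_prime_power[OF assms(1,3)])
  obtain \<iota> :: "'k \<Rightarrow> 'f" where \<iota>: "field_embedding \<iota>"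
    using prime_field_embedding[OF assms(1,4) cf] by blast
  then interpret field_embedding \<iota> .
  interpret J: odd_field p "TYPE('k)" by unfold_locales (use assms(4) p4 two_nz_of_CARD_prime[OF assms(1,4) p2] in auto)
  obtain d where d: "J.chi d = -1" by (rule J.nonsquare_exists)
  let ?h = "(p - 1) div 2"
  have "d ^ ?h = - 1" using J.of_int_chi[of d] d by simp
  then have dh: "\<iota> d ^ ?h = - 1" by (metis \<iota>_1 \<iota>_minus \<iota>_power)
  have ph: "p = 1 + 2 * ?h" using p4 by presburger
  \<comment> \<open>A non-square of the prime field has a square root in the larger field: raising
    the value \<open>-1\<close> of its character to the even power \<open>p + 1\<close> gives
    1.\<close>
  obtain \<delta> where \<delta>2: "\<delta> ^ 2 = \<iota> d"
  proof (rule power_eq_exists)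
    have "p ^ 2 - 1 = (p - 1) * (p + 1)" by (simp add: power2_eq_square algebra_simps)
    also have "p - 1 = 2 * ?h" using ph by simp
    finally show "CARD('f) - 1 = 2 * (?h * (p + 1))" using assms(3) by simp
    show "\<iota> d ^ (?h * (p + 1)) = 1" unfolding power_mult dh using ph by (metis even_add even_mult_iff even_numeral odd_one power_minus_even power_one)
    show "?h * (p + 1) > 0" using p2 by simp
  qed auto
  have \<delta>p: "\<delta> ^ p = - \<delta>"
  proof -
    have "\<delta> ^ p = \<delta> ^ (1 + 2 * ?h)" using ph by simp
    also have "\<dots> = \<delta> * (\<delta> ^ 2) ^ ?h" by (simp only: power_add power_one_right power_mult)
    finally show ?thesis using dh by (simp add: \<delta>2)
  qed
  have "\<delta> \<noteq> 0"
  proof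
    assume "\<delta> = 0"
    then have "\<iota> d = 0" using \<delta>2 by simp
    then show False using dh p2 by (simp add: power_0_left split: if_splits)
  qed
  then interpret E: quadratic_extension p \<delta>
    by unfold_locales (use assms(1,3) p4 \<delta>p in auto)
  obtain \<kappa> :: 'f where \<kappa>: "\<kappa> ^ 2 = -2"
    using E.square_iff[of "-2"] E.rational_power_half[of "-2"] by auto
  \<comment> \<open>\<open>quartic_pos\<close> and \<open>quartic_neg\<close> depend only on
    \<open>p\<close> and \<open>\<delta>\<close>; this auxiliary instance makes them available
    before \<open>\<kappa>'\<close> is chosen.\<close>
  interpret K0: hermitian_quads p \<delta> \<kappa> \<kappa> by unfold_locales (use \<kappa> in auto)
  define \<kappa>' where "\<kappa>' = (if int (card K0.quartic_pos) - int (card K0.quartic_neg) = - 1 then \<kappa> else - \<kappa>)"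
  have \<kappa>': "\<kappa>' ^ 2 = -2" using \<kappa> by (simp add: \<kappa>'_def)
  interpret K: hermitian_quads p \<delta> \<kappa> \<kappa>' by unfold_locales (use \<kappa> \<kappa>' in auto)
  interpret K: hermitian_quads_choice p \<delta> \<kappa> \<kappa>'
  proof unfold_locales
    have "- \<kappa> \<noteq> \<kappa>" using K0.eq_minus_self_iff[of \<kappa>] K0.\<kappa>_nz(1) by metis
    then show "int (card K0.quartic_pos) - int (card K0.quartic_neg) = (if \<kappa>' = \<kappa> then - 1 else 1)"
      using K0.quartic_difference[OF assms(4,2) \<iota> \<delta>2] by (auto simp: \<kappa>'_def)
  qed
  obtain \<zeta> :: 'f where \<zeta>: "\<zeta> ^ E.m = 1" "\<And>j. j < E.m \<Longrightarrow> \<zeta> ^ j = 1 \<Longrightarrow> j = 0"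
    by (rule E.primitive_torsion) blast
  obtain Q Q' where Q: "Q ** Q' = mat 1" "Q' ** Q = mat 1" "\<And>x y. hform p H (Q *v x) (Q *v y) = hform p K.H0 x y"
    using K.isometry_exists[OF assms(5)] by blast
  have rat: "\<iota> x ^ p = \<iota> x" for x using power_CARD_eq[of x] assms(4) by (simp flip: \<iota>_power)
  interpret S: surface_group p \<delta> \<kappa> \<kappa>' \<iota> \<zeta> H Q Q'
    by unfold_locales (fact rat \<zeta> Q)+
  show ?thesis by (rule S.surface_group_exists)
qed

end
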